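(* Let $l\ge 1$ be an integer, let $\Omega\subseteq\mathbb{R}^3$ be a bounded domain, and let $\lambda_1\le\lambda_2\le\cdots$ be the eigenvalues of the Dirichlet problem for the poly-Laplacian $(-\Delta)^l$ on $\Omega$. (1) If $l=1$, then for every integer $k\ge 1$ $$\sum_{i=1}^k\lambda_i\geq \frac{3}{5}\left(\frac{(2\pi)^3}{\omega_3 V } \right)^{\frac{2}{3}}k^{\frac{5}{3}}+\frac{1}{16}\frac{V}{I}k-\frac{11}{3840}\left(\frac{\omega_3^{\frac{1}{3}}}{2\pi}\right)^2\left(\frac{V^{\frac{4}{3}} }{I }\right)^2k^{\frac{1}{3}}+\frac{659}{6400000}\left( \frac{\omega_3^4}{4} \right)^{\frac{1}{3}}\frac{V^{\frac{13}{3}} }{(2\pi)^4I^3 }k^{-\frac{1}{3}}.$$ (2) If $l=2$, then for every integer $k\ge 1$ $$\sum_{i=1}^k\lambda_i\geq \frac{3}{7}\left(\frac{(2\pi)^3}{\omega_3 V} \right)^{\frac{4}{3}}k^{\frac{7}{3}}+\frac{\pi^2}{2\omega_3^{\frac{2}{3}}}\frac{V^{\frac{1}{3}} }{I }k^{\frac{5}{3}}-\frac{1}{256}\left(\frac{V }{I }\right)^2k+\frac{23}{580608}\frac{V^{\frac{11}{3}} }{(2\pi)^2 I^3 }k^{\frac{1}{3}}.$$ (3) If $l\geq 3$ and $k\ge 1$ is an integer with $k\geq \max\{k_1,k_2\}$, where $$k_1=\frac{2}{105}\max_{1\leq i\leq 2l}\left\{ \left( \frac{C^{i+1}_{2l+3}}{44C^i_{2l+3}}+\frac{1}{3}\right)^3,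 \left( \frac{C^{i+1}_{2l+2}}{44C^i_{2l+2}}+\frac{1}{3}\right)^3, \left( \frac{C^{i+1}_{2l+1}}{44C^i_{2l+1}}+\frac{1}{3}\right)^3 \right\},$$ $$k_2=\frac{2}{105}\max_{ 1\leq i\leq 2l } \left\{ \left( \frac{C^{i+1}_{2l+3}}{2C^i_{2l+3}}\right)^3, \left( \frac{C^{i+1}_{2l+2}}{2C^i_{2l+2}}\right)^3, \left( \frac{C^{i+1}_{2l+1}}{2C^i_{2l+1}}\right)^3\right\},$$ then $$\begin{aligned}\sum_{i=1}^k\lambda_i\geq{}& \frac{3}{(2l+3)\omega^{\frac{2l}{3}}_3}\alpha^{-\frac{2l}{3}}k^{\frac{2l+3}{3}}+\frac{4l\pi^6}{VI\,\omega^{\frac{2l-2}{3}}_3}\alpha^{\frac{8-2l}{3}}k^{\frac{2l+1}{3}}-\frac{(l+1)^2}{2\omega^{\frac{2l-3}{3}}_3\rho^3}\alpha^{\frac{12-2l}{3}}k^{\frac{2l}{3}}\\ &+\frac{(3l-2)(2l+1)(l+1)}{24\,\omega_3^{\frac{2l-4}{3}}\rho^4}\alpha^{\frac{16-2l}{3}}k^{\frac{2l-1}{3}}-\frac{(2l+1)(2l-1)(l+1)}{24\,\omega_3^{\frac{2l-5}{3}}\rho^5}\alpha^{\frac{20-2l}{3}}k^{\frac{2l-2}{3}}.\end{aligned}$$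
   Context: Eigenvalue problem: $(-\Delta)^l u=\lambda u$ in $\Omega$, $u=\frac{\partial u}{\partial\nu}=\cdots=\frac{\partial^{l-1}u}{\partial\nu^{l-1}}=0$ on $\partial\Omega$ (Dirichlet conditions, understood in the usual weak sense $u\in H^l_0(\Omega)$). The spectrum is real and discrete, $0<\lambda_1\le\lambda_2\le\cdots\to\infty$, each eigenvalue repeated according to its finite multiplicity. Notation: $V=V(\Omega)$ is the volume of $\Omega$; $\omega_3=\frac{4\pi}{3}$ is the volume of the unit ball of $\mathbb{R}^3$; $I=I(\Omega)=\int_\Omega|x|^2dx$; $\alpha=(2\pi)^{-3}V$; $\rho=2(2\pi)^{-3}\sqrt{VI}$; $C^m_a=\frac{a!}{m!(a-m)!}$ is the binomial coefficient. *)

theory Defs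
  imports "HOL-Analysis.Analysis"
begin

definition pderiv_at :: "'n \<Rightarrow> (real^'n \<Rightarrow> real) \<Rightarrow> real^'n \<Rightarrow> real" where
  "pderiv_at i f = (\<lambda>x. frechet_derivative f (at x) (axis i 1))"

text \<open>Mixed partial derivatives are indexed by lists of coordinate directions (rather than by
  multi-indices); a list of length \<open>m\<close> gives a derivative of order \<open>m\<close>.\<close>

definition iter_pderiv :: "'n list \<Rightarrow> (real^'n \<Rightarrow> real) \<Rightarrow> real^'n \<Rightarrow> real" where
  "iter_pderiv is f = foldr pderiv_at is f"

definition neg_laplacian :: "(real^'n \<Rightarrow> real) \<Rightarrow> real^'n \<Rightarrow> real" where
  "neg_laplacian f = (\<lambda>x. - (\<Sum>i\<in>UNIV. pderiv_at i (pderiv_at i f) x))"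

text \<open>Differentiability of all iterated partial derivatives (of every order, including order 0)
  forces them to be continuous, so this is \<open>C\<^sup>\<infinity>\<close> on the whole space.\<close>

definition smooth_fun :: "(real^'n \<Rightarrow> real) \<Rightarrow> bool" where
  "smooth_fun f \<longleftrightarrow> (\<forall>is x. iter_pderiv is f differentiable (at x))"

text \<open>\<open>C\<^sub>c\<^sup>\<infinity>(\<Omega>)\<close>, its elements being extended by \<open>0\<close> to the whole space.\<close>

definition test_funs :: "(real^'n) set \<Rightarrow> (real^'n \<Rightarrow> real) set" where
  "test_funs \<Omega> = {\<phi>. smooth_fun \<phi> \<and> compact (closure {x. \<phi> x \<noteq> 0}) \<and> closure {x. \<phi> x \<noteq> 0} \<subseteq> \<Omega>}"

text \<open>Elements of the spaces below are functions on the whole space of which only the values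
  on \<open>\<Omega>\<close> matter; functions that agree almost everywhere on \<open>\<Omega>\<close> are not identified.\<close>

definition L2 :: "(real^'n) set \<Rightarrow> (real^'n \<Rightarrow> real) set" where
  "L2 \<Omega> = {u \<in> borel_measurable (lebesgue_on \<Omega>). integrable (lebesgue_on \<Omega>) (\<lambda>x. (u x)\<^sup>2)}"

definition weak_pderiv ::
    "(real^'n) set \<Rightarrow> 'n list \<Rightarrow> (real^'n \<Rightarrow> real) \<Rightarrow> (real^'n \<Rightarrow> real) \<Rightarrow> bool" where
  "weak_pderiv \<Omega> is u v \<longleftrightarrow>
    (\<forall>\<phi>\<in>test_funs \<Omega>.
      (\<integral>x. u x * iter_pderiv is \<phi> x \<partial>lebesgue_on \<Omega>)
        = (- 1) ^ length is * (\<integral>x. v x * \<phi> x \<partial>lebesgue_on \<Omega>))"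

definition sobolev :: "nat \<Rightarrow> (real^'n) set \<Rightarrow> (real^'n \<Rightarrow> real) set" where
  "sobolev l \<Omega> = {u \<in> L2 \<Omega>. \<forall>is. length is \<le> l \<longrightarrow> (\<exists>v\<in>L2 \<Omega>. weak_pderiv \<Omega> is u v)}"

text \<open>\<open>H\<^sup>l\<^sub>0(\<Omega>)\<close>: the closure of the test functions in \<open>H\<^sup>l(\<Omega>)\<close>.\<close>

definition sobolev0 :: "nat \<Rightarrow> (real^'n) set \<Rightarrow> (real^'n \<Rightarrow> real) set" where
  "sobolev0 l \<Omega> = {u \<in> sobolev l \<Omega>.
    \<exists>\<phi> :: nat \<Rightarrow> real^'n \<Rightarrow> real.
      (\<forall>n. \<phi> n \<in> test_funs \<Omega>) \<and>
      (\<forall>is. \<forall>v\<in>L2 \<Omega>. length is \<le> l \<longrightarrow> weak_pderiv \<Omega> is u v \<longrightarrow>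
        (\<lambda>n. \<integral>x. (iter_pderiv is (\<phi> n) x - v x)\<^sup>2 \<partial>lebesgue_on \<Omega>) \<longlonglongrightarrow> 0)}"

text \<open>Weak solutions of \<open>(-\<Delta>)\<^sup>l u = \<mu> u\<close> in \<open>\<Omega>\<close>; the Dirichlet boundary conditions are
  expressed by membership in \<open>H\<^sup>l\<^sub>0(\<Omega>)\<close>.\<close>

definition dirichlet_eigenspace :: "nat \<Rightarrow> (real^'n) set \<Rightarrow> real \<Rightarrow> (real^'n \<Rightarrow> real) set" where
  "dirichlet_eigenspace l \<Omega> \<mu> = {u \<in> sobolev0 l \<Omega>.
    \<forall>\<phi>\<in>test_funs \<Omega>.
      (\<integral>x. u x * (neg_laplacian ^^ l) \<phi> x \<partial>lebesgue_on \<Omega>)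
        = \<mu> * (\<integral>x. u x * \<phi> x \<partial>lebesgue_on \<Omega>)}"

text \<open>\<open>E\<close> has dimension \<open>m\<close> modulo equality almost everywhere on \<open>\<Omega>\<close>, as witnessed by a basis.\<close>

definition has_ae_dim :: "(real^'n) set \<Rightarrow> (real^'n \<Rightarrow> real) set \<Rightarrow> nat \<Rightarrow> bool" where
  "has_ae_dim \<Omega> E m \<longleftrightarrow>
    (\<exists>u :: nat \<Rightarrow> real^'n \<Rightarrow> real.
      (\<forall>i<m. u i \<in> E) \<and>
      (\<forall>c :: nat \<Rightarrow> real. (AE x in lebesgue_on \<Omega>. (\<Sum>i<m. c i * u i x) = 0) \<longrightarrow> (\<forall>i<m. c i = 0)) \<and>
      (\<forall>v\<in>E. \<exists>c :: nat \<Rightarrow> real. AE x in lebesgue_on \<Omega>. v x = (\<Sum>i<m. c i * u i x)))"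

text \<open>\<open>\<lambda>\<^sub>1 \<le> \<lambda>\<^sub>2 \<le> \<dots>\<close> is the list of all eigenvalues, each repeated according to its
  multiplicity: every real \<open>\<mu>\<close> occurs as often as the dimension of its eigenspace (hence not at
  all if \<open>\<mu>\<close> is not an eigenvalue). Indices start at \<open>1\<close>; \<open>ev 0\<close> is irrelevant.\<close>

definition dirichlet_eigenvalues :: "nat \<Rightarrow> (real^'n) set \<Rightarrow> (nat \<Rightarrow> real) \<Rightarrow> bool" where
  "dirichlet_eigenvalues l \<Omega> ev \<longleftrightarrow>
    mono_on {1..} ev \<and>
    (\<forall>\<mu>. finite {i. 1 \<le> i \<and> ev i = \<mu>} \<and>
         has_ae_dim \<Omega> (dirichlet_eigenspace l \<Omega> \<mu>) (card {i. 1 \<le> i \<and> ev i = \<mu>}))"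

definition vol :: "(real^3) set \<Rightarrow> real" where
  "vol \<Omega> = measure lebesgue \<Omega>"

definition moment :: "(real^3) set \<Rightarrow> real" where
  "moment \<Omega> = (\<integral>x. (norm x)\<^sup>2 \<partial>lebesgue_on \<Omega>)"

definition omega3 :: real where
  "omega3 = 4 * pi / 3"

definition alpha :: "(real^3) set \<Rightarrow> real" where
  "alpha \<Omega> = vol \<Omega> / (2 * pi) ^ 3"

definition rho :: "(real^3) set \<Rightarrow> real" where
  "rho \<Omega> = 2 / (2 * pi) ^ 3 * sqrt (vol \<Omega> * moment \<Omega>)"

definition binom_ratio :: "nat \<Rightarrow> nat \<Rightarrow> real" where
  "binom_ratio a i = real (a choose (i + 1)) / real (a choose i)"

definition k1 :: "nat \<Rightarrow> real" where
  "k1 l = 2 / 105 * Max (\<Union>i\<in>{1..2*l}.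
     {(binom_ratio (2*l+3) i / 44 + 1/3) ^ 3,
      (binom_ratio (2*l+2) i / 44 + 1/3) ^ 3,
      (binom_ratio (2*l+1) i / 44 + 1/3) ^ 3})"

definition k2 :: "nat \<Rightarrow> real" where
  "k2 l = 2 / 105 * Max (\<Union>i\<in>{1..2*l}.
     {(binom_ratio (2*l+3) i / 2) ^ 3,
      (binom_ratio (2*l+2) i / 2) ^ 3,
      (binom_ratio (2*l+1) i / 2) ^ 3})"

end

theory Submission
  imports Defs "HOL-Probability.Characteristic_Functions"
begin

text \<open>Let \<open>F\<close> be the sum of the squared moduli of the unitary Fourier transforms of \<open>k\<close>
  orthonormal eigenfunctions. By Plancherel, \<open>F\<close> has integral \<open>k\<close> and \<open>\<integral> norm \<xi> ^ (2 * l) * F \<xi>\<close>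
  is at most the sum of the eigenvalues; by Bessel's inequality, \<open>0 \<le> F \<le> alpha\<close> and \<open>F\<close> is
  Lipschitz with constant \<open>rho\<close>. Among all such functions the moment is smallest for the radial
  trapezoid of height \<open>alpha\<close> and slope \<open>rho\<close>: along every ray the difference of \<open>F\<close> and the
  trapezoid can be compared with its value at one fixed radius, so no rearrangement is needed. The
  moment of the trapezoid is an explicit function of a root of a cubic equation, and the three
  bounds are obtained by expanding that root. The ratio of the width of the trapezoid to its
  radius is small because the ball minimises the moment of inertia among domains of given volume.\<close>

subsection \<open>Means of powers over an interval\<close>

text \<open>The ball that carries mass \<open>k\<close> at constant height
  \<open>alpha \<Omega>\<close> has radius \<tau> with
  \<open>omega3 * alpha \<Omega> * \<tau> ^ 3 = real k\<close>. In units of \<tau> the slope of the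
  trapezoid occupies the radii between \<open>x - h\<close> and \<open>x + h\<close>, and radial
  integration turns its mass into \<open>mean_pow 3 x h\<close> and its moment into
  \<open>mean_pow (2 * l + 3) x h\<close>. The mass condition is therefore the cubic
  \<open>x ^ 3 + x * h\<^sup>2 = 1\<close>, and every term of the three claims is, up to a numerical
  factor, one common positive quantity times a power of \<open>h\<close>. What remains is an
  inequality in the single small parameter \<open>h\<close>. The moment of inertia gives
  \<open>(2 * h) ^ 3 * real k \<le> 2 / 105\<close>; this bounds \<open>h\<close> for every
  \<open>k\<close> and turns \<open>k2 l \<le> real k\<close> into
  \<open>2 * h * (l + 1) \<le> 2\<close>. The eigenfunctions are only mean-square limits of test
  functions. The moment may drop in the limit, so Fatou is enough for it; the mass must not drop, so
  Plancherel has to survive the limit as an equality.\<close>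

definition mean_pow :: "nat \<Rightarrow> real \<Rightarrow> real \<Rightarrow> real" where
  "mean_pow n x h = ((x + h) ^ (n + 1) - (x - h) ^ (n + 1)) / (2 * h * (real n + 1))"

lemma mean_pow_scale:
  assumes "c \<noteq> 0"
  shows "mean_pow n (c * x) (c * h) = c ^ n * mean_pow n x h"
proof -
  have "(c * x + c * h) ^ (n + 1) - (c * x - c * h) ^ (n + 1)
      = c ^ (n + 1) * ((x + h) ^ (n + 1) - (x - h) ^ (n + 1))"
    by (metis right_diff_distrib distrib_left power_mult_distrib)
  then show ?thesis
    unfolding mean_pow_def using assms by (simp only: power_add power_one_right) simp
qed

lemma mean_pow_3: "h \<noteq> 0 \<Longrightarrow> mean_pow 3 x h = x ^ 3 + x * h\<^sup>2"
  by (simp add: mean_pow_def field_simps) algebra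

lemma mean_pow_5: "h \<noteq> 0 \<Longrightarrow> mean_pow 5 x h = x ^ 5 + 10 / 3 * x ^ 3 * h\<^sup>2 + x * h ^ 4"
  by (simp add: mean_pow_def field_simps) algebra

lemma mean_pow_6: "h \<noteq> 0 \<Longrightarrow> mean_pow 6 x h = x ^ 6 + 5 * x ^ 4 * h\<^sup>2 + 3 * x\<^sup>2 * h ^ 4 + h ^ 6 / 7"
  by (simp add: mean_pow_def field_simps) algebra

lemma mean_pow_7: "h \<noteq> 0 \<Longrightarrow>
    mean_pow 7 x h = x ^ 7 + 7 * x ^ 5 * h\<^sup>2 + 7 * x ^ 3 * h ^ 4 + x * h ^ 6"
  by (simp add: mean_pow_def field_simps) algebra

lemma mean_pow_9: "h \<noteq> 0 \<Longrightarrow>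
    mean_pow 9 x h = x ^ 9 + 12 * x ^ 7 * h\<^sup>2 + 126 / 5 * x ^ 5 * h ^ 4 + 12 * x ^ 3 * h ^ 6 + x * h ^ 8"
  by (simp add: mean_pow_def field_simps) algebra

section \<open>The root of the normalised mass equation\<close>

text \<open>The left side of the cubic increases with \<open>x\<close> and equals
  \<open>1 - d ^ 3\<close> at \<open>1 - d\<close>, so the error is of third order only. Here and
  below \<open>d\<close> stands for \<open>h\<^sup>2 / 3\<close>, which makes the cubic the equation
  \<open>mean_pow 3 x h = 1\<close>.\<close>

lemma cubic_root_lower:
  fixes x d :: real
  assumes eq: "x ^ 3 + 3 * x * d = 1" and d: "0 \<le> d" "d < 1"
  shows "1 - d \<le> x"
proof (rule ccontr)
  assume "\<not> 1 - d \<le> x"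
  then have lt: "x < 1 - d" by simp
  have "x > 0"
  proof (rule ccontr)
    assume "\<not> x > 0"
    then have "x ^ 3 \<le> 0" "x * d \<le> 0" using d by (auto simp: power3_eq_cube mult_nonpos_nonneg mult_nonneg_nonpos zero_le_mult_iff)
    then show False using eq by linarith
  qed
  then have "x ^ 3 < (1 - d) ^ 3" "x * d \<le> (1 - d) * d"
    using lt d by (auto intro!: power_strict_mono mult_right_mono)
  moreover have "(1 - d) ^ 3 + 3 * ((1 - d) * d) = 1 - d ^ 3" by algebra
  moreover have "d ^ 3 \<ge> 0" using d by simp
  ultimately show False using eq by linarith
qed

text \<open>At \<open>1 - d + d\<^sup>2\<close> the left side exceeds 1 by about
  \<open>3 * d\<^sup>2\<close>. The expansion of the root has no second-order term; the added
  \<open>d\<^sup>2\<close> is a crude margin, good enough for the one upper estimate, that of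
  \<open>mean_pow 6\<close>.\<close>

lemma cubic_root_upper:
  fixes x d :: real
  assumes eq: "x ^ 3 + 3 * x * d = 1" and d: "0 \<le> d" "d \<le> 1/10"
  shows "x \<le> 1 - d + d\<^sup>2"
proof (rule ccontr)
  define y where "y = 1 - d + d\<^sup>2"
  assume "\<not> x \<le> 1 - d + d\<^sup>2"
  then have lt: "y < x" by (simp add: y_def)
  have y: "y \<ge> 0" using d by (auto simp: y_def)
  have "y ^ 3 < x ^ 3" using lt y by (intro power_strict_mono) auto
  moreover have "y * d \<le> x * d" using lt d by (intro mult_right_mono) auto
  moreover have "y ^ 3 + 3 * (y * d) = 1 + d\<^sup>2 * (3 - 4 * d + d\<^sup>2 * (6 - 3 * d + d\<^sup>2))"
    unfolding y_def by algebra
  moreover have "d\<^sup>2 * (3 - 4 * d + d\<^sup>2 * (6 - 3 * d + d\<^sup>2)) \<ge> 0"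
    using d by (intro mult_nonneg_nonneg add_nonneg_nonneg) auto
  ultimately show False using eq by linarith
qed

text \<open>Reduction modulo the cubic leaves a quadratic in \<open>x\<close> that increases from
  \<open>1 - d\<close> on; the right-hand side is its exact value at \<open>1 - d\<close>. Inserting
  \<open>1 - d\<close> without the reduction would give \<open>33/5\<close> instead of
  \<open>36/5\<close> in front of \<open>d ^ 3\<close>, too little for the last term of the case
  \<open>l = 1\<close>.\<close>

lemma mean_pow_5_lower:
  fixes x h :: real
  assumes h: "0 < h" "h\<^sup>2 \<le> 3/100" and eq: "mean_pow 3 x h = 1"
  shows "3/5 * mean_pow 5 x h \<ge> 3/5 + h\<^sup>2 - 11/15 * h ^ 4 + 4/15 * h ^ 6"
proof -
  define d where "d = h\<^sup>2 / 3"
  have d: "0 \<le> d" "d \<le> 1/100" using h by (auto simp: d_def)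
  have h2: "h\<^sup>2 = 3 * d" "h ^ 4 = 9 * d\<^sup>2" "h ^ 6 = 27 * d ^ 3"
    by (auto simp: d_def power_divide power_mult[symmetric])
  have x3: "x ^ 3 + 3 * x * d = 1" using eq h by (simp add: mean_pow_3 h2)
  have x: "1 - d \<le> x" using cubic_root_lower[OF x3] d by simp
  have "3/5 * mean_pow 5 x h = 3/5 * x^5 + 6 * d * x ^ 3 + 27/5 * d\<^sup>2 * x"
    using h by (simp add: mean_pow_5 h2)
  also have "\<dots> = 3/5 * x\<^sup>2 + 21/5 * d - 36/5 * d\<^sup>2 * x"
    using x3 by algebra
  finally have 1: "3/5 * mean_pow 5 x h = 3/5 * x\<^sup>2 + 21/5 * d - 36/5 * d\<^sup>2 * x" .
  have "3/5 * x\<^sup>2 - 36/5 * d\<^sup>2 * x - (3/5 * (1-d)\<^sup>2 - 36/5 * d\<^sup>2 * (1-d))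
      = (x - (1 - d)) * (3/5 * (x + 1 - d) - 36/5 * d\<^sup>2)" by algebra
  moreover have "\<dots> \<ge> 0"
  proof -
    have "d\<^sup>2 \<le> d" using d by (simp add: power2_eq_square mult_left_le)
    then have "3/5 * (x + 1 - d) - 36/5 * d\<^sup>2 \<ge> 0" using d x by (simp add: algebra_simps)
    then show ?thesis using x by simp
  qed
  moreover have "3/5 * (1-d)\<^sup>2 - 36/5 * d\<^sup>2 * (1-d) + 21/5 * d = 3/5 + 3 * d - 33/5 * d\<^sup>2 + 36/5 * d ^ 3"
    by algebra
  ultimately show ?thesis unfolding 1 h2 by linarith
qed

text \<open>All coefficients of \<open>mean_pow 7\<close> as a polynomial in \<open>x\<close> are
  nonnegative, so \<open>1 - d\<close> can be inserted directly. The third-order coefficient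
  obtained is \<open>39/7\<close>; lowering it to \<open>36/7\<close>, which is \<open>12/63\<close>
  in front of \<open>h ^ 6\<close>, absorbs the negative term of fourth order.\<close>

lemma mean_pow_7_lower:
  fixes x h :: real
  assumes h: "0 < h" "h\<^sup>2 \<le> 3/100" and eq: "mean_pow 3 x h = 1"
  shows "3/7 * mean_pow 7 x h \<ge> 3/7 + 2 * h\<^sup>2 - h ^ 4 + 12/63 * h ^ 6"
proof -
  define d where "d = h\<^sup>2 / 3"
  have d: "0 \<le> d" "d \<le> 1/100" using h by (auto simp: d_def)
  have h2: "h\<^sup>2 = 3 * d" "h ^ 4 = 9 * d\<^sup>2" "h ^ 6 = 27 * d ^ 3"
    by (auto simp: d_def power_divide power_mult[symmetric])
  have x3: "x ^ 3 + 3 * x * d = 1" using eq h by (simp add: mean_pow_3 h2)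
  have x: "1 - d \<le> x" using cubic_root_lower[OF x3] d by simp
  have x0: "1 - d \<ge> 0" using d by simp
  have "3/7 * mean_pow 7 x h = 3/7 * x^7 + 9 * d * x ^ 5 + 27 * d\<^sup>2 * x ^ 3 + 81/7 * d ^ 3 * x"
    using h by (simp add: mean_pow_7 h2)
  also have "\<dots> \<ge> 3/7 * (1-d)^7 + 9 * d * (1-d) ^ 5 + 27 * d\<^sup>2 * (1-d) ^ 3 + 81/7 * d ^ 3 * (1-d)"
    using d x x0 by (intro add_mono mult_left_mono power_mono) auto
  finally have 1: "3/7 * mean_pow 7 x h \<ge>
      3/7 * (1-d)^7 + 9 * d * (1-d) ^ 5 + 27 * d\<^sup>2 * (1-d) ^ 3 + 81/7 * d ^ 3 * (1-d)" .
  have 2: "3/7 * (1-d)^7 + 9 * d * (1-d) ^ 5 + 27 * d\<^sup>2 * (1-d) ^ 3 + 81/7 * d ^ 3 * (1-d)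
     = 3/7 + 6 * d - 9 * d\<^sup>2 + d ^ 3 * (39/7 - 39/7 * d) + d ^ 5 * (9 - 6 * d - 3/7 * d\<^sup>2)"
    by algebra
  have "d\<^sup>2 \<le> d" using d by (simp add: power2_eq_square mult_left_le)
  then have "9 - 6 * d - 3/7 * d\<^sup>2 \<ge> 0" using d by linarith
  then have 3: "d ^ 5 * (9 - 6 * d - 3/7 * d\<^sup>2) \<ge> 0" using d by simp
  have "d ^ 3 * (39/7 - 39/7 * d) \<ge> d ^ 3 * (36/7)" using d by (intro mult_left_mono) auto
  then show ?thesis using 1 2 3 unfolding h2 by linarith
qed

section \<open>Powers of degree at least nine\<close>

text \<open>The fourth derivative of \<open>t powr q\<close> carries the factor
  \<open>q * (q - 1) * (q - 2) * (q - 3)\<close>, nonnegative for \<open>q \<ge> 3\<close>. The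
  Lagrange remainder multiplies it by the even power \<open>(p - 1) ^ 4\<close>, so it has the same
  sign on both sides of 1.\<close>

lemma powr_ge_cubic_taylor:
  fixes p q :: real
  assumes p: "p > 0" and q: "q \<ge> 3"
  shows "p powr q \<ge> 1 + q * (p - 1) + q * (q - 1) / 2 * (p - 1)\<^sup>2 + q * (q - 1) * (q - 2) / 6 * (p - 1) ^ 3"
proof (cases "p = 1")
  case False
  define D where "D k t = (\<Prod>i<k. q - real i) * t powr (q - real k)" for k t
  have der: "(D k has_real_derivative D (Suc k) t) (at t)" if "t > 0" for k t
  proof -
    have "((\<lambda>t. (\<Prod>i<k. q - real i) * t powr (q - real k)) has_real_derivative
       (\<Prod>i<k. q - real i) * ((q - real k) * t powr (q - real k - 1))) (at t)"
      using that by (auto intro!: derivative_eq_intros)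
    then show ?thesis unfolding D_def[abs_def] by (simp add: algebra_simps)
  qed
  have "\<exists>t. (if p < 1 then p < t \<and> t < 1 else 1 < t \<and> t < p) \<and>
      p powr q = (\<Sum>m<4. D m 1 / fact m * (p - 1) ^ m) + D 4 t / fact 4 * (p - 1) ^ 4"
    by (rule Taylor[where a = "min p 1" and b = "max p 1"])
      (use p False in \<open>auto simp: D_def[of 0] intro!: der\<close>)
  then obtain t where t: "t > 0" and
    eq: "p powr q = (\<Sum>m<4. D m 1 / fact m * (p - 1) ^ m) + D 4 t / fact 4 * (p - 1) ^ 4"
    using p by (smt (verit, best))
  have "D 4 t = q * (q - 1) * (q - 2) * (q - 3) * t powr (q - 4)"
    by (simp add: D_def numeral_eq_Suc algebra_simps)
  then have "D 4 t \<ge> 0" using q by simp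
  moreover have "(\<Sum>m<4. D m 1 / fact m * (p - 1) ^ m) =
     1 + q * (p - 1) + q * (q - 1) / 2 * (p - 1)\<^sup>2 + q * (q - 1) * (q - 2) / 6 * (p - 1) ^ 3"
    by (simp add: D_def numeral_eq_Suc)
  ultimately show ?thesis unfolding eq by simp
qed simp

text \<open>A pointwise inequality is averaged over the interval from \<open>x - h\<close> to
  \<open>x + h\<close>; \<open>G\<close> is an antiderivative of the difference of its two sides.
  The exponents are multiples of three because the minorant to be used is a cubic polynomial in
  \<open>u ^ 3\<close>.\<close>

lemma mean_pow_mono:
  fixes x h c0 c3 c6 c9 :: real
  assumes h: "0 < h" "h < x"
    and ge: "\<And>u. u > 0 \<Longrightarrow> u ^ n \<ge> c0 + c3 * u ^ 3 + c6 * u ^ 6 + c9 * u ^ 9"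
  shows "mean_pow n x h \<ge> c0 + c3 * mean_pow 3 x h + c6 * mean_pow 6 x h + c9 * mean_pow 9 x h"
proof -
  define G where "G u = u ^ (n+1) / (real n + 1) - c0 * u - c3 * u ^ 4 / 4 - c6 * u ^ 7 / 7 - c9 * u ^ 10 / 10"
    for u :: real
  have "G (x - h) \<le> G (x + h)"
  proof (rule DERIV_nonneg_imp_nondecreasing[of "x - h" "x + h" G])
    fix u assume u: "x - h \<le> u" "u \<le> x + h"
    have "(G has_real_derivative (real (n + 1) * u ^ (n + 1 - 1) / (real n + 1) - c0 - c3 * (4 * u ^ 3) / 4
        - c6 * (7 * u ^ 6) / 7 - c9 * (10 * u ^ 9) / 10)) (at u)"
      unfolding G_def by (rule derivative_eq_intros refl | simp)+
    moreover have "real (n + 1) * u ^ (n + 1 - 1) / (real n + 1) - c0 - c3 * (4 * u ^ 3) / 4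
        - c6 * (7 * u ^ 6) / 7 - c9 * (10 * u ^ 9) / 10 = u ^ n - (c0 + c3 * u ^ 3 + c6 * u ^ 6 + c9 * u ^ 9)"
      by (simp add: add.commute[of 1])
    moreover have "u ^ n - (c0 + c3 * u ^ 3 + c6 * u ^ 6 + c9 * u ^ 9) \<ge> 0" using ge[of u] u h by simp
    ultimately show "\<exists>y. (G has_real_derivative y) (at u) \<and> y \<ge> 0" by metis
  qed (use h in auto)
  then have "0 \<le> (G (x + h) - G (x - h)) / (2 * h)" using h by simp
  also have "\<dots> = mean_pow n x h - c0 - c3 * mean_pow 3 x h - c6 * mean_pow 6 x h - c9 * mean_pow 9 x h"
    using h by (simp add: G_def mean_pow_def divide_simps) (simp add: algebra_simps)
  finally show ?thesis by simp
qed

text \<open>The linear coefficients 27 here and 9 in \<open>mean_pow_6_upper\<close> are the exact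
  first-order ones. They cancel in the mean of \<open>(u ^ 3 - 1) ^ 3\<close>, whose sign is thus
  decided by second-order terms; the exact \<open>54/5\<close> is lowered to 9 to absorb the higher
  powers.\<close>

lemma mean_pow_9_lower:
  fixes x d h :: real
  assumes h: "0 < h" and d: "d = h\<^sup>2 / 3" "d \<le> 1/100" and x: "1 - d \<le> x"
  shows "mean_pow 9 x h \<ge> 1 + 27 * d + 9 * d\<^sup>2"
proof -
  have d0: "0 \<le> d" unfolding d(1) by simp
  have h2: "h\<^sup>2 = 3 * d" "h ^ 4 = 9 * d\<^sup>2" "h ^ 6 = 27 * d ^ 3" "h ^ 8 = 81 * d ^ 4"
    by (auto simp: d power_divide power_mult[symmetric])
  have x0: "1 - d \<ge> 0" using d by simp
  have "mean_pow 9 x h = x ^ 9 + 36 * d * x ^ 7 + 1134/5 * d\<^sup>2 * x ^ 5 + 324 * d ^ 3 * x ^ 3 + 81 * d ^ 4 * x"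
    using h by (simp add: mean_pow_9 h2)
  also have "\<dots> \<ge> (1-d) ^ 9 + 36 * d * (1-d) ^ 7 + 1134/5 * d\<^sup>2 * (1-d) ^ 5 + 324 * d ^ 3 * (1-d) ^ 3 + 81 * d ^ 4 * (1-d)"
    using d0 x x0 by (intro add_mono mult_left_mono power_mono) auto
  finally have 1: "mean_pow 9 x h \<ge> (1-d) ^ 9 + 36 * d * (1-d) ^ 7 + 1134/5 * d\<^sup>2 * (1-d) ^ 5 + 324 * d ^ 3 * (1-d) ^ 3 + 81 * d ^ 4 * (1-d)" .
  have 2: "(1-d) ^ 9 + 36 * d * (1-d) ^ 7 + 1134/5 * d\<^sup>2 * (1-d) ^ 5 + 324 * d ^ 3 * (1-d) ^ 3 + 81 * d ^ 4 * (1-d)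
    = 1 + 27 * d + d\<^sup>2 * (54/5 - 138 * d) + d ^ 4 * (243 - 243 * d) + d ^ 6 * (138 - 54/5 * d - 27 * d\<^sup>2 - d ^ 3)"
    by algebra
  have "d\<^sup>2 \<le> d" "d ^ 3 \<le> d" using d0 d(2) power_decreasing[of 1 3 d] by (auto simp: power2_eq_square mult_left_le)
  then have "d ^ 6 * (138 - 54/5 * d - 27 * d\<^sup>2 - d ^ 3) \<ge> 0" "d ^ 4 * (243 - 243 * d) \<ge> 0"
    using d(2) d0 by (auto intro!: mult_nonneg_nonneg)
  moreover have "d\<^sup>2 * (54/5 - 138 * d) \<ge> d\<^sup>2 * 9" using d(2) by (intro mult_left_mono) auto
  ultimately show ?thesis using 1 2 by linarith
qed

lemma mean_pow_6_upper:
  fixes x d h :: real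
  assumes h: "0 < h" and d: "d = h\<^sup>2 / 3" "d \<le> 1/100" and x: "0 \<le> x" "x \<le> 1 - d + d\<^sup>2"
  shows "mean_pow 6 x h \<le> 1 + 9 * d"
proof -
  have d0: "0 \<le> d" unfolding d(1) by simp
  have h2: "h\<^sup>2 = 3 * d" "h ^ 4 = 9 * d\<^sup>2" "h ^ 6 = 27 * d ^ 3"
    by (auto simp: d power_divide power_mult[symmetric])
  define y where "y = 1 - d + d\<^sup>2"
  have "mean_pow 6 x h = x ^ 6 + 15 * d * x ^ 4 + 27 * d\<^sup>2 * x\<^sup>2 + 27/7 * d ^ 3"
    using h by (simp add: mean_pow_6 h2)
  also have "\<dots> \<le> y ^ 6 + 15 * d * y ^ 4 + 27 * d\<^sup>2 * y\<^sup>2 + 27/7 * d ^ 3"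
    using d0 x unfolding y_def[symmetric] by (intro add_mono mult_left_mono power_mono) auto
  also have "\<dots> = 1 + 9 * d - d\<^sup>2 * (12 - 349/7 * d) - d ^ 4 * (69 - 105 * d)
      - d ^ 6 * (72 - 24 * d - 30 * d\<^sup>2) - d ^ 9 * (35 - 21 * d) - d ^ 11 * (6 - d)"
    unfolding y_def by algebra
  also have "\<dots> \<le> 1 + 9 * d"
  proof -
    have "d\<^sup>2 \<le> d" using d0 d(2) by (simp add: power2_eq_square mult_left_le)
    then have "d\<^sup>2 * (12 - 349/7 * d) \<ge> 0" "d ^ 4 * (69 - 105 * d) \<ge> 0"
      "d ^ 6 * (72 - 24 * d - 30 * d\<^sup>2) \<ge> 0" "d ^ 9 * (35 - 21 * d) \<ge> 0" "d ^ 11 * (6 - d) \<ge> 0"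
      using d0 d(2) by (auto intro!: mult_nonneg_nonneg)
    then show ?thesis by linarith
  qed
  finally show ?thesis .
qed

text \<open>With \<open>q = real n / 3\<close> one has \<open>u ^ n = (u ^ 3) powr q\<close>.
  Expansion at \<open>u ^ 3 = 1\<close> is the natural one, since the mean of \<open>u ^ 3\<close>
  is 1 and the linear term averages to zero. The means of the square and the cube of
  \<open>u ^ 3 - 1\<close> remain; with \<open>c3 \<ge> c2 / 3\<close> the terms in
  \<open>mean_pow 6\<close> cancel and \<open>c2 * (mean_pow 9 x h - 1) / 3\<close> is left. The
  resulting coefficient of \<open>h\<^sup>2\<close> is the exact first-order one. For
  \<open>n = 2 * l + 3\<close> the condition \<open>n \<ge> 9\<close> says
  \<open>l \<ge> 3\<close>.\<close>

lemma mean_pow_lower: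
  fixes x h :: real
  assumes h: "0 < h" "h\<^sup>2 \<le> 3/100" and eq: "mean_pow 3 x h = 1" and n: "n \<ge> 9"
  shows "mean_pow n x h \<ge> 1 + real n * (real n - 3) / 6 * h\<^sup>2"
proof -
  define d where "d = h\<^sup>2 / 3"
  define q where "q = real n / 3"
  have q: "q \<ge> 3" using n by (simp add: q_def)
  have d: "0 \<le> d" "d \<le> 1/100" using h by (auto simp: d_def)
  have x3: "x ^ 3 + 3 * x * d = 1" using eq h by (simp add: mean_pow_3 d_def)
  have x: "1 - d \<le> x" "x \<le> 1 - d + d\<^sup>2"
    using cubic_root_lower[OF x3] cubic_root_upper[OF x3] d by simp_all
  \<comment> \<open>This keeps the averaging interval inside the positive half-line, where
    \<open>u ^ n\<close> may be written with \<open>powr\<close>.\<close>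
  have "h < x"
  proof -
    have "h\<^sup>2 < (1/2)\<^sup>2" using h(2) by (simp add: power2_eq_square)
    then have "h < 1/2" using power2_less_imp_less by fastforce
    then show ?thesis using x d by simp
  qed
  define c2 c3 where "c2 = q * (q - 1) / 2" and "c3 = q * (q - 1) * (q - 2) / 6"
  have "u ^ n \<ge> (1 - q + c2 - c3) + (q - 2 * c2 + 3 * c3) * u ^ 3 + (c2 - 3 * c3) * u ^ 6 + c3 * u ^ 9"
    if "u > 0" for u :: real
  proof -
    have "(u ^ 3) powr q = u ^ n"
    proof -
      have "(u ^ 3) powr q = (u powr real 3) powr q" using that by (simp add: powr_realpow)
      also have "\<dots> = u powr real n" by (simp only: powr_powr) (simp add: q_def)
      finally show ?thesis using that by (simp add: powr_realpow)
    qed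
    moreover have "1 + q * (u^3 - 1) + c2 * (u^3 - 1)\<^sup>2 + c3 * (u^3 - 1) ^ 3 =
      (1 - q + c2 - c3) + (q - 2 * c2 + 3 * c3) * u ^ 3 + (c2 - 3 * c3) * u ^ 6 + c3 * u ^ 9"
      by algebra
    moreover have "(u ^ 3) powr q \<ge> 1 + q * (u^3 - 1) + c2 * (u^3 - 1)\<^sup>2 + c3 * (u^3 - 1) ^ 3"
      using powr_ge_cubic_taylor[of "u ^ 3" q] that q by (simp add: c2_def c3_def)
    ultimately show ?thesis by linarith
  qed
  from mean_pow_mono[OF h(1) \<open>h < x\<close> this]
  have "mean_pow n x h \<ge> (1 - q + c2 - c3) + (q - 2 * c2 + 3 * c3) * mean_pow 3 x h
      + (c2 - 3 * c3) * mean_pow 6 x h + c3 * mean_pow 9 x h" .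
  also have "(1 - q + c2 - c3) + (q - 2 * c2 + 3 * c3) * mean_pow 3 x h
      + (c2 - 3 * c3) * mean_pow 6 x h + c3 * mean_pow 9 x h
     = 1 + c2 * (mean_pow 6 x h - 1) + c3 * (mean_pow 9 x h - 3 * mean_pow 6 x h + 2)"
    unfolding eq by (simp add: algebra_simps)
  finally have 1: "mean_pow n x h \<ge> 1 + c2 * (mean_pow 6 x h - 1) + c3 * (mean_pow 9 x h - 3 * mean_pow 6 x h + 2)" .
  have M9: "mean_pow 9 x h \<ge> 1 + 27 * d + 9 * d\<^sup>2"
    using mean_pow_9_lower[OF h(1) d_def d(2) x(1)] .
  have M6: "mean_pow 6 x h \<le> 1 + 9 * d"
    using mean_pow_6_upper[OF h(1) d_def d(2) _ x(2)] x(1) d by simp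
  \<comment> \<open>The upper bound for \<open>mean_pow 6\<close> enters only here: the mean of the
    cube is nonnegative, which allows \<open>c3\<close> to be replaced by the smaller
    \<open>c2 / 3\<close>.\<close>
  have A3: "mean_pow 9 x h - 3 * mean_pow 6 x h + 2 \<ge> 0" using M9 M6 zero_le_power2[of d] by linarith
  have "c3 = c2 * ((q - 2) / 3)" by (simp add: c2_def c3_def)
  moreover have c2: "c2 \<ge> 0" using q by (simp add: c2_def)
  ultimately have "c3 \<ge> c2 * (1/3)" using q mult_left_mono[of "1/3" "(q - 2) / 3" c2] by simp
  then have "c3 * (mean_pow 9 x h - 3 * mean_pow 6 x h + 2) \<ge> c2 * (1/3) * (mean_pow 9 x h - 3 * mean_pow 6 x h + 2)"
    using A3 by (rule mult_right_mono)
  moreover have eq6: "c2 * (mean_pow 6 x h - 1) + c2 * (1/3) * (mean_pow 9 x h - 3 * mean_pow 6 x h + 2)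
      = c2 * ((mean_pow 9 x h - 1) / 3)" by (simp add: algebra_simps)
  moreover have "mean_pow 9 x h \<ge> 1 + 27 * d" using M9 zero_le_power2[of d] by linarith
  then have ge9: "c2 * ((mean_pow 9 x h - 1) / 3) \<ge> c2 * (9 * d)"
    using c2 by (intro mult_left_mono) auto
  moreover have "c2 * (9 * d) = real n * (real n - 3) / 6 * h\<^sup>2"
    by (simp add: c2_def q_def d_def field_simps)
  ultimately show ?thesis using 1 ge9 by linarith
qed

subsection \<open>The bathtub principle for Lipschitz functions\<close>

lemma integrable_lborel_affine_iff:
  fixes f :: "'a::euclidean_space \<Rightarrow> real"
  assumes [measurable]: "f \<in> borel_measurable borel" and c: "c \<noteq> 0"
  shows "integrable lborel (\<lambda>x. f (t + c *\<^sub>R x)) \<longleftrightarrow> integrable lborel f"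
  by (subst (2) lborel_affine[OF c, of t]) (simp add: integrable_density integrable_distr_eq c)

lemma integral_lborel_affine:
  fixes f :: "'a::euclidean_space \<Rightarrow> real"
  assumes [measurable]: "f \<in> borel_measurable borel" and c: "c \<noteq> 0"
  shows "integral\<^sup>L lborel f = \<bar>c\<bar> ^ DIM('a) * (LBINT x. f (t + c *\<^sub>R x))"
  by (subst lborel_affine[OF c, of t]) (simp add: integral_density integral_distr)

lemma integrable_ball_bounded:
  fixes f :: "real^3 \<Rightarrow> real"
  assumes "f \<in> borel_measurable borel" and "\<And>x. x \<in> ball 0 r \<Longrightarrow> \<bar>f x\<bar> \<le> B"
  shows "integrable lborel (\<lambda>x. indicator (ball 0 r) x * f x)"
proof -
  have "emeasure lborel (ball (0::real^3) r) < \<infinity>"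
    by (rule emeasure_bounded_finite) simp
  then show ?thesis
    using integrableI_bounded_set_indicator[of "ball 0 r" lborel f B] assms by auto
qed

lemma measure_ball3: "r \<ge> 0 \<Longrightarrow> measure lborel (ball (0::real^3) r) = omega3 * r ^ 3"
  by (simp add: omega3_def content_ball unit_ball_vol_3)

lemma homogeneous_ball_scale:
  fixes H :: "real^3 \<Rightarrow> real"
  assumes [measurable]: "H \<in> borel_measurable borel"
    and hom: "\<And>t x. t > 0 \<Longrightarrow> H (t *\<^sub>R x) = H x"
    and r: "r > 0"
  shows "(LBINT x. indicator (ball 0 r) x * (norm x ^ n * H x))
     = r ^ (n + 3) * (LBINT x. indicator (ball 0 1) x * (norm x ^ n * H x))"
proof -
  have "(LBINT x. indicator (ball 0 r) x * (norm x ^ n * H x))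
    = \<bar>r\<bar> ^ DIM(real^3) * (LBINT x. indicator (ball 0 r) (0 + r *\<^sub>R x) * (norm (0 + r *\<^sub>R x) ^ n * H (0 + r *\<^sub>R x)))"
    using r by (intro integral_lborel_affine) (measurable, auto)
  also have "(\<lambda>x. indicator (ball 0 r) (0 + r *\<^sub>R x) * (norm (0 + r *\<^sub>R x) ^ n * H (0 + r *\<^sub>R x)))
      = (\<lambda>x. r ^ n * (indicator (ball 0 1) x * (norm x ^ n * H x)))"
    using r by (auto simp: hom indicator_def power_mult_distrib fun_eq_iff)
  finally show ?thesis using r by (simp add: power_add)
qed

text \<open>This is the radial integration of polar coordinates, obtained from scaling alone.
  Scaling gives \<open>I n r = r ^ (n + 3) * I n 1\<close>. On a thin shell around radius 1 the
  weight \<open>norm x ^ n\<close> is close to 1, so \<open>I n\<close> and \<open>I 0\<close> have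
  the same derivative at 1; comparing the two yields
  \<open>(real n + 3) * I n 1 = 3 * I 0 1\<close>.\<close>

lemma homogeneous_ball_moment:
  fixes H :: "real^3 \<Rightarrow> real"
  assumes [measurable]: "H \<in> borel_measurable borel"
    and hom: "\<And>t x. t > 0 \<Longrightarrow> H (t *\<^sub>R x) = H x"
    and bnd: "\<And>x. \<bar>H x\<bar> \<le> B" and r: "r \<ge> 0"
  shows "(LBINT x. indicator (ball 0 r) x * (norm x ^ n * H x))
    = 3 / (real n + 3) * r ^ (n + 3) * (LBINT x. indicator (ball 0 1) x * H x)"
proof -
  define I where "I n r = (LBINT x. indicator (ball 0 r) x * (norm x ^ n * H x))" for n r
  have scale: "I n r = r ^ (n + 3) * I n 1" if "r > 0" for n r
    unfolding I_def using that by (intro homogeneous_ball_scale hom) auto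
  have B: "B \<ge> 0" using bnd[of 0] by linarith
  have int: "integrable lborel (\<lambda>x. indicator (ball 0 r) x * (norm x ^ n * H x))" for n r
  proof (rule integrable_ball_bounded[where B = "r ^ n * B"])
    fix x :: "real^3" assume "x \<in> ball 0 r"
    then have "norm x ^ n \<le> r ^ n" "0 \<le> r" by (auto intro!: power_mono intro: less_imp_le order_le_less_trans[OF norm_ge_zero])
    then show "\<bar>norm x ^ n * H x\<bar> \<le> r ^ n * B"
      using bnd[of x] B by (auto simp: abs_mult intro!: mult_mono)
  qed simp
  have int1: "integrable lborel (\<lambda>x::real^3. indicator (ball 0 r) x :: real)" for r :: real
    using integrable_ball_bounded[of "\<lambda>_. 1" r 1] by auto
  \<comment> \<open>By scaling, \<open>f r\<close> is the integral of
    \<open>(norm x ^ n - 1) * H x\<close> over the shell between the radii 1 and \<open>r\<close>.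
    Both the weight and the volume of the shell vanish at \<open>r = 1\<close>, hence
    \<open>f\<close> is of smaller order than \<open>r - 1\<close>.\<close>
  define f where "f r = (r ^ (n + 3) - 1) * I n 1 - (r ^ 3 - 1) * I 0 1" for r
  have bound: "\<bar>f r\<bar> \<le> (r ^ n - 1) * B * (omega3 * (r ^ 3 - 1))" if r: "r > 1" for r
  proof -
    have "f r = I n r - I n 1 - (I 0 r - I 0 1)"
    proof -
      have "I n r = r ^ (n + 3) * I n 1" "I 0 r = r ^ 3 * I 0 1"
        using r scale[of r n] scale[of r 0] by simp_all
      then show ?thesis unfolding f_def by (simp only: left_diff_distrib mult_1)
    qed
    also have "\<dots> = (LBINT x. (indicator (ball 0 r) x - indicator (ball 0 1) x) * ((norm x ^ n - 1) * H x))"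
    proof -
      let ?g = "\<lambda>k s x. indicator (ball 0 s) x * (norm x ^ k * H x)"
      have "I n r - I n 1 - (I 0 r - I 0 1) = (LBINT x. ?g n r x - ?g n 1 x - (?g 0 r x - ?g 0 1 x))"
        unfolding I_def by (simp only: Bochner_Integration.integral_diff Bochner_Integration.integrable_diff int)
      also have "(\<lambda>x. ?g n r x - ?g n 1 x - (?g 0 r x - ?g 0 1 x))
         = (\<lambda>x. (indicator (ball 0 r) x - indicator (ball 0 1) x) * ((norm x ^ n - 1) * H x))"
        by (simp add: fun_eq_iff algebra_simps)
      finally show ?thesis .
    qed
    also have "\<bar>\<dots>\<bar> \<le> (LBINT x. (indicator (ball (0::real^3) r) x - indicator (ball 0 1) x) * ((r ^ n - 1) * B))"
    proof (rule order_trans[OF integral_abs_bound integral_mono])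
      show "integrable lborel (\<lambda>x. \<bar>(indicator (ball 0 r) x - indicator (ball 0 1) x) * ((norm x ^ n - 1) * H x)\<bar>)"
      proof (rule integrable_abs)
        let ?g = "\<lambda>k s x. indicator (ball 0 s) x * (norm x ^ k * H x)"
        have "integrable lborel (\<lambda>x. ?g n r x - ?g n 1 x - (?g 0 r x - ?g 0 1 x))"
          by (intro Bochner_Integration.integrable_diff int)
        also have "(\<lambda>x. ?g n r x - ?g n 1 x - (?g 0 r x - ?g 0 1 x))
           = (\<lambda>x. (indicator (ball 0 r) x - indicator (ball 0 1) x) * ((norm x ^ n - 1) * H x))"
          by (simp add: fun_eq_iff algebra_simps)
        finally show "integrable lborel (\<lambda>x. (indicator (ball 0 r) x - indicator (ball 0 1) x) * ((norm x ^ n - 1) * H x))" .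
      qed
      show "integrable lborel (\<lambda>x. (indicator (ball (0::real^3) r) x - indicator (ball 0 1) x) * ((r ^ n - 1) * B))"
        by (intro integrable_mult_left Bochner_Integration.integrable_diff int1)
      fix x :: "real^3"
      show "\<bar>(indicator (ball 0 r) x - indicator (ball 0 1) x) * ((norm x ^ n - 1) * H x)\<bar>
        \<le> (indicator (ball 0 r) x - indicator (ball 0 1) x) * ((r ^ n - 1) * B)"
      proof (cases "1 \<le> norm x \<and> norm x < r")
        case True
        then have "norm x ^ n \<le> r ^ n" "1 \<le> norm x ^ n" by (auto intro!: power_mono)
        then have "(norm x ^ n - 1) * \<bar>H x\<bar> \<le> (r ^ n - 1) * B"
          using bnd[of x] by (intro mult_mono) auto
        then show ?thesis using True \<open>1 \<le> norm x ^ n\<close> by (simp add: indicator_def abs_mult)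
      qed (use r in \<open>auto simp: indicator_def\<close>)
    qed
    also have "\<dots> = (r ^ n - 1) * B * (omega3 * (r ^ 3 - 1))"
      using int1 r by (simp add: measure_ball3 algebra_simps)
    finally show ?thesis .
  qed
  have "(f has_real_derivative (real n + 3) * I n 1 - 3 * I 0 1) (at 1)"
    unfolding f_def by (auto intro!: derivative_eq_intros)
  then have lim: "((\<lambda>r. (f r - f 1) / (r - 1)) \<longlongrightarrow> (real n + 3) * I n 1 - 3 * I 0 1) (at_right 1)"
    unfolding has_field_derivative_iff by (rule tendsto_mono[rotated]) (simp add: at_le)
  have "((\<lambda>r::real. r ^ 3) has_real_derivative 3) (at 1)"
    by (auto intro!: derivative_eq_intros)
  then have "((\<lambda>r::real. (r ^ 3 - 1) / (r - 1)) \<longlongrightarrow> 3) (at_right 1)"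
    unfolding has_field_derivative_iff power_one by (rule tendsto_mono[rotated]) (simp add: at_le)
  moreover have "((\<lambda>r::real. (r ^ n - 1) * B * omega3) \<longlongrightarrow> (1 ^ n - 1) * B * omega3) (at_right 1)"
    by (intro tendsto_intros)
  ultimately have "((\<lambda>r. (r ^ n - 1) * B * omega3 * ((r ^ 3 - 1) / (r - 1))) \<longlongrightarrow> (1 ^ n - 1) * B * omega3 * 3) (at_right 1)"
    by (rule tendsto_mult[rotated])
  then have "((\<lambda>r. (r ^ n - 1) * B * omega3 * ((r ^ 3 - 1) / (r - 1))) \<longlongrightarrow> 0) (at_right 1)" by simp
  moreover have "\<forall>\<^sub>F r in at_right 1. norm ((f r - f 1) / (r - 1)) \<le> (r ^ n - 1) * B * omega3 * ((r ^ 3 - 1) / (r - 1))"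
  proof -
    have "\<forall>\<^sub>F r in at_right (1::real). r > 1" by (simp add: eventually_at_right_less)
    then show ?thesis
    proof eventually_elim
      case (elim r)
      have "f 1 = 0" by (simp add: f_def)
      then have "norm ((f r - f 1) / (r - 1)) = \<bar>f r\<bar> / (r - 1)" using elim by simp
      also have "\<dots> \<le> (r ^ n - 1) * B * (omega3 * (r ^ 3 - 1)) / (r - 1)"
        using bound[OF elim] elim by (intro divide_right_mono) auto
      finally show ?case by (simp only: times_divide_eq_right mult.assoc)
    qed
  qed
  ultimately have "((\<lambda>r. (f r - f 1) / (r - 1)) \<longlongrightarrow> 0) (at_right 1)"
    by (rule Lim_null_comparison[rotated])
  then have "(real n + 3) * I n 1 - 3 * I 0 1 = 0"
    by (rule tendsto_unique[OF trivial_limit_at_right_real lim])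
  then have "I n 1 = 3 / (real n + 3) * I 0 1" by (simp add: field_simps)
  moreover have "I n r = r ^ (n + 3) * I n 1"
    using scale[of r n] r by (cases "r = 0") (auto simp: I_def ball_empty)
  ultimately have "I n r = 3 / (real n + 3) * r ^ (n + 3) * I 0 1" by simp
  then show ?thesis by (simp add: I_def)
qed

lemma ball_moment:
  assumes "r \<ge> 0"
  shows "has_bochner_integral lborel (\<lambda>x::real^3. indicator (ball 0 r) x * norm x ^ n)
    (3 / (real n + 3) * omega3 * r ^ (n + 3))"
proof -
  have "integrable lborel (\<lambda>x::real^3. indicator (ball 0 r) x * norm x ^ n)"
  proof (rule integrable_ball_bounded[where B = "r ^ n"])
    fix x :: "real^3" assume "x \<in> ball 0 r"
    then show "\<bar>norm x ^ n\<bar> \<le> r ^ n" by (simp add: power_mono)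
  qed measurable
  then show ?thesis
    using homogeneous_ball_moment[of "\<lambda>_. 1" 1 r n] assms
    by (simp add: has_bochner_integral_iff measure_ball3)
qed

text \<open>The proof integrates \<open>(norm x ^ n - m) * (F x - \<Phi> x)\<close>, where
  \<open>\<Phi>\<close> is the trapezoid and \<open>m\<close> is the mean of
  \<open>norm x ^ n\<close> over the annulus on which it slopes. Off the annulus the integrand is
  nonnegative, as in the classical bathtub argument. On the annulus let \<open>c ^ n = m\<close> and
  let \<open>H x\<close> be the value of the difference at radius \<open>c\<close> on the ray of
  \<open>x\<close>: by the Lipschitz bound \<open>F x - \<Phi> x - H x\<close> has the sign of
  \<open>norm x - c\<close>, and \<open>H\<close>, being constant on rays, contributes nothing by
  the choice of \<open>m\<close>. Since \<open>m\<close> is nonnegative, a lower bound for the mass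
  of \<open>F\<close> is enough.\<close>

lemma lipschitz_bathtub:
  fixes F :: "real^3 \<Rightarrow> real"
  assumes F0: "\<And>x. 0 \<le> F x" and Fa: "\<And>x. F x \<le> p * (b - s)"
    and lip: "\<And>x y. \<bar>F x - F y\<bar> \<le> p * norm (x - y)"
    and p: "p > 0" and s: "0 \<le> s" "s < b"
    and intF: "integrable lborel F" "integrable lborel (\<lambda>x. norm x ^ n * F x)"
    and mass: "omega3 * p / 4 * (b ^ 4 - s ^ 4) \<le> (LBINT x. F x)"
  shows "3 * omega3 * p / ((real n + 3) * (real n + 4)) * (b ^ (n + 4) - s ^ (n + 4))
    \<le> (LBINT x. norm x ^ n * F x)"
proof -
  define ann :: "real^3 \<Rightarrow> real" where "ann x = indicator (ball 0 b) x - indicator (ball 0 s) x" for x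
  have ann_eq: "ann x = (if s \<le> norm x \<and> norm x < b then 1 else 0)" for x
    using s by (auto simp: ann_def indicator_def)
  have b: "b \<ge> 0" using s by simp
  have [measurable]: "F \<in> borel_measurable borel" using intF by auto
  have ball_int: "integrable lborel (\<lambda>x::real^3. indicator (ball 0 r) x * norm x ^ k)"
    and ball_eq: "(LBINT x. indicator (ball (0::real^3) r) x * norm x ^ k) = 3 / (real k + 3) * omega3 * r ^ (k + 3)"
    if "r \<ge> 0" for r k
    using ball_moment[OF that, of k] by (simp_all add: has_bochner_integral_iff)
  have ann_int: "integrable lborel (\<lambda>x. ann x * norm x ^ k)" for k
    unfolding ann_def left_diff_distrib using ball_int s b by (intro Bochner_Integration.integrable_diff)
  have ann_mom: "(LBINT x. ann x * norm x ^ k) = 3 / (real k + 3) * omega3 * (b ^ (k + 3) - s ^ (k + 3))" for k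
    unfolding ann_def left_diff_distrib using ball_int s b
    by (simp add: ball_eq right_diff_distrib)
  have om: "omega3 > 0" by (simp add: omega3_def)
  define m where "m = 3 / (real n + 3) * (b ^ (n + 3) - s ^ (n + 3)) / (b ^ 3 - s ^ 3)"
  have b3: "b ^ 3 - s ^ 3 > 0" using s by (simp add: power_strict_mono)
  have m_ann: "(LBINT x. ann x * norm x ^ n) = m * (omega3 * (b ^ 3 - s ^ 3))"
    using b3 by (simp add: ann_mom m_def)
  have ann0: "(LBINT x. ann x) = omega3 * (b ^ 3 - s ^ 3)" and ann0_int: "integrable lborel ann"
    using ann_mom[of 0] ann_int[of 0] by simp_all
  have "(LBINT x. s ^ n * ann x) \<le> (LBINT x. ann x * norm x ^ n)"
    using s by (intro integral_mono ann_int integrable_mult_right ann0_int)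
      (auto simp: ann_eq intro!: power_mono)
  then have "s ^ n * (omega3 * (b ^ 3 - s ^ 3)) \<le> m * (omega3 * (b ^ 3 - s ^ 3))"
    unfolding m_ann by (simp add: ann0)
  then have sm: "s ^ n \<le> m" using b3 om by (auto simp: mult_le_cancel_right)
  have "(LBINT x. ann x * norm x ^ n) \<le> (LBINT x. b ^ n * ann x)"
    using s by (intro integral_mono ann_int integrable_mult_right ann0_int)
      (auto simp: ann_eq intro!: power_mono)
  then have "m * (omega3 * (b ^ 3 - s ^ 3)) \<le> b ^ n * (omega3 * (b ^ 3 - s ^ 3))"
    unfolding m_ann by (simp add: ann0)
  then have mb: "m \<le> b ^ n" using b3 om by (auto simp: mult_le_cancel_right)
  obtain c where c: "s \<le> c" "c \<le> b" "c ^ n = m"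
  proof -
    have "continuous_on {s..b} (\<lambda>t. t ^ n)" by (intro continuous_intros)
    then show ?thesis using IVT'[of "\<lambda>t. t ^ n" s m b] sm mb s that by auto
  qed
  define \<phi> where "\<phi> r = p * (b - r)" for r
  define \<Phi> where "\<Phi> x = p * (b - s) * indicator (ball 0 s) x + ann x * \<phi> (norm x)" for x :: "real^3"
  define H where "H x = F ((c / norm x) *\<^sub>R x) - \<phi> c" for x
  have [measurable]: "H \<in> borel_measurable borel" unfolding H_def by measurable
  have H_hom: "H (t *\<^sub>R x) = H x" if "t > 0" for t x
    using that by (simp add: H_def)
  have H_bnd: "\<bar>H x\<bar> \<le> p * (b - s) + \<bar>\<phi> c\<bar>" for x
    using F0[of "(c / norm x) *\<^sub>R x"] Fa[of "(c / norm x) *\<^sub>R x"] by (simp add: H_def)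
  define K where "K = (LBINT x. indicator (ball 0 1) x * H x)"
  have H_int: "integrable lborel (\<lambda>x. indicator (ball 0 r) x * (norm x ^ k * H x))" if "r \<ge> 0" for r k
  proof (rule integrable_ball_bounded[where B = "r ^ k * (p * (b - s) + \<bar>\<phi> c\<bar>)"])
    fix x :: "real^3" assume "x \<in> ball 0 r"
    then have "norm x ^ k \<le> r ^ k" by (intro power_mono) auto
    then show "\<bar>norm x ^ k * H x\<bar> \<le> r ^ k * (p * (b - s) + \<bar>\<phi> c\<bar>)"
      using H_bnd[of x] that by (auto simp: abs_mult intro!: mult_mono)
  qed measurable
  have H_mom: "(LBINT x. indicator (ball 0 r) x * (norm x ^ k * H x)) = 3 / (real k + 3) * r ^ (k + 3) * K"
    if "r \<ge> 0" for r k
    unfolding K_def using H_hom H_bnd that by (intro homogeneous_ball_moment) auto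
  have H_ann_int: "integrable lborel (\<lambda>x. ann x * (norm x ^ k * H x))" for k
    unfolding ann_def left_diff_distrib using H_int s b by (intro Bochner_Integration.integrable_diff)
  have H_ann: "(LBINT x. ann x * (norm x ^ k * H x)) = 3 / (real k + 3) * (b ^ (k + 3) - s ^ (k + 3)) * K" for k
    unfolding ann_def left_diff_distrib using H_int s b
    by (simp add: H_mom right_diff_distrib left_diff_distrib)
  \<comment> \<open>By \<open>H_ann\<close> both integrals are multiples of \<open>K\<close>, and
    \<open>m\<close> is the quotient of the two factors.\<close>
  have H_zero: "(LBINT x. ann x * (norm x ^ n * H x) - m * (ann x * (norm x ^ 0 * H x))) = 0"
    using H_ann_int[of n] H_ann_int[of 0] b3 H_ann[of n] H_ann[of 0] by (simp add: m_def)
  have ptw: "ann x * (norm x ^ n * H x) - m * (ann x * (norm x ^ 0 * H x)) \<le> (norm x ^ n - m) * (F x - \<Phi> x)" for x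
  proof -
    consider "norm x < s" | "s \<le> norm x" "norm x < b" | "b \<le> norm x" by linarith
    then show ?thesis
    proof cases
      case 1
      then have "norm x ^ n \<le> m" using sm power_mono[of "norm x" s n] by simp
      moreover have "\<Phi> x = p * (b - s)" "ann x = 0" using 1 by (auto simp: \<Phi>_def ann_eq)
      ultimately show ?thesis using Fa[of x] by (simp add: mult_nonpos_nonpos)
    next
      case 3
      then have "m \<le> norm x ^ n" using mb power_mono[of b "norm x" n] b by simp
      moreover have "\<Phi> x = 0" "ann x = 0" using 3 s by (auto simp: \<Phi>_def ann_eq)
      ultimately show ?thesis using F0[of x] by simp
    next
      case 2
      then have [simp]: "ann x = 1" "\<Phi> x = \<phi> (norm x)" by (auto simp: \<Phi>_def ann_eq)
      have "(norm x ^ n - m) * (F x - \<phi> (norm x) - H x) \<ge> 0"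
      \<comment> \<open>The origin lies in the annulus only when \<open>s = 0\<close>. There
        \<open>c / norm x\<close> is 0, so the two values of \<open>F\<close> cancel and
        \<open>- (p * c)\<close> remains.\<close>
      proof (cases "x = 0")
        case True
        then have "0 ^ n \<le> m" using c s power_mono[of 0 c n] by simp
        moreover have "F x - \<phi> (norm x) - H x = - (p * c)"
          using True by (simp add: H_def \<phi>_def algebra_simps)
        moreover have "- (p * c) \<le> 0" using c s p by simp
        ultimately show ?thesis using mult_nonpos_nonpos[of "0 ^ n - m" "- (p * c)"] True by simp
      next
        case False
        define y where "y = (c / norm x) *\<^sub>R x"
        have "x - y = ((norm x - c) / norm x) *\<^sub>R x"
          using False by (simp add: y_def algebra_simps diff_divide_distrib)
        then have "norm (x - y) = \<bar>norm x - c\<bar>" using False by simp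
        then have d: "\<bar>F x - F y\<bar> \<le> p * \<bar>norm x - c\<bar>" using lip[of x y] by simp
        have e: "F x - \<phi> (norm x) - H x = F x - F y + p * (norm x - c)"
          by (simp add: H_def \<phi>_def y_def algebra_simps)
        show ?thesis
        proof (cases "norm x \<ge> c")
          case True
          then have "norm x ^ n \<ge> m" using c s power_mono[of c "norm x" n] by simp
          moreover have "F x - F y + p * (norm x - c) \<ge> 0" using d True by simp
          ultimately show ?thesis unfolding e by simp
        next
          case False
          then have "norm x ^ n \<le> m" using c power_mono[of "norm x" c n] by simp
          moreover have "F x - F y + p * (norm x - c) \<le> 0"
          proof -
            have "p * \<bar>norm x - c\<bar> = - (p * (norm x - c))" using False by (simp add: algebra_simps)
            then show ?thesis using d by linarith
          qed
          ultimately show ?thesis unfolding e by (simp add: mult_nonpos_nonpos)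
        qed
      qed
      then show ?thesis by (simp add: algebra_simps)
    qed
  qed
  have \<Phi>_eq: "norm x ^ k * \<Phi> x = p * (b - s) * (indicator (ball 0 s) x * norm x ^ k)
     + (p * b * (ann x * norm x ^ k) - p * (ann x * norm x ^ Suc k))" for k and x :: "real^3"
    by (simp add: \<Phi>_def \<phi>_def algebra_simps)
  have \<Phi>_int: "integrable lborel (\<lambda>x. norm x ^ k * \<Phi> x)" for k
    unfolding \<Phi>_eq using ball_int[OF s(1)] ann_int
    by (intro Bochner_Integration.integrable_add Bochner_Integration.integrable_diff integrable_mult_right)
  have \<Phi>_mom: "(LBINT x. norm x ^ k * \<Phi> x) = 3 * omega3 * p / ((real k + 3) * (real k + 4)) * (b ^ (k + 4) - s ^ (k + 4))" for k
  proof -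
    have "(LBINT x. norm x ^ k * \<Phi> x) = p * (b - s) * (3 / (real k + 3) * omega3 * s ^ (k + 3))
       + (p * b * (3 / (real k + 3) * omega3 * (b ^ (k + 3) - s ^ (k + 3)))
          - p * (3 / (real (Suc k) + 3) * omega3 * (b ^ (Suc k + 3) - s ^ (Suc k + 3))))"
      unfolding \<Phi>_eq using ball_int[OF s(1)] ann_int
      by (simp only: Bochner_Integration.integral_add Bochner_Integration.integral_diff integral_mult_right_zero
          Bochner_Integration.integrable_add Bochner_Integration.integrable_diff integrable_mult_right ball_eq[OF s(1)] ann_mom)
    also have "\<dots> = 3 * omega3 * p * (b ^ (k + 4) - s ^ (k + 4)) * (1 / (real k + 3) - 1 / (real k + 4))"
      by (simp add: power_add divide_simps) (simp add: algebra_simps eval_nat_numeral)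
    also have "1 / (real k + 3) - 1 / (real k + 4) = 1 / ((real k + 3) * (real k + 4))"
      by (simp add: divide_simps)
    finally show ?thesis by simp
  qed
  have "0 \<le> (LBINT x. (norm x ^ n - m) * (F x - \<Phi> x))"
    unfolding H_zero[symmetric]
  proof (rule integral_mono)
    show "integrable lborel (\<lambda>x. ann x * (norm x ^ n * H x) - m * (ann x * (norm x ^ 0 * H x)))"
      by (intro Bochner_Integration.integrable_diff integrable_mult_right H_ann_int)
    have "integrable lborel (\<lambda>x. (norm x ^ n * F x - norm x ^ n * \<Phi> x) - m * (F x - norm x ^ 0 * \<Phi> x))"
      by (intro Bochner_Integration.integrable_diff integrable_mult_right \<Phi>_int intF)
    then show "integrable lborel (\<lambda>x. (norm x ^ n - m) * (F x - \<Phi> x))"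
      by (simp add: algebra_simps)
  qed (rule ptw)
  also have "(\<lambda>x. (norm x ^ n - m) * (F x - \<Phi> x)) = (\<lambda>x. (norm x ^ n * F x - norm x ^ n * \<Phi> x) - m * (F x - norm x ^ 0 * \<Phi> x))"
    by (simp add: fun_eq_iff algebra_simps)
  also have "(LBINT x. (norm x ^ n * F x - norm x ^ n * \<Phi> x) - m * (F x - norm x ^ 0 * \<Phi> x))
    = (LBINT x. norm x ^ n * F x) - (LBINT x. norm x ^ n * \<Phi> x)
      - m * ((LBINT x. F x) - (LBINT x. norm x ^ 0 * \<Phi> x))"
    using \<Phi>_int intF by (simp only: Bochner_Integration.integral_diff integral_mult_right_zero
       Bochner_Integration.integrable_diff integrable_mult_right)
  finally have "(LBINT x. norm x ^ n * \<Phi> x) + m * ((LBINT x. F x) - (LBINT x. norm x ^ 0 * \<Phi> x))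
     \<le> (LBINT x. norm x ^ n * F x)" by simp
  moreover have "m * ((LBINT x. F x) - (LBINT x. norm x ^ 0 * \<Phi> x)) \<ge> 0"
  proof (rule mult_nonneg_nonneg)
    show "0 \<le> m" using sm s zero_le_power[of s n] by linarith
    show "0 \<le> (LBINT x. F x) - (LBINT x. norm x ^ 0 * \<Phi> x)"
      using mass \<Phi>_mom[of 0] by simp
  qed
  ultimately show ?thesis unfolding \<Phi>_mom by simp
qed

subsection \<open>Plancherel for compactly supported functions\<close>

lemma gauss_fourier_real:
  "has_bochner_integral lborel (\<lambda>t::real. exp (- t\<^sup>2 / 2) * iexp (t * z)) (of_real (sqrt (2 * pi) * exp (- z\<^sup>2 / 2)))"
proof -
  have d: "std_normal_density x = exp (- x\<^sup>2 / 2) / sqrt (2 * pi)" for x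
    by (simp add: std_normal_density_def)
  have "integrable lborel (\<lambda>t. std_normal_density t * cos (0::real))"
    using integrable_std_normal_moment[of 0] by simp
  then have int: "integrable lborel (\<lambda>t. std_normal_density t *\<^sub>R iexp (t * z))"
    by (rule Bochner_Integration.integrable_bound) (auto simp: )
  have "(LBINT t. std_normal_density t *\<^sub>R iexp (z * t)) = complex_of_real (exp (- (z\<^sup>2) / 2))"
    using fun_cong[OF char_std_normal_distribution, of z]
    by (simp add: char_def integral_density normal_density_nonneg)
  then have "has_bochner_integral lborel (\<lambda>t. std_normal_density t *\<^sub>R iexp (t * z)) (complex_of_real (exp (- z\<^sup>2 / 2)))"
    using int by (simp add: has_bochner_integral_iff mult.commute)
  from has_bochner_integral_mult_right[OF this, of "of_real (sqrt (2 * pi))"]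
  show ?thesis by (simp add: d scaleR_conv_of_real mult_ac)
qed

text \<open>Both the Gaussian and the exponential are products over the coordinates, and
  \<open>lborel\<close> is an image of the product measure, so the integral factors into
  one-dimensional ones.\<close>

lemma gauss_fourier_complex:
  fixes z :: "'a::euclidean_space"
  shows "has_bochner_integral lborel (\<lambda>x. exp (- (norm x)\<^sup>2 / 2) * iexp (x \<bullet> z))
    (of_real (sqrt (2 * pi) ^ DIM('a) * exp (- (norm z)\<^sup>2 / 2)))"
proof -
  interpret product_sigma_finite "\<lambda>_::'a. lborel :: real measure" by standard
  define g where "g b t = exp (- t\<^sup>2 / 2) * iexp (t * (z \<bullet> b))" for b :: 'a and t :: real
  have g_int: "integrable lborel (g b)" and g_eq: "integral\<^sup>L lborel (g b) = of_real (sqrt (2 * pi) * exp (- (z \<bullet> b)\<^sup>2 / 2))" for b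
    using gauss_fourier_real[of "z \<bullet> b"] unfolding g_def has_bochner_integral_iff by auto
  define T where "T f = (\<Sum>b\<in>Basis. f b *\<^sub>R b)" for f :: "'a \<Rightarrow> real"
  have [measurable]: "T \<in> (\<Pi>\<^sub>M b\<in>(Basis::'a set). lborel) \<rightarrow>\<^sub>M borel" unfolding T_def by measurable
  have norm2: "(norm y)\<^sup>2 = (\<Sum>b\<in>Basis. (y \<bullet> b)\<^sup>2)" for y :: 'a
    unfolding power2_norm_eq_inner by (subst euclidean_inner) (simp add: power2_eq_square)
  have eq: "exp (- (norm x)\<^sup>2 / 2) * iexp (x \<bullet> z) = (\<Prod>b\<in>Basis. g b (x \<bullet> b))" for x
  proof -
    have "(\<Prod>b\<in>Basis. g b (x \<bullet> b)) = of_real (\<Prod>b\<in>Basis. exp (- (x \<bullet> b)\<^sup>2 / 2)) * (\<Prod>b\<in>Basis. iexp ((x \<bullet> b) * (z \<bullet> b)))"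
      unfolding g_def by (simp add: prod.distrib)
    also have "(\<Prod>b\<in>Basis. exp (- (x \<bullet> b)\<^sup>2 / 2)) = exp (- (norm x)\<^sup>2 / 2)"
      by (simp add: exp_sum[symmetric] norm2 sum_negf sum_divide_distrib)
    also have "(\<Prod>b\<in>Basis. iexp ((x \<bullet> b) * (z \<bullet> b))) = iexp (x \<bullet> z)"
      by (simp add: exp_sum[symmetric] euclidean_inner[of x z] sum_distrib_left)
    finally show ?thesis by simp
  qed
  have proj: "T f \<bullet> b = f b" if "b \<in> Basis" for f b
    using that by (simp add: T_def)
  have "integrable (\<Pi>\<^sub>M b\<in>Basis. lborel) (\<lambda>f. \<Prod>b\<in>Basis. g b (f b))"
    by (intro product_integrable_prod g_int) auto
  moreover have "(\<lambda>f. \<Prod>b\<in>Basis. g b (f b)) = (\<lambda>f. exp (- (norm (T f))\<^sup>2 / 2) * iexp (T f \<bullet> z))"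
    unfolding eq by (auto simp: proj)
  ultimately have 1: "integrable (\<Pi>\<^sub>M b\<in>Basis. lborel) (\<lambda>f. exp (- (norm (T f))\<^sup>2 / 2) * iexp (T f \<bullet> z))" by simp
  have "integrable lborel (\<lambda>x. exp (- (norm x)\<^sup>2 / 2) * iexp (x \<bullet> z))"
    using 1 by (subst lborel_eq) (simp add: T_def[symmetric, abs_def] integrable_distr_eq)
  moreover have "(LBINT x. exp (- (norm x)\<^sup>2 / 2) * iexp (x \<bullet> z)) = of_real (sqrt (2 * pi) ^ DIM('a) * exp (- (norm z)\<^sup>2 / 2))"
  proof -
    have "(LBINT x. exp (- (norm x)\<^sup>2 / 2) * iexp (x \<bullet> z)) = (\<integral>f. exp (- (norm (T f))\<^sup>2 / 2) * iexp (T f \<bullet> z) \<partial>(\<Pi>\<^sub>M b\<in>Basis. lborel))"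
      by (subst lborel_eq) (simp add: T_def[symmetric, abs_def] integral_distr)
    also have "\<dots> = (\<integral>f. (\<Prod>b\<in>Basis. g b (f b)) \<partial>(\<Pi>\<^sub>M b\<in>Basis. lborel))"
      unfolding eq by (auto simp: proj cong: prod.cong)
    also have "\<dots> = (\<Prod>b\<in>Basis. of_real (sqrt (2 * pi) * exp (- (z \<bullet> b)\<^sup>2 / 2)))"
      by (subst product_integral_prod) (auto simp: g_int g_eq)
    also have "\<dots> = of_real (sqrt (2 * pi) ^ DIM('a) * (\<Prod>b\<in>Basis. exp (- (z \<bullet> b)\<^sup>2 / 2)))"
      by (simp add: prod.distrib)
    also have "(\<Prod>b\<in>Basis. exp (- (z \<bullet> b)\<^sup>2 / 2)) = exp (- (norm z)\<^sup>2 / 2)"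
      by (simp add: exp_sum[symmetric] norm2 sum_negf sum_divide_distrib)
    finally show ?thesis .
  qed
  ultimately show ?thesis by (simp add: has_bochner_integral_iff)
qed

lemma gauss_fourier:
  fixes z :: "'a::euclidean_space"
  shows "has_bochner_integral lborel (\<lambda>x. exp (- (norm x)\<^sup>2 / 2) * cos (x \<bullet> z))
    (sqrt (2 * pi) ^ DIM('a) * exp (- (norm z)\<^sup>2 / 2))"
proof -
  have "has_bochner_integral lborel (\<lambda>x. Re (exp (- (norm x)\<^sup>2 / 2) * iexp (x \<bullet> z)))
    (Re (of_real (sqrt (2 * pi) ^ DIM('a) * exp (- (norm z)\<^sup>2 / 2))))"
    by (rule has_bochner_integral_bounded_linear[OF bounded_linear_Re gauss_fourier_complex])
  then show ?thesis by (simp add: Re_exp)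
qed

lemma gauss_integral:
  "integrable lborel (\<lambda>x::'a::euclidean_space. exp (- (norm x)\<^sup>2 / 2))"
  "(LBINT x. exp (- (norm (x::'a::euclidean_space))\<^sup>2 / 2)) = sqrt (2 * pi) ^ DIM('a)"
  using gauss_fourier[of "0::'a"] by (simp_all add: has_bochner_integral_iff)

section \<open>Cosine and sine transforms\<close>

text \<open>The real part and, up to sign, the imaginary part of the Fourier transform without
  normalising factor are kept as two real functions. The measure is a parameter because test
  functions are transformed over the whole space, but eigenfunctions only over
  \<open>lebesgue_on \<Omega>\<close>: their values outside \<Omega> are arbitrary.\<close>

definition cos_tr :: "'a::euclidean_space measure \<Rightarrow> ('a \<Rightarrow> real) \<Rightarrow> 'a \<Rightarrow> real" where
  "cos_tr M f \<xi> = (LINT x|M. f x * cos (\<xi> \<bullet> x))"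

definition sin_tr :: "'a::euclidean_space measure \<Rightarrow> ('a \<Rightarrow> real) \<Rightarrow> 'a \<Rightarrow> real" where
  "sin_tr M f \<xi> = (LINT x|M. f x * sin (\<xi> \<bullet> x))"

text \<open>The real part of the product of the Fourier transform of \<open>f\<close> with the conjugate of that
  of \<open>g\<close>.\<close>

definition fourier_prod :: "'a::euclidean_space measure \<Rightarrow> ('a \<Rightarrow> real) \<Rightarrow> ('a \<Rightarrow> real) \<Rightarrow> 'a \<Rightarrow> real" where
  "fourier_prod M f g \<xi> = cos_tr M f \<xi> * cos_tr M g \<xi> + sin_tr M f \<xi> * sin_tr M g \<xi>"

text \<open>This class contains test functions together with all their derivatives and is stable
  under sums and under multiplication by sines and cosines, while its members are bounded and
  integrable. Plancherel can be proved on it directly.\<close>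

definition cont_csupp :: "('a::euclidean_space \<Rightarrow> real) \<Rightarrow> bool" where
  "cont_csupp f \<longleftrightarrow> continuous_on UNIV f \<and> (\<exists>B. \<forall>x. norm x > B \<longrightarrow> f x = 0)"

lemma cont_csupp_measurable: "cont_csupp f \<Longrightarrow> f \<in> borel_measurable borel"
  unfolding cont_csupp_def by (simp add: borel_measurable_continuous_onI)

lemma cont_csupp_bounded:
  assumes "cont_csupp f"
  obtains C where "\<And>x. \<bar>f x\<bar> \<le> C"
proof -
  obtain B where B: "norm x > B \<Longrightarrow> f x = 0" for x using assms unfolding cont_csupp_def by blast
  have "compact (f ` cball 0 B)"
    using assms unfolding cont_csupp_def by (intro compact_continuous_image) (auto intro: continuous_on_subset)
  then obtain C where C: "\<And>x. x \<in> cball 0 B \<Longrightarrow> \<bar>f x\<bar> \<le> C"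
    using compact_imp_bounded bounded_iff by (metis imageI real_norm_def)
  have "\<bar>f x\<bar> \<le> max C 0" for x
    using C[of x] B[of x] by (cases "norm x \<le> B") (auto simp: max_def)
  then show ?thesis using that by blast
qed

lemma cont_csupp_integrable:
  assumes f: "cont_csupp f"
  shows "integrable lborel f"
proof -
  obtain B where B: "norm x > B \<Longrightarrow> f x = 0" for x using f unfolding cont_csupp_def by blast
  have "integrable lborel (\<lambda>x. indicator (cball 0 B) x *\<^sub>R f x)"
    using f unfolding cont_csupp_def
    by (intro borel_integrable_compact) (auto intro: continuous_on_subset)
  moreover have "(\<lambda>x. indicator (cball 0 B) x *\<^sub>R f x) = f"
    using B by (auto simp: fun_eq_iff indicator_def)
  ultimately show ?thesis by simp
qed

lemma cont_csupp_add: "cont_csupp f \<Longrightarrow> cont_csupp g \<Longrightarrow> cont_csupp (\<lambda>x. f x + g x)"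
  unfolding cont_csupp_def
proof safe
  fix B B' assume "\<forall>x. norm x > B \<longrightarrow> f x = 0" "\<forall>x. norm x > B' \<longrightarrow> g x = 0"
  then show "\<exists>B. \<forall>x. norm x > B \<longrightarrow> f x + g x = 0" by (intro exI[of _ "max B B'"]) auto
qed (intro continuous_intros)

lemma cont_csupp_mult: "cont_csupp f \<Longrightarrow> continuous_on UNIV g \<Longrightarrow> cont_csupp (\<lambda>x. f x * g x)"
  unfolding cont_csupp_def by (auto intro!: continuous_intros)

lemma integral_swap_kernel:
  fixes g f :: "'a::euclidean_space \<Rightarrow> real" and k :: "'a \<Rightarrow> 'a \<Rightarrow> real"
  assumes g: "integrable lborel g" and f: "integrable lborel f"
    and [measurable]: "case_prod k \<in> borel_measurable (borel \<Otimes>\<^sub>M borel)" and k: "\<And>x y. \<bar>k x y\<bar> \<le> K"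
  shows "(LBINT x. g x * (LBINT y. f y * k x y)) = (LBINT y. f y * (LBINT x. g x * k x y))"
proof -
  have [measurable]: "f \<in> borel_measurable borel" "g \<in> borel_measurable borel" using f g by auto
  have K: "K \<ge> 0" using k[of 0 0] by linarith
  have 1: "integrable (lborel \<Otimes>\<^sub>M lborel) (\<lambda>p. g (fst p) * f (snd p) * K)"
    by (rule lborel_pair.Fubini_integrable) (use f g in \<open>auto simp: abs_mult\<close>)
  have "integrable (lborel \<Otimes>\<^sub>M lborel) (\<lambda>(x, y). g x * f y * k x y)"
    by (rule Bochner_Integration.integrable_bound[OF 1])
      (use k K in \<open>auto simp: abs_mult split_beta intro!: mult_mono AE_I2 order_trans[OF k]\<close>)
  from lborel_pair.Fubini_integral[OF this]
  have "(LBINT y. (LBINT x. f y * (g x * k x y))) = (LBINT x. (LBINT y. g x * (f y * k x y)))"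
    by (simp add: mult_ac)
  then show ?thesis by simp
qed

lemma integrable_mult_cos_sin:
  fixes f :: "'a::euclidean_space \<Rightarrow> real"
  assumes "integrable M f" and [measurable_cong]: "sets M = sets borel"
  shows "integrable M (\<lambda>x. f x * cos (\<xi> \<bullet> x))" "integrable M (\<lambda>x. f x * sin (\<xi> \<bullet> x))"
proof -
  have [measurable]: "f \<in> borel_measurable M" using assms by auto
  show "integrable M (\<lambda>x. f x * cos (\<xi> \<bullet> x))" "integrable M (\<lambda>x. f x * sin (\<xi> \<bullet> x))"
    by (rule Bochner_Integration.integrable_bound[OF assms(1)]; auto simp: abs_mult intro!: AE_I2 mult_left_le)+
qed

text \<open>The subtraction formula for the cosine exhibits the squared modulus as a double integral
  with a bounded kernel, to which Fubini applies.\<close>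

lemma fourier_prod_eq_double_integral:
  fixes f :: "'a::euclidean_space \<Rightarrow> real"
  assumes f: "integrable lborel f"
  shows "fourier_prod lborel f f \<xi> = (LBINT x. f x * (LBINT y. f y * cos (\<xi> \<bullet> (x - y))))"
proof -
  have int: "integrable lborel (\<lambda>x. f x * cos (\<xi> \<bullet> x))" "integrable lborel (\<lambda>x. f x * sin (\<xi> \<bullet> x))"
    using integrable_mult_cos_sin[OF f] by auto
  have "(LBINT y. f y * cos (\<xi> \<bullet> (x - y))) = cos (\<xi> \<bullet> x) * cos_tr lborel f \<xi> + sin (\<xi> \<bullet> x) * sin_tr lborel f \<xi>" for x
  proof -
    have "(\<lambda>y. f y * cos (\<xi> \<bullet> (x - y))) = (\<lambda>y. cos (\<xi> \<bullet> x) * (f y * cos (\<xi> \<bullet> y)) + sin (\<xi> \<bullet> x) * (f y * sin (\<xi> \<bullet> y)))"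
      by (simp add: inner_diff_right cos_diff algebra_simps)
    then show ?thesis using int by (simp add: cos_tr_def sin_tr_def)
  qed
  then have "(LBINT x. f x * (LBINT y. f y * cos (\<xi> \<bullet> (x - y))))
    = (LBINT x. f x * cos (\<xi> \<bullet> x) * cos_tr lborel f \<xi> + f x * sin (\<xi> \<bullet> x) * sin_tr lborel f \<xi>)"
    by (simp add: algebra_simps)
  also have "\<dots> = fourier_prod lborel f f \<xi>"
    using int by (simp add: fourier_prod_def cos_tr_def sin_tr_def)
  finally show ?thesis by simp
qed

lemma cos_sin_tr_measurable:
  assumes [measurable]: "f \<in> borel_measurable borel"
  shows "cos_tr lborel f \<in> borel_measurable borel" "sin_tr lborel f \<in> borel_measurable borel"
  unfolding cos_tr_def[abs_def] sin_tr_def[abs_def] by measurable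

lemma cos_sin_tr_bound:
  assumes f: "integrable M f" and "sets M = sets borel"
  shows "\<bar>cos_tr M f \<xi>\<bar> \<le> (LINT x|M. \<bar>f x\<bar>)" "\<bar>sin_tr M f \<xi>\<bar> \<le> (LINT x|M. \<bar>f x\<bar>)"
  unfolding cos_tr_def sin_tr_def using f integrable_mult_cos_sin[OF assms]
  by (auto intro!: order_trans[OF integral_abs_bound] integral_mono mult_left_le simp: abs_mult)

text \<open>The transform of a Gaussian is a Gaussian: after the integrals are exchanged, the
  damping factor in \<open>\<xi>\<close> becomes an averaging kernel of width \<open>e\<close>
  around \<open>x\<close>. The substitution \<open>y = x + e *\<^sub>R z\<close> moves
  \<open>e\<close> from the kernel into the argument of \<open>f\<close>.\<close>

lemma fourier_prod_gauss:
  fixes f :: "'a::euclidean_space \<Rightarrow> real"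
  assumes f: "integrable lborel f" and e: "e > 0"
  shows "(LBINT \<xi>. exp (- (norm (e *\<^sub>R \<xi>))\<^sup>2 / 2) * fourier_prod lborel f f \<xi>)
    = (LBINT x. f x * (LBINT z. f (x + e *\<^sub>R z) * (sqrt (2 * pi) ^ DIM('a) * exp (- (norm z)\<^sup>2 / 2))))"
proof -
  define g where "g \<xi> = exp (- (norm (e *\<^sub>R \<xi>))\<^sup>2 / 2)" for \<xi> :: 'a
  have [measurable]: "f \<in> borel_measurable borel" using f by auto
  have [measurable]: "cos_tr lborel f \<in> borel_measurable borel" "sin_tr lborel f \<in> borel_measurable borel"
    by (auto intro: cos_sin_tr_measurable)
  have g: "integrable lborel g"
    unfolding g_def using gauss_integral integrable_lborel_affine_iff[of "\<lambda>x::'a. exp (- (norm x)\<^sup>2 / 2)" e 0] e by simp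
  have g_cos: "(LBINT \<xi>. g \<xi> * cos (\<xi> \<bullet> (x - y)))
     = sqrt (2 * pi) ^ DIM('a) * exp (- (norm ((x - y) /\<^sub>R e))\<^sup>2 / 2) / e ^ DIM('a)" for x y
  proof -
    have "(LBINT \<xi>. exp (- (norm \<xi>)\<^sup>2 / 2) * cos (\<xi> \<bullet> ((x - y) /\<^sub>R e)))
      = e ^ DIM('a) * (LBINT \<xi>. g \<xi> * cos (\<xi> \<bullet> (x - y)))"
    proof -
      have "(0 + e *\<^sub>R \<xi>) \<bullet> ((x - y) /\<^sub>R e) = \<xi> \<bullet> (x - y)" for \<xi> using e by simp
      then show ?thesis
        using e by (subst integral_lborel_affine[where c = e and t = 0]) (simp_all add: g_def del: inner_scaleR_left inner_scaleR_right)
    qed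
    then show ?thesis using gauss_fourier[of "(x - y) /\<^sub>R e"] e
      by (simp add: has_bochner_integral_iff field_simps)
  qed
  define h where "h \<xi> x = (LBINT y. f y * cos (\<xi> \<bullet> (x - y)))" for \<xi> x
  have h_meas: "case_prod h \<in> borel_measurable (borel \<Otimes>\<^sub>M borel)" unfolding h_def by measurable
  have h_bound: "\<bar>h \<xi> x\<bar> \<le> (LBINT y. \<bar>f y\<bar>)" for \<xi> x
  proof -
    have "integrable lborel (\<lambda>y. f y * cos (\<xi> \<bullet> (x - y)))"
      by (rule Bochner_Integration.integrable_bound[OF f]) (auto simp: abs_mult intro!: AE_I2 mult_left_le)
    then show ?thesis unfolding h_def using f
      by (intro order_trans[OF integral_abs_bound] integral_mono integrable_abs) (auto simp: abs_mult intro!: mult_left_le)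
  qed
  have "(LBINT \<xi>. g \<xi> * fourier_prod lborel f f \<xi>) = (LBINT \<xi>. g \<xi> * (LBINT x. f x * h \<xi> x))"
    by (simp add: fourier_prod_eq_double_integral[OF f] h_def)
  also have "\<dots> = (LBINT x. f x * (LBINT \<xi>. g \<xi> * h \<xi> x))"
    by (rule integral_swap_kernel[OF g f h_meas h_bound])
  also have "\<dots> = (LBINT x. f x * (LBINT y. f y * (LBINT \<xi>. g \<xi> * cos (\<xi> \<bullet> (x - y)))))"
    unfolding h_def by (subst integral_swap_kernel[OF g f, where K = 1]) auto
  also have "\<dots> = (LBINT x. f x * (LBINT z. f (x + e *\<^sub>R z) * (sqrt (2 * pi) ^ DIM('a) * exp (- (norm z)\<^sup>2 / 2))))"
  proof (rule Bochner_Integration.integral_cong[OF refl], rule arg_cong2[where f = "(*)", OF refl])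
    fix x :: 'a
    have "(LBINT y. f y * (LBINT \<xi>. g \<xi> * cos (\<xi> \<bullet> (x - y))))
      = e ^ DIM('a) * (LBINT z. f (x + e *\<^sub>R z) * (sqrt (2 * pi) ^ DIM('a) * exp (- (norm ((x - (x + e *\<^sub>R z)) /\<^sub>R e))\<^sup>2 / 2) / e ^ DIM('a)))"
      unfolding g_cos using e by (subst integral_lborel_affine[where c = e and t = x]) auto
    also have "\<dots> = (LBINT z. e ^ DIM('a) * (f (x + e *\<^sub>R z) * (sqrt (2 * pi) ^ DIM('a) * exp (- (norm ((x - (x + e *\<^sub>R z)) /\<^sub>R e))\<^sup>2 / 2) / e ^ DIM('a))))"
      by simp
    also have "\<dots> = (LBINT z. f (x + e *\<^sub>R z) * (sqrt (2 * pi) ^ DIM('a) * exp (- (norm z)\<^sup>2 / 2)))"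
      using e by (intro Bochner_Integration.integral_cong) (auto simp: field_simps)
    finally show "(LBINT y. f y * (LBINT \<xi>. g \<xi> * cos (\<xi> \<bullet> (x - y))))
      = (LBINT z. f (x + e *\<^sub>R z) * (sqrt (2 * pi) ^ DIM('a) * exp (- (norm z)\<^sup>2 / 2)))" .
  qed
  finally show ?thesis unfolding g_def .
qed

text \<open>The damping in \<open>fourier_prod_gauss\<close> is removed along
  \<open>e n = 1 / real (Suc n)\<close>. The damped squares increase, so monotone convergence yields
  integrability together with the value; on the other side continuity of \<open>f\<close> and
  dominated convergence apply. The factor \<open>(2 * pi) ^ DIM('a)\<close> is \<open>c * c\<close>,
  one \<open>c\<close> from the transform of the Gaussian and one from its total mass.\<close>

lemma plancherel_square:
  fixes f :: "'a::euclidean_space \<Rightarrow> real"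
  assumes f: "cont_csupp f"
  shows "has_bochner_integral lborel (fourier_prod lborel f f) ((2 * pi) ^ DIM('a) * (LBINT x. (f x)\<^sup>2))"
proof -
  define c where "c = sqrt (2 * pi) ^ DIM('a)"
  have "c * c = (sqrt (2 * pi) * sqrt (2 * pi)) ^ DIM('a)" by (simp only: c_def power_mult_distrib)
  also have "sqrt (2 * pi) * sqrt (2 * pi) = 2 * pi" by (subst real_sqrt_mult_self) simp
  finally have c: "c \<ge> 0" "c * c = (2 * pi) ^ DIM('a)" by (simp_all add: c_def)
  define \<gamma> where "\<gamma> z = exp (- (norm z)\<^sup>2 / 2)" for z :: 'a
  have \<gamma>: "integrable lborel \<gamma>" "integral\<^sup>L lborel \<gamma> = c" "\<And>z. 0 \<le> \<gamma> z"
    unfolding \<gamma>_def[abs_def] c_def using gauss_integral[where 'a = 'a] by simp_all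
  have int: "integrable lborel f" by (rule cont_csupp_integrable[OF f])
  have [measurable]: "f \<in> borel_measurable borel" "\<gamma> \<in> borel_measurable borel"
    using int \<gamma>(1) by auto
  have [measurable]: "cos_tr lborel f \<in> borel_measurable borel" "sin_tr lborel f \<in> borel_measurable borel"
    by (auto intro: cos_sin_tr_measurable)
  have [measurable]: "fourier_prod lborel f f \<in> borel_measurable borel" unfolding fourier_prod_def[abs_def] by measurable
  have P0: "0 \<le> fourier_prod lborel f f \<xi>" for \<xi> by (simp add: fourier_prod_def)
  obtain C where C: "\<And>x. \<bar>f x\<bar> \<le> C" using cont_csupp_bounded[OF f] by blast
  define e where "e n = 1 / real (Suc n)" for n
  have e: "e n > 0" for n by (simp add: e_def)
  have e_lim: "e \<longlonglongrightarrow> 0" unfolding e_def using LIMSEQ_inverse_real_of_nat by (simp add: inverse_eq_divide)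
  define A where "A n \<xi> = \<gamma> (e n *\<^sub>R \<xi>) * fourier_prod lborel f f \<xi>" for n \<xi>
  have A_eq: "(LBINT \<xi>. A n \<xi>) = (LBINT x. f x * (LBINT z. f (x + e n *\<^sub>R z) * (c * \<gamma> z)))" for n
    unfolding A_def \<gamma>_def c_def by (rule fourier_prod_gauss[OF int e])
  have A_int: "integrable lborel (A n)" for n
  proof -
    define D where "D = (LBINT x. \<bar>f x\<bar>)"
    have D: "\<bar>cos_tr lborel f \<xi>\<bar> \<le> D" "\<bar>sin_tr lborel f \<xi>\<bar> \<le> D" for \<xi>
      unfolding D_def using cos_sin_tr_bound[OF int] by auto
    have PD: "fourier_prod lborel f f \<xi> \<le> D * D + D * D" for \<xi>
    proof -
      have "fourier_prod lborel f f \<xi> = \<bar>cos_tr lborel f \<xi>\<bar> * \<bar>cos_tr lborel f \<xi>\<bar> + \<bar>sin_tr lborel f \<xi>\<bar> * \<bar>sin_tr lborel f \<xi>\<bar>"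
        by (simp add: fourier_prod_def)
      also have "\<dots> \<le> D * D + D * D" using D[of \<xi>] by (intro add_mono mult_mono) auto
      finally show ?thesis .
    qed
    have "integrable lborel (\<lambda>\<xi>. \<gamma> (e n *\<^sub>R \<xi>))"
      using integrable_lborel_affine_iff[of \<gamma> "e n" 0] \<gamma> e[of n] by simp
    then have i: "integrable lborel (\<lambda>\<xi>. \<gamma> (e n *\<^sub>R \<xi>) * (D * D + D * D))" by (rule integrable_mult_left)
    have b: "norm (A n \<xi>) \<le> norm (\<gamma> (e n *\<^sub>R \<xi>) * (D * D + D * D))" for \<xi>
      using PD[of \<xi>] P0[of \<xi>] \<gamma>(3)[of "e n *\<^sub>R \<xi>"] by (simp only: A_def real_norm_def abs_mult abs_of_nonneg) (simp add: mult_left_mono)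
    have m: "A n \<in> borel_measurable lborel" unfolding A_def by measurable
    show ?thesis
      by (rule Bochner_Integration.integrable_bound[OF i m AE_I2[OF b]])
  qed
  have A_mono: "mono (\<lambda>n. A n \<xi>)" for \<xi>
  proof (rule incseq_SucI)
    fix n
    have "norm (e (Suc n) *\<^sub>R \<xi>) \<le> norm (e n *\<^sub>R \<xi>)"
      by (simp add: e_def mult_right_mono frac_le)
    then have "\<gamma> (e n *\<^sub>R \<xi>) \<le> \<gamma> (e (Suc n) *\<^sub>R \<xi>)" unfolding \<gamma>_def by (simp add: power_mono)
    then show "A n \<xi> \<le> A (Suc n) \<xi>" unfolding A_def using P0 by (rule mult_right_mono)
  qed
  have A_lim: "(\<lambda>n. A n \<xi>) \<longlonglongrightarrow> fourier_prod lborel f f \<xi>" for \<xi>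
  proof -
    have "(\<lambda>n. A n \<xi>) \<longlonglongrightarrow> exp (- (norm (0 *\<^sub>R \<xi>))\<^sup>2 / 2) * fourier_prod lborel f f \<xi>"
      unfolding A_def \<gamma>_def by (intro tendsto_intros e_lim) auto
    then show ?thesis by simp
  qed
  have inner_lim: "(\<lambda>n. LBINT z. f (x + e n *\<^sub>R z) * (c * \<gamma> z)) \<longlonglongrightarrow> (LBINT z. f x * (c * \<gamma> z))" for x
  proof (rule integral_dominated_convergence[where w = "\<lambda>z. C * (c * \<gamma> z)"])
    show "integrable lborel (\<lambda>z. C * (c * \<gamma> z))" using \<gamma> by simp
    show "AE z in lborel. (\<lambda>n. f (x + e n *\<^sub>R z) * (c * \<gamma> z)) \<longlonglongrightarrow> f x * (c * \<gamma> z)"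
    proof (rule AE_I2)
      fix z
      have "(\<lambda>n. x + e n *\<^sub>R z) \<longlonglongrightarrow> x + 0 *\<^sub>R z" by (intro tendsto_intros e_lim)
      moreover have "isCont f (x + 0 *\<^sub>R z)"
        using f unfolding cont_csupp_def by (simp add: continuous_on_eq_continuous_at)
      ultimately have "(\<lambda>n. f (x + e n *\<^sub>R z)) \<longlonglongrightarrow> f (x + 0 *\<^sub>R z)" by (rule isCont_tendsto_compose[rotated])
      then show "(\<lambda>n. f (x + e n *\<^sub>R z) * (c * \<gamma> z)) \<longlonglongrightarrow> f x * (c * \<gamma> z)" by (intro tendsto_mult) auto
    qed
    show "AE z in lborel. norm (f (x + e n *\<^sub>R z) * (c * \<gamma> z)) \<le> C * (c * \<gamma> z)" for n
      using C c \<gamma> by (intro AE_I2) (auto simp: abs_mult intro!: mult_right_mono)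
  qed measurable
  have inner_bound: "\<bar>\<integral>z. f (x + e n *\<^sub>R z) * (c * \<gamma> z) \<partial>lborel\<bar> \<le> C * (c * c)" for x n
  proof -
    have i: "integrable lborel (\<lambda>z. C * (c * \<gamma> z))" using \<gamma> by simp
    have b: "\<bar>f (x + e n *\<^sub>R z) * (c * \<gamma> z)\<bar> \<le> C * (c * \<gamma> z)" for z
      using C c \<gamma> by (auto simp: abs_mult intro!: mult_right_mono)
    have "integrable lborel (\<lambda>z. f (x + e n *\<^sub>R z) * (c * \<gamma> z))"
      by (rule Bochner_Integration.integrable_bound[OF i]) (use b in \<open>auto intro!: AE_I2 order_trans[OF _ abs_ge_self]\<close>)
    then have "\<bar>\<integral>z. f (x + e n *\<^sub>R z) * (c * \<gamma> z) \<partial>lborel\<bar> \<le> (LBINT z. C * (c * \<gamma> z))"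
      by (intro order_trans[OF integral_abs_bound] integral_mono i b) auto
    then show ?thesis using \<gamma> by simp
  qed
  have "(\<lambda>n. LBINT x. f x * (LBINT z. f (x + e n *\<^sub>R z) * (c * \<gamma> z)))
      \<longlonglongrightarrow> (LBINT x. f x * (LBINT z. f x * (c * \<gamma> z)))"
  proof (rule integral_dominated_convergence[where w = "\<lambda>x. \<bar>f x\<bar> * (C * (c * c))"])
    show "integrable lborel (\<lambda>x. \<bar>f x\<bar> * (C * (c * c)))" using int by simp
    show "AE x in lborel. (\<lambda>n. f x * (LBINT z. f (x + e n *\<^sub>R z) * (c * \<gamma> z))) \<longlonglongrightarrow> f x * (LBINT z. f x * (c * \<gamma> z))"
      by (intro AE_I2 tendsto_mult inner_lim) auto
    show "AE x in lborel. norm (f x * (LBINT z. f (x + e n *\<^sub>R z) * (c * \<gamma> z))) \<le> \<bar>f x\<bar> * (C * (c * c))" for n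
      using inner_bound by (intro AE_I2) (auto simp: abs_mult intro!: mult_left_mono)
  qed measurable
  also have "(LBINT x. f x * (LBINT z. f x * (c * \<gamma> z))) = (2 * pi) ^ DIM('a) * (LBINT x. (f x)\<^sup>2)"
  proof -
    have "(LBINT x. f x * (LBINT z. f x * (c * \<gamma> z))) = (LBINT x. (c * c) * (f x)\<^sup>2)"
      using \<gamma> by (simp add: power2_eq_square mult_ac)
    then show ?thesis by (simp add: c)
  qed
  finally have lim: "(\<lambda>n. LBINT \<xi>. A n \<xi>) \<longlonglongrightarrow> (2 * pi) ^ DIM('a) * (LBINT x. (f x)\<^sup>2)"
    unfolding A_eq .
  show ?thesis
    unfolding has_bochner_integral_iff
  proof
    show "integrable lborel (fourier_prod lborel f f)"
      by (rule integrable_monotone_convergence[OF A_int AE_I2[OF A_mono] AE_I2[OF A_lim] lim]) simp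
    show "integral\<^sup>L lborel (fourier_prod lborel f f) = (2 * pi) ^ DIM('a) * (LBINT x. (f x)\<^sup>2)"
      by (rule integral_monotone_convergence[OF A_int AE_I2[OF A_mono] AE_I2[OF A_lim] lim]) simp
  qed
qed

lemma cos_sin_tr_add:
  assumes "integrable M f" "integrable M g" "sets M = sets borel"
  shows "cos_tr M (\<lambda>x. f x + g x) \<xi> = cos_tr M f \<xi> + cos_tr M g \<xi>"
    "sin_tr M (\<lambda>x. f x + g x) \<xi> = sin_tr M f \<xi> + sin_tr M g \<xi>"
  using integrable_mult_cos_sin[OF assms(1,3)] integrable_mult_cos_sin[OF assms(2,3)]
  by (simp_all add: cos_tr_def sin_tr_def distrib_right)

text \<open>Polarisation: the square case is applied to \<open>f + g\<close>, \<open>f\<close> and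
  \<open>g\<close>.\<close>

lemma plancherel:
  fixes f g :: "'a::euclidean_space \<Rightarrow> real"
  assumes f: "cont_csupp f" and g: "cont_csupp g"
  shows "has_bochner_integral lborel (fourier_prod lborel f g) ((2 * pi) ^ DIM('a) * (LBINT x. f x * g x))"
proof -
  have int: "integrable lborel f" "integrable lborel g" using f g by (auto intro: cont_csupp_integrable)
  have cont: "continuous_on UNIV f" "continuous_on UNIV g" using f g by (auto simp: cont_csupp_def)
  have int2: "integrable lborel (\<lambda>x. f x * f x)" "integrable lborel (\<lambda>x. f x * g x)" "integrable lborel (\<lambda>x. g x * g x)"
    using f g cont by (auto intro!: cont_csupp_integrable cont_csupp_mult)
  have eq: "fourier_prod lborel (\<lambda>x. f x + g x) (\<lambda>x. f x + g x) \<xi>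
    = fourier_prod lborel f f \<xi> + 2 * fourier_prod lborel f g \<xi> + fourier_prod lborel g g \<xi>" for \<xi>
    using cos_sin_tr_add[OF int] by (simp add: fourier_prod_def algebra_simps)
  have "has_bochner_integral lborel (\<lambda>\<xi>. (fourier_prod lborel (\<lambda>x. f x + g x) (\<lambda>x. f x + g x) \<xi>
      - fourier_prod lborel f f \<xi> - fourier_prod lborel g g \<xi>) / 2)
    (((2 * pi) ^ DIM('a) * (LBINT x. (f x + g x)\<^sup>2) - (2 * pi) ^ DIM('a) * (LBINT x. (f x)\<^sup>2)
      - (2 * pi) ^ DIM('a) * (LBINT x. (g x)\<^sup>2)) / 2)"
    using f g by (intro has_bochner_integral_divide has_bochner_integral_diff plancherel_square cont_csupp_add) auto
  moreover have "(LBINT x. (f x + g x)\<^sup>2) = (LBINT x. (f x)\<^sup>2) + 2 * (LBINT x. f x * g x) + (LBINT x. (g x)\<^sup>2)"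
  proof -
    have "(LBINT x. (f x + g x)\<^sup>2) = (LBINT x. f x * f x + 2 * (f x * g x) + g x * g x)"
      by (simp add: power2_eq_square algebra_simps)
    then show ?thesis using int2 by (simp add: power2_eq_square)
  qed
  ultimately show ?thesis unfolding eq by (simp add: algebra_simps)
qed

subsection \<open>Test functions\<close>

lemma iter_pderiv_Nil [simp]: "iter_pderiv [] f = f"
  by (simp add: iter_pderiv_def)

lemma iter_pderiv_Cons: "iter_pderiv (i # is) f = pderiv_at i (iter_pderiv is f)"
  by (simp add: iter_pderiv_def)

lemma iter_pderiv_append: "iter_pderiv (is @ js) f = iter_pderiv is (iter_pderiv js f)"
  by (simp add: iter_pderiv_def)

lemma smooth_fun_iter_pderiv: "smooth_fun f \<Longrightarrow> smooth_fun (iter_pderiv is f)"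
  unfolding smooth_fun_def iter_pderiv_append[symmetric] by blast

lemma smooth_fun_pderiv_at: "smooth_fun f \<Longrightarrow> smooth_fun (pderiv_at i f)"
  using smooth_fun_iter_pderiv[of f "[i]"] by (simp add: iter_pderiv_Cons)

lemma smooth_fun_differentiable: "smooth_fun f \<Longrightarrow> f differentiable (at x)"
  unfolding smooth_fun_def by (metis iter_pderiv_Nil)

lemma smooth_fun_continuous: "smooth_fun f \<Longrightarrow> continuous_on UNIV f"
  using smooth_fun_differentiable
  by (auto simp: continuous_on_eq_continuous_at intro: differentiable_imp_continuous_within)

lemma pderiv_at_linear:
  assumes "f differentiable (at x)" "g differentiable (at x)"
  shows "pderiv_at i (\<lambda>x. a * f x + b * g x) x = a * pderiv_at i f x + b * pderiv_at i g x"
proof -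
  have "((\<lambda>x. a * f x + b * g x) has_derivative
      (\<lambda>h. a * frechet_derivative f (at x) h + b * frechet_derivative g (at x) h)) (at x)"
    using assms by (auto intro!: derivative_eq_intros simp: frechet_derivative_works)
  then show ?thesis
    by (simp add: pderiv_at_def frechet_derivative_at[symmetric])
qed

lemma iter_pderiv_linear:
  assumes f: "smooth_fun f" and g: "smooth_fun g"
  shows "iter_pderiv is (\<lambda>x. a * f x + b * g x) = (\<lambda>x. a * iter_pderiv is f x + b * iter_pderiv is g x)"
proof (induction "is")
  case (Cons i "is")
  have "iter_pderiv is f differentiable (at x)" "iter_pderiv is g differentiable (at x)" for x
    using f g unfolding smooth_fun_def by auto
  then show ?case
    unfolding iter_pderiv_Cons Cons.IH by (intro ext pderiv_at_linear)
qed simp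

lemma smooth_fun_linear:
  assumes "smooth_fun f" "smooth_fun g"
  shows "smooth_fun (\<lambda>x. a * f x + b * g x)"
  using assms unfolding smooth_fun_def
  by (simp add: iter_pderiv_linear[OF assms])

lemma test_funsI:
  assumes "smooth_fun f" "compact K" "K \<subseteq> \<Omega>" "\<And>x. x \<notin> K \<Longrightarrow> f x = 0"
  shows "f \<in> test_funs \<Omega>"
proof -
  have "closure {x. f x \<noteq> 0} \<subseteq> K"
    using assms by (intro closure_minimal) (auto intro: compact_imp_closed)
  moreover then have "compact (closure {x. f x \<noteq> 0})"
    using assms(2) by (metis closed_closure compact_Int_closed inf.absorb2)
  ultimately show ?thesis using assms unfolding test_funs_def by auto
qed

lemma test_funs_smooth: "f \<in> test_funs \<Omega> \<Longrightarrow> smooth_fun f"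
  unfolding test_funs_def by simp

lemma test_funs_support:
  assumes "f \<in> test_funs \<Omega>"
  obtains K where "compact K" "K \<subseteq> \<Omega>" "\<And>x. x \<notin> K \<Longrightarrow> f x = 0"
proof -
  have "x \<notin> closure {x. f x \<noteq> 0} \<Longrightarrow> f x = 0" for x
    using closure_subset[of "{x. f x \<noteq> 0}"] by auto
  then show ?thesis using assms that[of "closure {x. f x \<noteq> 0}"] unfolding test_funs_def by blast
qed

lemma test_funs_linear:
  assumes "f \<in> test_funs \<Omega>" "g \<in> test_funs \<Omega>"
  shows "(\<lambda>x. a * f x + b * g x) \<in> test_funs \<Omega>"
proof -
  obtain K where K: "compact K" "K \<subseteq> \<Omega>" "\<And>x. x \<notin> K \<Longrightarrow> f x = 0" using test_funs_support[OF assms(1)] by blast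
  obtain L where L: "compact L" "L \<subseteq> \<Omega>" "\<And>x. x \<notin> L \<Longrightarrow> g x = 0" using test_funs_support[OF assms(2)] by blast
  show ?thesis
    using K L assms by (intro test_funsI[of _ "K \<union> L"] smooth_fun_linear) (auto intro: test_funs_smooth)
qed

lemma test_funs_zero: "(\<lambda>x. 0) \<in> test_funs \<Omega>"
proof -
  have "iter_pderiv is (\<lambda>x. 0) = (\<lambda>x. 0)" for "is" :: "'a list"
  proof (induction "is")
    case (Cons i "is")
    then show ?case by (simp add: iter_pderiv_Cons pderiv_at_def)
  qed simp
  then have "smooth_fun (\<lambda>x::real^'a. 0)" by (simp add: smooth_fun_def)
  then show ?thesis by (intro test_funsI[of _ "{}"]) auto
qed

lemma test_funs_sum:
  assumes "finite I" "\<And>i. i \<in> I \<Longrightarrow> f i \<in> test_funs \<Omega>"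
  shows "(\<lambda>x. \<Sum>i\<in>I. a i * f i x) \<in> test_funs \<Omega>"
  using assms
proof (induction I rule: finite_induct)
  case (insert i I)
  then have "(\<lambda>x. a i * f i x + 1 * (\<Sum>i\<in>I. a i * f i x)) \<in> test_funs \<Omega>"
    by (intro test_funs_linear) auto
  then show ?case using insert by simp
qed (simp add: test_funs_zero)

lemma test_funs_pderiv_at:
  assumes f: "f \<in> test_funs \<Omega>"
  shows "pderiv_at i f \<in> test_funs \<Omega>"
proof -
  obtain K where K: "compact K" "K \<subseteq> \<Omega>" "\<And>x. x \<notin> K \<Longrightarrow> f x = 0" using test_funs_support[OF f] by blast
  have "pderiv_at i f x = 0" if x: "x \<notin> K" for x
  proof -
    have "((\<lambda>x. 0) has_derivative (\<lambda>h. 0::real)) (at x)" by simp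
    moreover have "open (- K)" "x \<in> - K" using K x by (auto simp: compact_imp_closed)
    ultimately have "(f has_derivative (\<lambda>h. 0)) (at x)"
      by (rule has_derivative_transform_within_open) (use K in auto)
    then show ?thesis by (simp add: pderiv_at_def frechet_derivative_at[symmetric])
  qed
  then show ?thesis
    using K f by (intro test_funsI[of _ K] smooth_fun_pderiv_at) (auto intro: test_funs_smooth)
qed

lemma test_funs_iter_pderiv: "f \<in> test_funs \<Omega> \<Longrightarrow> iter_pderiv is f \<in> test_funs \<Omega>"
  by (induction "is") (auto simp: iter_pderiv_Cons intro: test_funs_pderiv_at)

lemma test_funs_neg_laplacian:
  assumes "f \<in> test_funs \<Omega>"
  shows "neg_laplacian f \<in> test_funs \<Omega>"
proof -
  have "(\<lambda>x. \<Sum>i\<in>UNIV. (-1) * pderiv_at i (pderiv_at i f) x) \<in> test_funs \<Omega>"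
    by (intro test_funs_sum test_funs_pderiv_at assms finite)
  then show ?thesis by (simp add: neg_laplacian_def sum_negf)
qed

lemma test_funs_neg_laplacian_pow: "f \<in> test_funs \<Omega> \<Longrightarrow> (neg_laplacian ^^ l) f \<in> test_funs \<Omega>"
  by (induction l) (auto intro: test_funs_neg_laplacian)

lemma test_funs_cont_csupp:
  assumes f: "f \<in> test_funs \<Omega>"
  shows "cont_csupp f"
proof -
  obtain K where K: "compact K" "K \<subseteq> \<Omega>" "\<And>x. x \<notin> K \<Longrightarrow> f x = 0" using test_funs_support[OF f] by blast
  obtain B where "\<forall>x\<in>K. norm x \<le> B"
    using compact_imp_bounded[OF K(1)] unfolding bounded_iff by blast
  then have "\<forall>x. norm x > B \<longrightarrow> f x = 0" using K(3) by force
  then show ?thesis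
    unfolding cont_csupp_def using f smooth_fun_continuous test_funs_smooth by blast
qed

section \<open>Fourier transforms of derivatives\<close>

text \<open>By translation invariance every difference quotient of \<open>h\<close> has integral
  zero. The quotients converge to \<open>D\<close>; by the mean value theorem they are bounded by
  \<open>C\<close>, and steps of length at most 1 keep their supports within the ball of radius
  \<open>B + norm e\<close>. This serves as integration by parts, with no iterated
  integrals.\<close>

lemma integral_directional_derivative_zero:
  fixes h D :: "'a::euclidean_space \<Rightarrow> real"
  assumes h: "cont_csupp h" and D: "cont_csupp D"
    and der: "\<And>x s. ((\<lambda>t. h (x + t *\<^sub>R e)) has_real_derivative D (x + s *\<^sub>R e)) (at s)"
  shows "(LBINT x. D x) = 0"
proof -
  have [measurable]: "h \<in> borel_measurable borel" "D \<in> borel_measurable borel"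
    using h D by (auto intro: cont_csupp_measurable)
  obtain C where C: "\<And>x. \<bar>D x\<bar> \<le> C" using cont_csupp_bounded[OF D] by blast
  obtain B where B: "\<And>x. norm x > B \<Longrightarrow> D x = 0" using D unfolding cont_csupp_def by blast
  define \<epsilon> where "\<epsilon> n = 1 / real (Suc n)" for n
  have \<epsilon>: "0 < \<epsilon> n" "\<epsilon> n \<le> 1" for n by (auto simp: \<epsilon>_def)
  define q where "q n x = (h (x + \<epsilon> n *\<^sub>R e) - h x) / \<epsilon> n" for n x
  have q0: "(LBINT x. q n x) = 0" for n
  proof -
    have "integrable lborel h" using h by (rule cont_csupp_integrable)
    then have "integrable lborel (\<lambda>x. h (x + \<epsilon> n *\<^sub>R e))"
      "(LBINT x. h (x + \<epsilon> n *\<^sub>R e)) = (LBINT x. h x)"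
      using integrable_lborel_affine_iff[of h 1 "\<epsilon> n *\<^sub>R e"] integral_lborel_affine[of h 1 "\<epsilon> n *\<^sub>R e"]
      by (simp_all add: add.commute)
    then show ?thesis using \<open>integrable lborel h\<close> unfolding q_def by simp
  qed
  have "(\<lambda>n. LBINT x. q n x) \<longlonglongrightarrow> (LBINT x. D x)"
  proof (rule integral_dominated_convergence[where w = "\<lambda>x. C * indicator (cball 0 (B + norm e)) x"])
    show "integrable lborel (\<lambda>x::'a. C * indicator (cball 0 (B + norm e)) x)"
      by (intro integrable_mult_right integrable_real_indicator emeasure_bounded_finite) auto
    show "AE x in lborel. (\<lambda>n. q n x) \<longlonglongrightarrow> D x"
    proof (rule AE_I2)
      fix x
      have "((\<lambda>t. (h (x + t *\<^sub>R e) - h (x + 0 *\<^sub>R e)) / (t - 0)) \<longlongrightarrow> D (x + 0 *\<^sub>R e)) (at 0)"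
        using der[of x 0] unfolding has_field_derivative_iff .
      moreover have "filterlim \<epsilon> (at 0) sequentially"
      proof -
        have "\<epsilon> \<longlonglongrightarrow> 0" unfolding \<epsilon>_def using LIMSEQ_inverse_real_of_nat by (simp add: inverse_eq_divide)
        then show ?thesis unfolding filterlim_at using \<epsilon>(1) by (auto simp: less_imp_neq[symmetric] intro!: always_eventually) 
      qed
      ultimately have "(\<lambda>n. (h (x + \<epsilon> n *\<^sub>R e) - h (x + 0 *\<^sub>R e)) / (\<epsilon> n - 0)) \<longlonglongrightarrow> D (x + 0 *\<^sub>R e)"
        by (rule filterlim_compose)
      then show "(\<lambda>n. q n x) \<longlonglongrightarrow> D x" by (simp add: q_def)
    qed
    show "AE x in lborel. norm (q n x) \<le> C * indicator (cball 0 (B + norm e)) x" for n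
    proof (rule AE_I2)
      fix x
      have "\<exists>z. 0 < z \<and> z < \<epsilon> n \<and> h (x + \<epsilon> n *\<^sub>R e) - h (x + 0 *\<^sub>R e) = (\<epsilon> n - 0) * D (x + z *\<^sub>R e)"
        using \<epsilon>[of n] by (intro MVT2 der)
      then obtain z where z: "0 < z" "z < \<epsilon> n" "q n x = D (x + z *\<^sub>R e)"
        using \<epsilon>[of n] by (auto simp: q_def field_simps)
      have "D (x + z *\<^sub>R e) = 0" if "norm x > B + norm e"
      proof (rule B)
        have "norm (z *\<^sub>R e) \<le> norm e" using z \<epsilon>[of n] by (simp add: mult_left_le_one_le)
        moreover have "norm x \<le> norm (x + z *\<^sub>R e) + norm (z *\<^sub>R e)" using norm_triangle_ineq4[of "x + z *\<^sub>R e" "z *\<^sub>R e"] by simp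
        ultimately show "norm (x + z *\<^sub>R e) > B" using that by linarith
      qed
      then show "norm (q n x) \<le> C * indicator (cball 0 (B + norm e)) x"
        unfolding z(3) using C[of "x + z *\<^sub>R e"] by (auto simp: indicator_def)
    qed
  qed (auto simp: q_def)
  then show ?thesis unfolding q0 by (simp add: LIMSEQ_const_iff)
qed

lemma test_fun_line_derivative:
  assumes "f \<in> test_funs \<Omega>"
  shows "((\<lambda>t. f (x + t *\<^sub>R axis i 1)) has_real_derivative pderiv_at i f (x + s *\<^sub>R axis i 1)) (at s)"
proof -
  have "(f has_derivative frechet_derivative f (at (x + s *\<^sub>R axis i 1))) (at (x + s *\<^sub>R axis i 1))"
    using smooth_fun_differentiable[OF test_funs_smooth[OF assms]] by (simp add: frechet_derivative_works[symmetric])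
  then have "((\<lambda>t. f (x + t *\<^sub>R axis i 1)) has_derivative (\<lambda>h. frechet_derivative f (at (x + s *\<^sub>R axis i 1)) (h *\<^sub>R axis i 1))) (at s)"
    by (rule has_derivative_compose[rotated]) (auto intro!: derivative_eq_intros)
  moreover have "frechet_derivative f (at (x + s *\<^sub>R axis i 1)) (h *\<^sub>R axis i 1) = pderiv_at i f (x + s *\<^sub>R axis i 1) * h" for h
    using linear_frechet_derivative[OF smooth_fun_differentiable[OF test_funs_smooth[OF assms]]]
    by (simp add: linear_scale pderiv_at_def)
  ultimately show ?thesis by (simp add: has_field_derivative_def)
qed

text \<open>Integration by parts: the derivatives of \<open>f x * cos (\<xi> \<bullet> x)\<close>
  and \<open>f x * sin (\<xi> \<bullet> x)\<close> along the \<open>i\<close>-th axis integrate to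
  zero.\<close>

lemma cos_sin_tr_pderiv:
  fixes f :: "real^'n \<Rightarrow> real"
  assumes f: "f \<in> test_funs \<Omega>"
  shows "cos_tr lborel (pderiv_at i f) \<xi> = \<xi> $ i * sin_tr lborel f \<xi>"
    and "sin_tr lborel (pderiv_at i f) \<xi> = - (\<xi> $ i * cos_tr lborel f \<xi>)"
proof -
  have cc: "cont_csupp f" "cont_csupp (pderiv_at i f)"
    using f by (auto intro: test_funs_cont_csupp test_funs_pderiv_at)
  have cos: "continuous_on UNIV (\<lambda>x. cos (\<xi> \<bullet> x))" and sin: "continuous_on UNIV (\<lambda>x. sin (\<xi> \<bullet> x))"
    by (auto intro!: continuous_intros)
  have int: "integrable lborel (\<lambda>x. g x * cos (\<xi> \<bullet> x))" "integrable lborel (\<lambda>x. g x * sin (\<xi> \<bullet> x))" if "cont_csupp g" for g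
    using that cos sin by (auto intro!: cont_csupp_integrable cont_csupp_mult)
  have ax: "\<xi> \<bullet> (x + t *\<^sub>R axis i 1) = \<xi> \<bullet> x + t * \<xi> $ i" for x t
    by (simp add: inner_add_right inner_axis)
  have "(LBINT x. pderiv_at i f x * cos (\<xi> \<bullet> x) + f x * (- \<xi> $ i * sin (\<xi> \<bullet> x))) = 0"
  proof (rule integral_directional_derivative_zero[where h = "\<lambda>x. f x * cos (\<xi> \<bullet> x)" and e = "axis i 1"])
    show "cont_csupp (\<lambda>x. pderiv_at i f x * cos (\<xi> \<bullet> x) + f x * (- \<xi> $ i * sin (\<xi> \<bullet> x)))"
      using cc by (intro cont_csupp_add cont_csupp_mult) (auto intro!: continuous_intros)
    show "((\<lambda>t. f (x + t *\<^sub>R axis i 1) * cos (\<xi> \<bullet> (x + t *\<^sub>R axis i 1))) has_real_derivative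
        pderiv_at i f (x + s *\<^sub>R axis i 1) * cos (\<xi> \<bullet> (x + s *\<^sub>R axis i 1))
        + f (x + s *\<^sub>R axis i 1) * (- \<xi> $ i * sin (\<xi> \<bullet> (x + s *\<^sub>R axis i 1)))) (at s)" for x s
      unfolding ax by (auto intro!: derivative_eq_intros test_fun_line_derivative[OF f])
  qed (use cc cos in \<open>auto intro: cont_csupp_mult\<close>)
  then have "(LBINT x. pderiv_at i f x * cos (\<xi> \<bullet> x) - \<xi> $ i * (f x * sin (\<xi> \<bullet> x))) = 0"
    by (simp add: algebra_simps)
  then show "cos_tr lborel (pderiv_at i f) \<xi> = \<xi> $ i * sin_tr lborel f \<xi>"
    unfolding cos_tr_def sin_tr_def using int[OF cc(1)] int[OF cc(2)] by simp
  have "(LBINT x. pderiv_at i f x * sin (\<xi> \<bullet> x) + f x * (\<xi> $ i * cos (\<xi> \<bullet> x))) = 0"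
  proof (rule integral_directional_derivative_zero[where h = "\<lambda>x. f x * sin (\<xi> \<bullet> x)" and e = "axis i 1"])
    show "cont_csupp (\<lambda>x. pderiv_at i f x * sin (\<xi> \<bullet> x) + f x * (\<xi> $ i * cos (\<xi> \<bullet> x)))"
      using cc by (intro cont_csupp_add cont_csupp_mult) (auto intro!: continuous_intros)
    show "((\<lambda>t. f (x + t *\<^sub>R axis i 1) * sin (\<xi> \<bullet> (x + t *\<^sub>R axis i 1))) has_real_derivative
        pderiv_at i f (x + s *\<^sub>R axis i 1) * sin (\<xi> \<bullet> (x + s *\<^sub>R axis i 1))
        + f (x + s *\<^sub>R axis i 1) * (\<xi> $ i * cos (\<xi> \<bullet> (x + s *\<^sub>R axis i 1)))) (at s)" for x s
      unfolding ax by (auto intro!: derivative_eq_intros test_fun_line_derivative[OF f])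
  qed (use cc sin in \<open>auto intro: cont_csupp_mult\<close>)
  then have "(LBINT x. pderiv_at i f x * sin (\<xi> \<bullet> x) + \<xi> $ i * (f x * cos (\<xi> \<bullet> x))) = 0"
    by (simp add: algebra_simps)
  then show "sin_tr lborel (pderiv_at i f) \<xi> = - (\<xi> $ i * cos_tr lborel f \<xi>)"
    unfolding cos_tr_def sin_tr_def using int[OF cc(1)] int[OF cc(2)] by (simp add: add_eq_0_iff)
qed

lemma norm_vec_square: "(norm \<xi>)\<^sup>2 = (\<Sum>i\<in>UNIV. (\<xi> $ i)\<^sup>2)" for \<xi> :: "real^'n"
  unfolding power2_norm_eq_inner inner_vec_def by (simp add: power2_eq_square)

lemma cos_sin_tr_neg_laplacian:
  fixes f :: "real^'n \<Rightarrow> real"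
  assumes f: "f \<in> test_funs \<Omega>"
  shows "cos_tr lborel (neg_laplacian f) \<xi> = (norm \<xi>)\<^sup>2 * cos_tr lborel f \<xi>"
    and "sin_tr lborel (neg_laplacian f) \<xi> = (norm \<xi>)\<^sup>2 * sin_tr lborel f \<xi>"
proof -
  have cc: "cont_csupp (pderiv_at i (pderiv_at i f))" for i
    using f by (intro test_funs_cont_csupp test_funs_pderiv_at)
  have int: "integrable lborel (\<lambda>x. pderiv_at i (pderiv_at i f) x * cos (\<xi> \<bullet> x))"
    "integrable lborel (\<lambda>x. pderiv_at i (pderiv_at i f) x * sin (\<xi> \<bullet> x))" for i
    using integrable_mult_cos_sin[OF cont_csupp_integrable[OF cc]] by auto
  have "cos_tr lborel (neg_laplacian f) \<xi> = - (\<Sum>i\<in>UNIV. cos_tr lborel (pderiv_at i (pderiv_at i f)) \<xi>)"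
    unfolding cos_tr_def neg_laplacian_def using int by (simp add: sum_distrib_right)
  also have "\<dots> = (norm \<xi>)\<^sup>2 * cos_tr lborel f \<xi>"
    by (simp add: cos_sin_tr_pderiv[OF test_funs_pderiv_at[OF f]] cos_sin_tr_pderiv[OF f] norm_vec_square
        sum_distrib_right sum_negf) (simp add: power2_eq_square mult.assoc)
  finally show "cos_tr lborel (neg_laplacian f) \<xi> = (norm \<xi>)\<^sup>2 * cos_tr lborel f \<xi>" .
  have "sin_tr lborel (neg_laplacian f) \<xi> = - (\<Sum>i\<in>UNIV. sin_tr lborel (pderiv_at i (pderiv_at i f)) \<xi>)"
    unfolding sin_tr_def neg_laplacian_def using int by (simp add: sum_distrib_right)
  also have "\<dots> = (norm \<xi>)\<^sup>2 * sin_tr lborel f \<xi>"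
    by (simp add: cos_sin_tr_pderiv[OF test_funs_pderiv_at[OF f]] cos_sin_tr_pderiv[OF f] norm_vec_square
        sum_distrib_right sum_negf) (simp add: power2_eq_square mult.assoc)
  finally show "sin_tr lborel (neg_laplacian f) \<xi> = (norm \<xi>)\<^sup>2 * sin_tr lborel f \<xi>" .
qed

lemma cos_sin_tr_neg_laplacian_pow:
  fixes f :: "real^'n \<Rightarrow> real"
  assumes f: "f \<in> test_funs \<Omega>"
  shows "cos_tr lborel ((neg_laplacian ^^ l) f) \<xi> = norm \<xi> ^ (2 * l) * cos_tr lborel f \<xi>"
    and "sin_tr lborel ((neg_laplacian ^^ l) f) \<xi> = norm \<xi> ^ (2 * l) * sin_tr lborel f \<xi>"
  by (induction l) (simp_all add: cos_sin_tr_neg_laplacian[OF test_funs_neg_laplacian_pow[OF f]] power2_eq_square)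

lemma sum_lists_Suc:
  fixes F :: "'n::finite list \<Rightarrow> real"
  shows "(\<Sum>is | length is = Suc l. F is) = (\<Sum>i\<in>UNIV. \<Sum>is | length is = l. F (i # is))"
proof -
  have eq: "{is :: 'n list. length is = Suc l} = (\<lambda>(i, is). i # is) ` (UNIV \<times> {is. length is = l})"
    by (auto simp: length_Suc_conv image_iff)
  have "inj_on (\<lambda>(i, is). i # is) (UNIV \<times> {is :: 'n list. length is = l})" by (auto simp: inj_on_def)
  then have "(\<Sum>is | length is = Suc l. F is) = (\<Sum>(i, is)\<in>UNIV \<times> {is. length is = l}. F (i # is))"
    unfolding eq by (subst sum.reindex) (auto simp: split_beta o_def)
  then show ?thesis by (simp add: sum.cartesian_product)
qed

text \<open>The sum runs over words, not multi-indices, so no multinomial coefficients appear: each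
  further letter \<open>i\<close> contributes the factor \<open>(\<xi> $ i)\<^sup>2\<close>, and
  these factors add up to \<open>(norm \<xi>)\<^sup>2\<close>.\<close>

lemma fourier_prod_iter_pderiv:
  fixes f g :: "real^'n \<Rightarrow> real"
  assumes f: "f \<in> test_funs \<Omega>" and g: "g \<in> test_funs \<Omega>"
  shows "(\<Sum>is | length is = l. fourier_prod lborel (iter_pderiv is f) (iter_pderiv is g) \<xi>)
    = norm \<xi> ^ (2 * l) * fourier_prod lborel f g \<xi>"
proof (induction l)
  case (Suc l)
  have "fourier_prod lborel (iter_pderiv (i # is) f) (iter_pderiv (i # is) g) \<xi>
    = (\<xi> $ i)\<^sup>2 * fourier_prod lborel (iter_pderiv is f) (iter_pderiv is g) \<xi>" for i "is"
    unfolding iter_pderiv_Cons fourier_prod_def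
    by (simp add: cos_sin_tr_pderiv[OF test_funs_iter_pderiv[OF f]] cos_sin_tr_pderiv[OF test_funs_iter_pderiv[OF g]]
        algebra_simps power2_eq_square)
  then have "(\<Sum>is | length is = Suc l. fourier_prod lborel (iter_pderiv is f) (iter_pderiv is g) \<xi>)
    = (\<Sum>i\<in>UNIV. (\<xi> $ i)\<^sup>2 * (norm \<xi> ^ (2 * l) * fourier_prod lborel f g \<xi>))"
    unfolding sum_lists_Suc by (simp add: sum_distrib_left[symmetric] Suc)
  also have "\<dots> = norm \<xi> ^ (2 * Suc l) * fourier_prod lborel f g \<xi>"
    by (simp only: sum_distrib_right[symmetric] norm_vec_square[symmetric])
      (simp add: power2_eq_square)
  finally show ?case .
qed simp

text \<open>The Fourier side makes commuting the mixed partial derivatives unnecessary.\<close>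

lemma integral_neg_laplacian_pow:
  fixes f g :: "real^'n \<Rightarrow> real"
  assumes f: "f \<in> test_funs \<Omega>" and g: "g \<in> test_funs \<Omega>"
  shows "(LBINT x. f x * (neg_laplacian ^^ l) g x)
    = (\<Sum>is | length is = l. LBINT x. iter_pderiv is f x * iter_pderiv is g x)"
proof -
  have "has_bochner_integral lborel (fourier_prod lborel f ((neg_laplacian ^^ l) g))
      ((2 * pi) ^ DIM(real^'n) * (LBINT x. f x * (neg_laplacian ^^ l) g x))"
    using f g by (intro plancherel test_funs_cont_csupp test_funs_neg_laplacian_pow)
  moreover have "fourier_prod lborel f ((neg_laplacian ^^ l) g)
    = (\<lambda>\<xi>. \<Sum>is | length is = l. fourier_prod lborel (iter_pderiv is f) (iter_pderiv is g) \<xi>)"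
    unfolding fourier_prod_iter_pderiv[OF f g]
    by (simp add: fourier_prod_def cos_sin_tr_neg_laplacian_pow[OF g] algebra_simps fun_eq_iff)
  moreover have "has_bochner_integral lborel (\<lambda>\<xi>. \<Sum>is | length is = l. fourier_prod lborel (iter_pderiv is f) (iter_pderiv is g) \<xi>)
      (\<Sum>is | length is = l. (2 * pi) ^ DIM(real^'n) * (LBINT x. iter_pderiv is f x * iter_pderiv is g x))"
    using f g by (intro has_bochner_integral_sum plancherel test_funs_cont_csupp test_funs_iter_pderiv)
  ultimately have "(2 * pi) ^ DIM(real^'n) * (LBINT x. f x * (neg_laplacian ^^ l) g x)
    = (2 * pi) ^ DIM(real^'n) * (\<Sum>is | length is = l. LBINT x. iter_pderiv is f x * iter_pderiv is g x)"
    unfolding sum_distrib_left by (simp only: has_bochner_integral_iff)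
  then show ?thesis by simp
qed

lemma fourier_moment_test_fun:
  fixes f :: "real^'n \<Rightarrow> real"
  assumes f: "f \<in> test_funs \<Omega>"
  shows "has_bochner_integral lborel (\<lambda>\<xi>. norm \<xi> ^ (2 * l) * fourier_prod lborel f f \<xi>)
    ((2 * pi) ^ DIM(real^'n) * (\<Sum>is | length is = l. LBINT x. (iter_pderiv is f x)\<^sup>2))"
  unfolding fourier_prod_iter_pderiv[OF f f, symmetric] sum_distrib_left
  using f by (intro has_bochner_integral_sum plancherel_square test_funs_cont_csupp test_funs_iter_pderiv)

subsection \<open>Square-integrable functions\<close>

definition sq_int :: "'a measure \<Rightarrow> ('a \<Rightarrow> real) set" where
  "sq_int M = {f \<in> borel_measurable M. integrable M (\<lambda>x. (f x)\<^sup>2)}"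

lemma L2_eq_sq_int: "L2 \<Omega> = sq_int (lebesgue_on \<Omega>)"
  by (simp add: L2_def sq_int_def)

lemma sq_int_mult:
  assumes "f \<in> sq_int M" "g \<in> sq_int M"
  shows "integrable M (\<lambda>x. f x * g x)"
proof (rule Bochner_Integration.integrable_bound)
  show "integrable M (\<lambda>x. (f x)\<^sup>2 + (g x)\<^sup>2)" using assms by (auto simp: sq_int_def)
  show "(\<lambda>x. f x * g x) \<in> borel_measurable M" using assms by (auto simp: sq_int_def)
  have "\<bar>f x * g x\<bar> \<le> (f x)\<^sup>2 + (g x)\<^sup>2" for x
    using sum_squares_bound[of "\<bar>f x\<bar>" "\<bar>g x\<bar>"] abs_ge_zero[of "f x * g x"] by (simp only: abs_mult power2_abs)
  then show "AE x in M. norm (f x * g x) \<le> norm ((f x)\<^sup>2 + (g x)\<^sup>2)" by simp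
qed

lemma sq_int_linear:
  assumes f: "f \<in> sq_int M" and g: "g \<in> sq_int M"
  shows "(\<lambda>x. a * f x + b * g x) \<in> sq_int M"
proof -
  have "integrable M (\<lambda>x. a\<^sup>2 * (f x * f x) + (2 * a * b) * (f x * g x) + b\<^sup>2 * (g x * g x))"
    using sq_int_mult[OF f f] sq_int_mult[OF f g] sq_int_mult[OF g g] by simp
  then have "integrable M (\<lambda>x. (a * f x + b * g x)\<^sup>2)"
    by (simp add: power2_eq_square algebra_simps)
  then show ?thesis using f g by (auto simp: sq_int_def)
qed

lemma sq_int_diff: "f \<in> sq_int M \<Longrightarrow> g \<in> sq_int M \<Longrightarrow> (\<lambda>x. f x - g x) \<in> sq_int M"
  using sq_int_linear[of f M g 1 "-1"] by simp

lemma integral_square_linear: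
  assumes f: "f \<in> sq_int M" and g: "g \<in> sq_int M"
  shows "(LINT x|M. (a * f x + b * g x)\<^sup>2)
    = a\<^sup>2 * (LINT x|M. (f x)\<^sup>2) + 2 * a * b * (LINT x|M. f x * g x) + b\<^sup>2 * (LINT x|M. (g x)\<^sup>2)"
proof -
  have "(LINT x|M. (a * f x + b * g x)\<^sup>2) = (LINT x|M. a\<^sup>2 * (f x * f x) + (2 * a * b) * (f x * g x) + b\<^sup>2 * (g x * g x))"
    by (simp add: power2_eq_square algebra_simps)
  then show ?thesis
    using sq_int_mult[OF f f] sq_int_mult[OF f g] sq_int_mult[OF g g] by (simp add: power2_eq_square)
qed

text \<open>The quadratic form \<open>quad\<close> is nonnegative, and at the coefficients
  \<open>C\<close> and \<open>- B\<close> it takes the value \<open>C * (A * C - B\<^sup>2)\<close>.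
  If \<open>C = 0\<close>, it is affine in the second coefficient, and
  \<open>- (A + 1) / (2 * B)\<close> would make it \<open>- 1\<close> unless
  \<open>B = 0\<close>.\<close>

lemma integral_cauchy_schwarz:
  assumes f: "f \<in> sq_int M" and g: "g \<in> sq_int M"
  shows "(LINT x|M. f x * g x)\<^sup>2 \<le> (LINT x|M. (f x)\<^sup>2) * (LINT x|M. (g x)\<^sup>2)"
proof -
  define A B C where "A = (LINT x|M. (f x)\<^sup>2)" and "B = (LINT x|M. f x * g x)" and "C = (LINT x|M. (g x)\<^sup>2)"
  have quad: "0 \<le> a\<^sup>2 * A + 2 * a * b * B + b\<^sup>2 * C" for a b
    unfolding A_def B_def C_def integral_square_linear[OF f g, symmetric] by simp
  have "C \<ge> 0" unfolding C_def by simp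
  show ?thesis
  proof (cases "C = 0")
    case True
    have "B = 0"
    proof (rule ccontr)
      assume "B \<noteq> 0"
      then have "1\<^sup>2 * A + 2 * 1 * (- (A + 1) / (2 * B)) * B + (- (A + 1) / (2 * B))\<^sup>2 * C = -1"
        using True by (simp add: field_simps)
      then show False using quad[of 1 "- (A + 1) / (2 * B)"] by linarith
    qed
    then show ?thesis using True unfolding A_def B_def C_def by simp
  next
    case False
    then have "C > 0" using \<open>C \<ge> 0\<close> by simp
    have "0 \<le> C * (A * C - B\<^sup>2)"
      using quad[of C "- B"] by (simp add: power2_eq_square algebra_simps)
    then have "B\<^sup>2 \<le> A * C" using \<open>C > 0\<close> by (simp add: zero_le_mult_iff)
    then show ?thesis unfolding A_def B_def C_def .
  qed
qed

section \<open>Convergence in mean square\<close>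

text \<open>Square-integrability is part of the notion, because the integral of a non-integrable
  function is 0 by default and the limit condition alone could hold vacuously.\<close>

definition l2_tendsto :: "'a measure \<Rightarrow> (nat \<Rightarrow> 'a \<Rightarrow> real) \<Rightarrow> ('a \<Rightarrow> real) \<Rightarrow> bool" where
  "l2_tendsto M \<phi> u \<longleftrightarrow> (\<forall>n. \<phi> n \<in> sq_int M) \<and> u \<in> sq_int M \<and> (\<lambda>n. LINT x|M. (\<phi> n x - u x)\<^sup>2) \<longlonglongrightarrow> 0"

lemma l2_tendsto_const: "u \<in> sq_int M \<Longrightarrow> l2_tendsto M (\<lambda>n. u) u"
  by (simp add: l2_tendsto_def)

lemma l2_tendsto_linear:
  assumes "l2_tendsto M \<phi> u" "l2_tendsto M \<psi> v"
  shows "l2_tendsto M (\<lambda>n x. a * \<phi> n x + b * \<psi> n x) (\<lambda>x. a * u x + b * v x)"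
proof -
  have s: "\<And>n. \<phi> n \<in> sq_int M" "\<And>n. \<psi> n \<in> sq_int M" "u \<in> sq_int M" "v \<in> sq_int M"
    using assms by (auto simp: l2_tendsto_def)
  define p q where "p n x = \<phi> n x - u x" and "q n x = \<psi> n x - v x" for n x
  have pq: "p n \<in> sq_int M" "q n \<in> sq_int M" for n
    unfolding p_def q_def using s by (auto intro: sq_int_diff)
  have pq2: "integrable M (\<lambda>x. (p n x)\<^sup>2)" "integrable M (\<lambda>x. (q n x)\<^sup>2)" for n using pq[of n] by (auto simp: sq_int_def)
  have lim: "(\<lambda>n. 2 * a\<^sup>2 * (LINT x|M. (p n x)\<^sup>2) + 2 * b\<^sup>2 * (LINT x|M. (q n x)\<^sup>2)) \<longlonglongrightarrow> 2 * a\<^sup>2 * 0 + 2 * b\<^sup>2 * 0"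
    using assms unfolding l2_tendsto_def p_def q_def by (intro tendsto_intros) auto
  have "(LINT x|M. (a * p n x + b * q n x)\<^sup>2) \<le> 2 * a\<^sup>2 * (LINT x|M. (p n x)\<^sup>2) + 2 * b\<^sup>2 * (LINT x|M. (q n x)\<^sup>2)" for n
  proof -
    have "(LINT x|M. (a * p n x + b * q n x)\<^sup>2) \<le> (LINT x|M. 2 * a\<^sup>2 * (p n x)\<^sup>2 + 2 * b\<^sup>2 * (q n x)\<^sup>2)"
    proof (rule integral_mono)
      show "integrable M (\<lambda>x. (a * p n x + b * q n x)\<^sup>2)" using sq_int_linear[OF pq(1)[of n] pq(2)[of n], of a b] by (simp add: sq_int_def)
      show "integrable M (\<lambda>x. 2 * a\<^sup>2 * (p n x)\<^sup>2 + 2 * b\<^sup>2 * (q n x)\<^sup>2)" using pq2 by simp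
      show "(a * p n x + b * q n x)\<^sup>2 \<le> 2 * a\<^sup>2 * (p n x)\<^sup>2 + 2 * b\<^sup>2 * (q n x)\<^sup>2" for x
        using zero_le_power2[of "a * p n x - b * q n x"] by (simp add: power2_eq_square algebra_simps)
    qed
    then show ?thesis using pq2 by simp
  qed
  then have bnd: "\<forall>\<^sub>F n in sequentially. norm (LINT x|M. (a * p n x + b * q n x)\<^sup>2) \<le> 2 * a\<^sup>2 * (LINT x|M. (p n x)\<^sup>2) + 2 * b\<^sup>2 * (LINT x|M. (q n x)\<^sup>2)"
    by (intro always_eventually allI) simp
  have eq: "a * p n x + b * q n x = a * \<phi> n x + b * \<psi> n x - (a * u x + b * v x)" for n x
    by (simp add: p_def q_def algebra_simps)
  have "(\<lambda>n. LINT x|M. (a * \<phi> n x + b * \<psi> n x - (a * u x + b * v x))\<^sup>2) \<longlonglongrightarrow> 0"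
    using Lim_null_comparison[OF bnd] lim unfolding eq by simp
  then show ?thesis unfolding l2_tendsto_def using s sq_int_linear by blast
qed

lemma l2_tendsto_integral:
  assumes "l2_tendsto M \<phi> u" "l2_tendsto M \<psi> v"
  shows "(\<lambda>n. LINT x|M. \<phi> n x * \<psi> n x) \<longlonglongrightarrow> (LINT x|M. u x * v x)"
proof -
  have s: "\<And>n. \<phi> n \<in> sq_int M" "\<And>n. \<psi> n \<in> sq_int M" "u \<in> sq_int M" "v \<in> sq_int M"
    and lim: "(\<lambda>n. LINT x|M. (\<phi> n x - u x)\<^sup>2) \<longlonglongrightarrow> 0" "(\<lambda>n. LINT x|M. (\<psi> n x - v x)\<^sup>2) \<longlonglongrightarrow> 0"
    using assms by (auto simp: l2_tendsto_def)
  have d: "(\<lambda>x. \<phi> n x - u x) \<in> sq_int M" "(\<lambda>x. \<psi> n x - v x) \<in> sq_int M" for n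
    using s by (auto intro: sq_int_diff)
  have null: "(\<lambda>n. LINT x|M. f n x * g n x) \<longlonglongrightarrow> 0"
    if f: "\<And>n. f n \<in> sq_int M" and g: "\<And>n. g n \<in> sq_int M"
      and l: "(\<lambda>n. (LINT x|M. (f n x)\<^sup>2) * (LINT x|M. (g n x)\<^sup>2)) \<longlonglongrightarrow> 0" for f g
  proof -
    have "(\<lambda>n. (LINT x|M. f n x * g n x)\<^sup>2) \<longlonglongrightarrow> 0"
    proof (rule Lim_null_comparison[OF _ l])
      show "\<forall>\<^sub>F n in sequentially. norm ((LINT x|M. f n x * g n x)\<^sup>2) \<le> (LINT x|M. (f n x)\<^sup>2) * (LINT x|M. (g n x)\<^sup>2)"
        using integral_cauchy_schwarz[OF f g] by (intro always_eventually allI) (simp only: real_norm_def abs_of_nonneg zero_le_power2)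
    qed
    then show ?thesis by simp
  qed
  have 1: "(\<lambda>n. LINT x|M. (\<phi> n x - u x) * (\<psi> n x - v x)) \<longlonglongrightarrow> 0"
    using tendsto_mult[OF lim] by (intro null d) simp
  have 2: "(\<lambda>n. LINT x|M. (\<phi> n x - u x) * v x) \<longlonglongrightarrow> 0"
    using tendsto_mult[OF lim(1) tendsto_const[of "\<integral>x. (v x)\<^sup>2 \<partial>M"]] by (intro null d s) simp
  have 3: "(\<lambda>n. LINT x|M. u x * (\<psi> n x - v x)) \<longlonglongrightarrow> 0"
    using tendsto_mult[OF tendsto_const[of "\<integral>x. (u x)\<^sup>2 \<partial>M"] lim(2)] by (intro null d s) simp
  have eq: "(LINT x|M. \<phi> n x * \<psi> n x) = (LINT x|M. (\<phi> n x - u x) * (\<psi> n x - v x)) + (LINT x|M. (\<phi> n x - u x) * v x)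
      + (LINT x|M. u x * (\<psi> n x - v x)) + (LINT x|M. u x * v x)" for n
  proof -
    have "(LINT x|M. \<phi> n x * \<psi> n x) = (LINT x|M. (\<phi> n x - u x) * (\<psi> n x - v x) + (\<phi> n x - u x) * v x
      + u x * (\<psi> n x - v x) + u x * v x)" by (simp add: algebra_simps)
    then show ?thesis
      using sq_int_mult[OF d(1)[of n] d(2)[of n]] sq_int_mult[OF d(1)[of n] s(4)] sq_int_mult[OF s(3) d(2)[of n]] sq_int_mult[OF s(3,4)] by simp
  qed
  show ?thesis
    unfolding eq using tendsto_add[OF tendsto_add[OF tendsto_add[OF 1 2] 3] tendsto_const[of "\<integral>x. u x * v x \<partial>M"]] by simp
qed

lemma fatou_integrable:
  fixes f :: "nat \<Rightarrow> 'a \<Rightarrow> real"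
  assumes int: "\<And>n. integrable M (f n)" and nn: "\<And>n x. 0 \<le> f n x"
    and lim: "\<And>x. (\<lambda>n. f n x) \<longlonglongrightarrow> g x" and c: "(\<lambda>n. LINT x|M. f n x) \<longlonglongrightarrow> c"
  shows "integrable M g" "(LINT x|M. g x) \<le> c"
proof -
  have [measurable]: "g \<in> borel_measurable M"
    by (rule borel_measurable_LIMSEQ_real[OF lim borel_measurable_integrable[OF int]])
  have g0: "0 \<le> g x" for x
    by (rule LIMSEQ_le_const[OF lim]) (simp add: nn)
  have c0: "0 \<le> c"
    by (rule LIMSEQ_le_const[OF c]) (simp add: nn)
  have "(\<integral>\<^sup>+x. ennreal (g x) \<partial>M) = (\<integral>\<^sup>+x. liminf (\<lambda>n. ennreal (f n x)) \<partial>M)"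
  proof (intro nn_integral_cong)
    fix x
    have "(\<lambda>n. ennreal (f n x)) \<longlonglongrightarrow> ennreal (g x)" by (rule tendsto_ennrealI[OF lim])
    then show "ennreal (g x) = liminf (\<lambda>n. ennreal (f n x))" by (simp add: lim_imp_Liminf)
  qed
  also have "\<dots> \<le> liminf (\<lambda>n. \<integral>\<^sup>+x. ennreal (f n x) \<partial>M)" 
    by (rule nn_integral_liminf) (rule measurable_compose[OF borel_measurable_integrable[OF int] measurable_ennreal])
  also have "(\<lambda>n. \<integral>\<^sup>+x. ennreal (f n x) \<partial>M) = (\<lambda>n. ennreal (LINT x|M. f n x))"
    by (rule ext, rule nn_integral_eq_integral[OF int]) (simp add: nn)
  also have "liminf \<dots> = ennreal c" by (rule lim_imp_Liminf[OF _ tendsto_ennrealI[OF c]]) simp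
  finally have le: "(\<integral>\<^sup>+x. ennreal (g x) \<partial>M) \<le> ennreal c" .
  then show int_g: "integrable M g"
    using le_less_trans[OF le ennreal_less_top] by (intro integrableI_nonneg) (auto simp: g0)
  show "(LINT x|M. g x) \<le> c"
    using le c0 g0 by (subst (asm) nn_integral_eq_integral[OF int_g]) auto
qed

text \<open>Independence is understood modulo null sets. The induction also records that each
  orthonormal function is a combination of the given ones: in the remainder \<open>y\<close> the
  function \<open>u n\<close> then has coefficient 1, so independence forbids that \<open>y\<close>
  vanishes almost everywhere, and \<open>y\<close> can be normalised.\<close>

lemma gram_schmidt_sq_int:
  fixes u :: "nat \<Rightarrow> 'a \<Rightarrow> real"
  assumes E: "E \<subseteq> sq_int M" and lin: "\<And>f g a b. f \<in> E \<Longrightarrow> g \<in> E \<Longrightarrow> (\<lambda>x. a * f x + b * g x) \<in> E"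
    and u: "\<And>i. i < m \<Longrightarrow> u i \<in> E"
    and indep: "\<And>c :: nat \<Rightarrow> real. (AE x in M. (\<Sum>i<m. c i * u i x) = 0) \<Longrightarrow> \<forall>i<m. c i = 0"
  shows "\<exists>w. (\<forall>i<m. w i \<in> E) \<and> (\<forall>i<m. \<forall>j<m. (LINT x|M. w i x * w j x) = (if i = j then 1 else 0))"
proof -
  have "\<exists>w. (\<forall>i<n. w i \<in> E \<and> (\<exists>c. \<forall>x. w i x = (\<Sum>j<n. c j * u j x))) \<and>
      (\<forall>i<n. \<forall>j<n. (LINT x|M. w i x * w j x) = (if i = j then 1 else 0))" if "n \<le> m" for n
    using that
  proof (induction n)
    case (Suc n)
    have "\<exists>w. (\<forall>i<n. w i \<in> E \<and> (\<exists>c. \<forall>x. w i x = (\<Sum>j<n. c j * u j x))) \<and>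
      (\<forall>i<n. \<forall>j<n. (LINT x|M. w i x * w j x) = (if i = j then 1 else 0))"
      using Suc.prems by (intro Suc.IH) simp
    then obtain w where w: "\<forall>i<n. w i \<in> E \<and> (\<exists>c. \<forall>x. w i x = (\<Sum>j<n. c j * u j x))"
      and on: "\<forall>i<n. \<forall>j<n. (LINT x|M. w i x * w j x) = (if i = j then 1 else 0)" by blast
    from w have wE: "i < n \<Longrightarrow> w i \<in> E" for i by blast
    from w have "\<forall>i. \<exists>c. i < n \<longrightarrow> (\<forall>x. w i x = (\<Sum>j<n. c j * u j x))" by blast
    from choice[OF this] obtain c where c: "\<And>i x. i < n \<Longrightarrow> w i x = (\<Sum>j<n. c i j * u j x)" by blast
    define b where "b i = (LINT x|M. u n x * w i x)" for i
    define y where "y x = u n x - (\<Sum>i<n. b i * w i x)" for x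
    have un: "u n \<in> E" using u Suc.prems by simp
    have "(\<lambda>x. u n x - (\<Sum>i<k. b i * w i x)) \<in> E" if "k \<le> n" for k
      using that
    proof (induction k)
      case (Suc k)
      then have "(\<lambda>x. 1 * (u n x - (\<Sum>i<k. b i * w i x)) + (- b k) * w k x) \<in> E" using wE by (intro lin) auto
      then show ?case by (simp add: algebra_simps)
    qed (use un in simp)
    then have yE: "y \<in> E" unfolding y_def by simp
    \<comment> \<open>The coefficients are continued by 0 beyond \<open>n\<close>, because
      \<open>indep\<close> speaks about all \<open>m\<close> functions at once.\<close>
    define d where "d j = (if j < n then - (\<Sum>i<n. b i * c i j) else if j = n then 1 else 0)" for j
    have y_eq: "y x = (\<Sum>j<Suc n. d j * u j x)" for x
    proof -
      have "(\<Sum>i<n. b i * w i x) = (\<Sum>i<n. \<Sum>j<n. b i * c i j * u j x)"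
        by (simp add: c sum_distrib_left mult.assoc)
      also have "\<dots> = (\<Sum>j<n. \<Sum>i<n. b i * c i j * u j x)" by (rule sum.swap)
      also have "\<dots> = (\<Sum>j<n. (\<Sum>i<n. b i * c i j) * u j x)" by (simp add: sum_distrib_right)
      finally show ?thesis by (simp add: y_def d_def sum_negf)
    qed
    have "(\<Sum>j<m. d j * u j x) = y x" for x
    proof -
      have "(\<Sum>j<m. d j * u j x) = (\<Sum>j<Suc n. d j * u j x)"
        using Suc.prems by (intro sum.mono_neutral_right) (auto simp: d_def)
      then show ?thesis by (simp add: y_eq)
    qed
    moreover have "d n \<noteq> 0" by (simp add: d_def)
    ultimately have nz: "\<not> (AE x in M. y x = 0)" using indep[of d] Suc.prems by auto
    have y2: "integrable M (\<lambda>x. (y x)\<^sup>2)" using yE E by (auto simp: sq_int_def)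
    have "(LINT x|M. (y x)\<^sup>2) \<noteq> 0"
      using nz integral_nonneg_eq_0_iff_AE[OF y2] by simp
    moreover have "(LINT x|M. (y x)\<^sup>2) \<ge> 0" by simp
    ultimately have N: "(LINT x|M. (y x)\<^sup>2) > 0" by linarith
    define s where "s = sqrt (LINT x|M. (y x)\<^sup>2)"
    have s: "s > 0" "s * s = (LINT x|M. y x * y x)" using N by (auto simp: s_def power2_eq_square)
    have int: "integrable M (\<lambda>x. f x * g x)" if "f \<in> E" "g \<in> E" for f g using that E by (auto intro: sq_int_mult)
    have orth: "(LINT x|M. y x * w j x) = 0" if j: "j < n" for j
    proof -
      have "(LINT x|M. y x * w j x) = (LINT x|M. u n x * w j x - (\<Sum>i<n. b i * (w i x * w j x)))"
        by (simp add: y_def left_diff_distrib sum_distrib_right mult.assoc)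
      also have "\<dots> = b j - (\<Sum>i<n. b i * (LINT x|M. w i x * w j x))"
        using int un wE j by (subst Bochner_Integration.integral_diff) (auto simp: b_def)
      also have "(\<Sum>i<n. b i * (LINT x|M. w i x * w j x)) = (\<Sum>i<n. if i = j then b i else 0)"
        using j by (intro sum.cong) (auto simp: on)
      also have "\<dots> = b j" using j by simp
      finally show ?thesis by simp
    qed
    define w' where "w' i = (if i < n then w i else (\<lambda>x. y x / s))" for i
    have "(\<lambda>x. (1/s) * y x + 0 * y x) \<in> E" by (intro lin yE)
    then have ysE: "(\<lambda>x. y x / s) \<in> E" by simp
    show ?case
    proof (intro exI[of _ w'] conjI allI impI)
      fix i assume "i < Suc n"
      then show "w' i \<in> E" using wE ysE by (auto simp: w'_def)
      show "\<exists>c. \<forall>x. w' i x = (\<Sum>j<Suc n. c j * u j x)"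
      proof (cases "i < n")
        case True
        then show ?thesis by (intro exI[of _ "\<lambda>j. if j < n then c i j else 0"]) (simp add: w'_def c)
      next
        case False
        then show ?thesis by (intro exI[of _ "\<lambda>j. d j / s"]) (simp add: w'_def y_eq sum_divide_distrib add_divide_distrib)
      qed
      fix j assume j: "j < Suc n"
      show "(LINT x|M. w' i x * w' j x) = (if i = j then 1 else 0)"
      proof -
        have orth': "(LINT x|M. w k x * y x) = 0" if "k < n" for k
          using orth[OF that] by (simp add: mult.commute)
        have ss: "(LINT x|M. y x * y x) / (s * s) = 1" using s(1) unfolding s(2)[symmetric] by simp
        consider "i < n" "j < n" | "i < n" "j = n" | "i = n" "j < n" | "i = n" "j = n"
          using \<open>i < Suc n\<close> j by linarith
        then show ?thesis
          by cases (simp_all add: w'_def on orth orth' ss)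
      qed
    qed
  qed simp
  then show ?thesis by blast
qed

subsection \<open>Eigenfunctions and their Fourier transforms\<close>

text \<open>An eigenfunction is stored together with the data that the estimates use: approximating
  test functions, one limit \<open>V is\<close> for each derivative of order \<open>l\<close>, and
  the weak equation. With the limits given as explicit functions, linear combinations can be formed
  term by term, with no recourse to weak derivatives.\<close>

definition l2_eigen_approx :: "nat \<Rightarrow> (real^'n) set \<Rightarrow> real \<Rightarrow> (real^'n \<Rightarrow> real) \<Rightarrow>
    (nat \<Rightarrow> real^'n \<Rightarrow> real) \<Rightarrow> ('n list \<Rightarrow> real^'n \<Rightarrow> real) \<Rightarrow> bool" where
  "l2_eigen_approx l \<Omega> \<mu> u \<phi> V \<longleftrightarrow>
    (\<forall>n. \<phi> n \<in> test_funs \<Omega>) \<and> l2_tendsto (lebesgue_on \<Omega>) \<phi> u \<and>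
    (\<forall>is. length is = l \<longrightarrow> l2_tendsto (lebesgue_on \<Omega>) (\<lambda>n. iter_pderiv is (\<phi> n)) (V is)) \<and>
    (\<forall>\<psi>\<in>test_funs \<Omega>. (LINT x|lebesgue_on \<Omega>. u x * (neg_laplacian ^^ l) \<psi> x) = \<mu> * (LINT x|lebesgue_on \<Omega>. u x * \<psi> x))"

lemma borel_measurable_lebesgue_on:
  assumes "f \<in> borel_measurable borel"
  shows "f \<in> borel_measurable (lebesgue_on \<Omega>)"
  using assms by (intro measurable_restrict_space1 measurable_completion) simp

text \<open>The bridge between \<open>lebesgue_on \<Omega>\<close>, where the Sobolev spaces live,
  and \<open>lborel\<close>, where the Fourier analysis is carried out.\<close>

lemma integral_lebesgue_on_vanish:
  fixes h :: "'a::euclidean_space \<Rightarrow> real"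
  assumes \<Omega>: "\<Omega> \<in> sets lebesgue" and h: "h \<in> borel_measurable borel" and z: "\<And>x. x \<notin> \<Omega> \<Longrightarrow> h x = 0"
  shows "integrable (lebesgue_on \<Omega>) h \<longleftrightarrow> integrable lborel h"
    and "integral\<^sup>L (lebesgue_on \<Omega>) h = integral\<^sup>L lborel h"
proof -
  have eq: "(\<lambda>x. indicator \<Omega> x * h x) = h" using z by (auto simp: indicator_def fun_eq_iff)
  have "integrable (lebesgue_on \<Omega>) h \<longleftrightarrow> integrable lebesgue h"
    using \<Omega> by (subst integrable_restrict_space) (auto simp: eq)
  then show "integrable (lebesgue_on \<Omega>) h \<longleftrightarrow> integrable lborel h"
    using h by (simp add: integrable_completion)
  have "integral\<^sup>L (lebesgue_on \<Omega>) h = integral\<^sup>L lebesgue h"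
    using \<Omega> by (subst integral_restrict_space) (auto simp: eq)
  then show "integral\<^sup>L (lebesgue_on \<Omega>) h = integral\<^sup>L lborel h"
    using h by (simp add: integral_completion)
qed

lemma test_funs_vanish: "\<phi> \<in> test_funs \<Omega> \<Longrightarrow> x \<notin> \<Omega> \<Longrightarrow> \<phi> x = 0"
  using closure_subset[of "{x. \<phi> x \<noteq> 0}"] unfolding test_funs_def by auto

locale bounded_domain =
  fixes \<Omega> :: "(real^'n) set"
  assumes open_dom: "open \<Omega>" and bounded_dom: "bounded \<Omega>"
begin

abbreviation "M \<equiv> lebesgue_on \<Omega>"

lemma dom_lmeasurable: "\<Omega> \<in> lmeasurable"
  using open_dom bounded_dom by (rule lmeasurable_open[rotated])

sublocale fin: finite_measure "lebesgue_on \<Omega>"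
  using dom_lmeasurable by (rule finite_measure_lebesgue_on)

lemma bounded_sq_int:
  assumes "f \<in> borel_measurable borel" "\<And>x. x \<in> \<Omega> \<Longrightarrow> \<bar>f x\<bar> \<le> B"
  shows "f \<in> sq_int M"
proof -
  have m: "f \<in> borel_measurable M" by (rule borel_measurable_lebesgue_on[OF assms(1)])
  have le: "norm ((f x)\<^sup>2) \<le> B\<^sup>2" if "x \<in> space M" for x
    using power_mono[OF assms(2), of x 2] that by simp
  have "integrable M (\<lambda>x. (f x)\<^sup>2)"
    by (rule fin.integrable_const_bound[OF AE_I2[OF le]]) (use m in simp_all)
  then show ?thesis using m by (simp add: sq_int_def)
qed

lemma cos_sq_int: "(\<lambda>x. cos (\<xi> \<bullet> x)) \<in> sq_int M"
  and sin_sq_int: "(\<lambda>x. sin (\<xi> \<bullet> x)) \<in> sq_int M"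
  by (rule bounded_sq_int[where B = 1]; simp)+

lemma test_integral:
  assumes \<phi>: "\<phi> \<in> test_funs \<Omega>" and h: "h \<in> borel_measurable borel"
  shows "(LINT x|M. \<phi> x * h x) = (LBINT x. \<phi> x * h x)"
  using dom_lmeasurable cont_csupp_measurable[OF test_funs_cont_csupp[OF \<phi>]] h test_funs_vanish[OF \<phi>]
  by (intro integral_lebesgue_on_vanish) auto

lemma test_sq_int:
  assumes \<phi>: "\<phi> \<in> test_funs \<Omega>"
  shows "\<phi> \<in> sq_int M"
proof -
  obtain C where "\<And>x. \<bar>\<phi> x\<bar> \<le> C" using cont_csupp_bounded[OF test_funs_cont_csupp[OF \<phi>]] by blast
  then show ?thesis
    by (rule bounded_sq_int[OF cont_csupp_measurable[OF test_funs_cont_csupp[OF \<phi>]]])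
qed

lemma test_tr:
  assumes \<phi>: "\<phi> \<in> test_funs \<Omega>"
  shows "cos_tr M \<phi> = cos_tr lborel \<phi>" "sin_tr M \<phi> = sin_tr lborel \<phi>"
  unfolding cos_tr_def sin_tr_def by (rule ext, rule test_integral[OF \<phi>], simp)+

lemma test_fourier_prod:
  assumes "\<phi> \<in> test_funs \<Omega>" "\<psi> \<in> test_funs \<Omega>"
  shows "fourier_prod M \<phi> \<psi> = fourier_prod lborel \<phi> \<psi>"
  using assms by (simp add: fourier_prod_def[abs_def] test_tr)

lemma test_integral2:
  assumes "\<phi> \<in> test_funs \<Omega>" "\<psi> \<in> test_funs \<Omega>"
  shows "(LINT x|M. \<phi> x * \<psi> x) = (LBINT x. \<phi> x * \<psi> x)"
  using assms by (intro test_integral cont_csupp_measurable test_funs_cont_csupp)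

lemma tr_tendsto:
  assumes "l2_tendsto M \<phi> u"
  shows "(\<lambda>n. cos_tr M (\<phi> n) \<xi>) \<longlonglongrightarrow> cos_tr M u \<xi>"
    and "(\<lambda>n. sin_tr M (\<phi> n) \<xi>) \<longlonglongrightarrow> sin_tr M u \<xi>"
  unfolding cos_tr_def sin_tr_def
  by (intro l2_tendsto_integral assms l2_tendsto_const cos_sq_int sin_sq_int)+

lemma fourier_prod_tendsto:
  assumes "l2_tendsto M \<phi> u"
  shows "(\<lambda>n. fourier_prod M (\<phi> n) (\<phi> n) \<xi>) \<longlonglongrightarrow> fourier_prod M u u \<xi>"
  unfolding fourier_prod_def by (intro tendsto_intros tr_tendsto assms)

lemma tr_linear:
  assumes "u \<in> sq_int M" "v \<in> sq_int M"
  shows "cos_tr M (\<lambda>x. a * u x + b * v x) \<xi> = a * cos_tr M u \<xi> + b * cos_tr M v \<xi>"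
    and "sin_tr M (\<lambda>x. a * u x + b * v x) \<xi> = a * sin_tr M u \<xi> + b * sin_tr M v \<xi>"
  using sq_int_mult[OF assms(1) cos_sq_int[of \<xi>]] sq_int_mult[OF assms(2) cos_sq_int[of \<xi>]]
    sq_int_mult[OF assms(1) sin_sq_int[of \<xi>]] sq_int_mult[OF assms(2) sin_sq_int[of \<xi>]]
  by (simp_all add: cos_tr_def sin_tr_def distrib_right mult.assoc)

text \<open>One weak derivative is chosen for every word. The empty word, for which \<open>u\<close>
  is its own weak derivative, supplies the convergence of the approximants themselves.\<close>

lemma l2_eigen_approx_eigenspace:
  assumes u: "u \<in> dirichlet_eigenspace l \<Omega> \<mu>"
  shows "\<exists>\<phi> V. l2_eigen_approx l \<Omega> \<mu> u \<phi> V"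
proof -
  have s: "u \<in> sobolev l \<Omega>" and L: "u \<in> L2 \<Omega>" using u by (auto simp: dirichlet_eigenspace_def sobolev0_def sobolev_def)
  obtain \<phi> where \<phi>: "\<And>n. \<phi> n \<in> test_funs \<Omega>"
    and lim: "\<And>is v. v \<in> L2 \<Omega> \<Longrightarrow> length is \<le> l \<Longrightarrow> weak_pderiv \<Omega> is u v \<Longrightarrow>
        (\<lambda>n. LINT x|M. (iter_pderiv is (\<phi> n) x - v x)\<^sup>2) \<longlonglongrightarrow> 0"
    using u unfolding dirichlet_eigenspace_def sobolev0_def by blast
  have "\<forall>is. \<exists>v. length is \<le> l \<longrightarrow> v \<in> L2 \<Omega> \<and> weak_pderiv \<Omega> is u v"
    using s unfolding sobolev_def by blast
  from choice[OF this] obtain V where V: "\<And>is. length is \<le> l \<Longrightarrow> V is \<in> L2 \<Omega> \<and> weak_pderiv \<Omega> is u (V is)" by blast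
  have "weak_pderiv \<Omega> [] u u" by (simp add: weak_pderiv_def)
  from lim[OF L _ this] have 1: "l2_tendsto M \<phi> u"
    using \<phi> L by (auto simp: l2_tendsto_def test_sq_int L2_eq_sq_int)
  have 2: "l2_tendsto M (\<lambda>n. iter_pderiv is (\<phi> n)) (V is)" if "length is = l" for "is"
    using V[of "is"] that lim[of "V is" "is"] \<phi>
    by (auto simp: l2_tendsto_def L2_eq_sq_int intro: test_sq_int test_funs_iter_pderiv)
  show ?thesis
    using \<phi> 1 2 u unfolding l2_eigen_approx_def dirichlet_eigenspace_def by blast
qed

lemma l2_eigen_approx_linear:
  assumes "l2_eigen_approx l \<Omega> \<mu> u \<phi> V" "l2_eigen_approx l \<Omega> \<mu> w \<psi> W"
  shows "l2_eigen_approx l \<Omega> \<mu> (\<lambda>x. a * u x + b * w x) (\<lambda>n x. a * \<phi> n x + b * \<psi> n x) (\<lambda>is x. a * V is x + b * W is x)"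
proof -
  have t: "\<And>n. \<phi> n \<in> test_funs \<Omega>" "\<And>n. \<psi> n \<in> test_funs \<Omega>"
    and l: "l2_tendsto M \<phi> u" "l2_tendsto M \<psi> w"
    and lV: "\<And>is. length is = l \<Longrightarrow> l2_tendsto M (\<lambda>n. iter_pderiv is (\<phi> n)) (V is)"
    and lW: "\<And>is. length is = l \<Longrightarrow> l2_tendsto M (\<lambda>n. iter_pderiv is (\<psi> n)) (W is)"
    and e: "\<And>\<theta>. \<theta> \<in> test_funs \<Omega> \<Longrightarrow> (LINT x|M. u x * (neg_laplacian ^^ l) \<theta> x) = \<mu> * (LINT x|M. u x * \<theta> x)"
      "\<And>\<theta>. \<theta> \<in> test_funs \<Omega> \<Longrightarrow> (LINT x|M. w x * (neg_laplacian ^^ l) \<theta> x) = \<mu> * (LINT x|M. w x * \<theta> x)"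
    using assms unfolding l2_eigen_approx_def by auto
  have s: "u \<in> sq_int M" "w \<in> sq_int M" using l by (auto simp: l2_tendsto_def)
  have int: "(LINT x|M. (a * u x + b * w x) * g x) = a * (LINT x|M. u x * g x) + b * (LINT x|M. w x * g x)"
    if "g \<in> test_funs \<Omega>" for g
    using sq_int_mult[OF s(1) test_sq_int[OF that]] sq_int_mult[OF s(2) test_sq_int[OF that]]
    by (simp add: distrib_right mult.assoc)
  show ?thesis
    unfolding l2_eigen_approx_def
  proof (intro conjI allI impI ballI)
    show "(\<lambda>x. a * \<phi> n x + b * \<psi> n x) \<in> test_funs \<Omega>" for n by (intro test_funs_linear t)
    show "l2_tendsto M (\<lambda>n x. a * \<phi> n x + b * \<psi> n x) (\<lambda>x. a * u x + b * w x)"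
      by (intro l2_tendsto_linear l)
    show "l2_tendsto M (\<lambda>n. iter_pderiv is (\<lambda>x. a * \<phi> n x + b * \<psi> n x)) (\<lambda>x. a * V is x + b * W is x)"
      if "length is = l" for "is"
      unfolding iter_pderiv_linear[OF test_funs_smooth[OF t(1)] test_funs_smooth[OF t(2)]]
      using that by (intro l2_tendsto_linear lV lW)
    show "(LINT x|M. (a * u x + b * w x) * (neg_laplacian ^^ l) \<theta> x) = \<mu> * (LINT x|M. (a * u x + b * w x) * \<theta> x)"
      if "\<theta> \<in> test_funs \<Omega>" for \<theta>
      unfolding int[OF that] int[OF test_funs_neg_laplacian_pow[OF that]] e(1)[OF that] e(2)[OF that]
      by (simp add: algebra_simps)
  qed
qed

text \<open>The weak equation for \<open>u\<close> is tested with \<open>\<psi> n\<close>. With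
  \<open>\<phi> m\<close> in place of \<open>u\<close>, \<open>integral_neg_laplacian_pow\<close>
  spreads the derivatives over both factors; then \<open>m\<close> and after it \<open>n\<close>
  tends to infinity. For \<open>w = u\<close> this is the energy identity; for two different
  eigenvalues the symmetry of the left side gives orthogonality.\<close>

lemma l2_eigen_approx_energy:
  assumes u: "l2_eigen_approx l \<Omega> \<mu> u \<phi> V" and w: "l2_eigen_approx l \<Omega> \<nu> w \<psi> W"
  shows "(\<Sum>is | length is = l. LINT x|M. V is x * W is x) = \<mu> * (LINT x|M. u x * w x)"
proof -
  have t: "\<And>n. \<phi> n \<in> test_funs \<Omega>" "\<And>n. \<psi> n \<in> test_funs \<Omega>"
    and l: "l2_tendsto M \<phi> u" "l2_tendsto M \<psi> w"
    and lV: "\<And>is. length is = l \<Longrightarrow> l2_tendsto M (\<lambda>n. iter_pderiv is (\<phi> n)) (V is)"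
    and lW: "\<And>is. length is = l \<Longrightarrow> l2_tendsto M (\<lambda>n. iter_pderiv is (\<psi> n)) (W is)"
    and e: "\<And>\<theta>. \<theta> \<in> test_funs \<Omega> \<Longrightarrow> (LINT x|M. u x * (neg_laplacian ^^ l) \<theta> x) = \<mu> * (LINT x|M. u x * \<theta> x)"
    using u w unfolding l2_eigen_approx_def by auto
  have us: "u \<in> sq_int M" using l by (auto simp: l2_tendsto_def)
  have Vs: "V is \<in> sq_int M" if "length is = l" for "is" using lV[OF that] by (auto simp: l2_tendsto_def)
  have eq: "(\<Sum>is | length is = l. LINT x|M. V is x * iter_pderiv is (\<psi> n) x) = \<mu> * (LINT x|M. u x * \<psi> n x)" for n
  proof -
    have eqm: "(LINT x|M. \<phi> m x * (neg_laplacian ^^ l) (\<psi> n) x)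
       = (\<Sum>is | length is = l. LINT x|M. iter_pderiv is (\<phi> m) x * iter_pderiv is (\<psi> n) x)" for m
      using integral_neg_laplacian_pow[OF t(1)[of m] t(2)[of n], of l] t
      by (simp add: test_integral2 test_funs_neg_laplacian_pow test_funs_iter_pderiv)
    have "(\<lambda>m. LINT x|M. \<phi> m x * (neg_laplacian ^^ l) (\<psi> n) x) \<longlonglongrightarrow> (LINT x|M. u x * (neg_laplacian ^^ l) (\<psi> n) x)"
      by (intro l2_tendsto_integral l l2_tendsto_const test_sq_int test_funs_neg_laplacian_pow t)
    moreover have "(\<lambda>m. \<Sum>is | length is = l. LINT x|M. iter_pderiv is (\<phi> m) x * iter_pderiv is (\<psi> n) x)
        \<longlonglongrightarrow> (\<Sum>is | length is = l. LINT x|M. V is x * iter_pderiv is (\<psi> n) x)"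
      by (intro tendsto_sum l2_tendsto_integral l2_tendsto_const test_sq_int test_funs_iter_pderiv t lV) simp
    ultimately have "(LINT x|M. u x * (neg_laplacian ^^ l) (\<psi> n) x) = (\<Sum>is | length is = l. LINT x|M. V is x * iter_pderiv is (\<psi> n) x)"
      unfolding eqm by (rule LIMSEQ_unique)
    then show ?thesis using e[OF t(2)] by simp
  qed
  have "(\<lambda>n. \<Sum>is | length is = l. LINT x|M. V is x * iter_pderiv is (\<psi> n) x)
      \<longlonglongrightarrow> (\<Sum>is | length is = l. LINT x|M. V is x * W is x)"
    by (intro tendsto_sum l2_tendsto_integral l2_tendsto_const Vs lW) simp_all
  moreover have "(\<lambda>n. \<mu> * (LINT x|M. u x * \<psi> n x)) \<longlonglongrightarrow> \<mu> * (LINT x|M. u x * w x)"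
    by (intro tendsto_mult_left l2_tendsto_integral l2_tendsto_const us l)
  ultimately show ?thesis unfolding eq by (rule LIMSEQ_unique)
qed

lemma l2_eigen_approx_orthogonal:
  assumes u: "l2_eigen_approx l \<Omega> \<mu> u \<phi> V" and w: "l2_eigen_approx l \<Omega> \<nu> w \<psi> W" and "\<mu> \<noteq> \<nu>"
  shows "(LINT x|M. u x * w x) = 0"
proof -
  have "\<mu> * (LINT x|M. u x * w x) = \<nu> * (LINT x|M. u x * w x)"
    using l2_eigen_approx_energy[OF u w] l2_eigen_approx_energy[OF w u] by (simp add: mult.commute)
  then show ?thesis using \<open>\<mu> \<noteq> \<nu>\<close> by simp
qed

text \<open>For the approximants the weighted integral is their energy, by Plancherel. Mean-square
  convergence on a domain of finite measure makes the transforms converge at every frequency, so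
  Fatou applies, and the limit of the energies is the eigenvalue times the squared norm.\<close>

lemma fourier_moment_eigen:
  assumes u: "l2_eigen_approx l \<Omega> \<mu> u \<phi> V"
  shows "integrable lborel (\<lambda>\<xi>. norm \<xi> ^ (2 * l) * fourier_prod M u u \<xi>)"
    and "(LBINT \<xi>. norm \<xi> ^ (2 * l) * fourier_prod M u u \<xi>) \<le> (2 * pi) ^ CARD('n) * (\<mu> * (LINT x|M. (u x)\<^sup>2))"
proof -
  have t: "\<And>n. \<phi> n \<in> test_funs \<Omega>" and l: "l2_tendsto M \<phi> u"
    and lV: "\<And>is. length is = l \<Longrightarrow> l2_tendsto M (\<lambda>n. iter_pderiv is (\<phi> n)) (V is)"
    using u unfolding l2_eigen_approx_def by auto
  define f where "f n \<xi> = norm \<xi> ^ (2 * l) * fourier_prod M (\<phi> n) (\<phi> n) \<xi>" for n \<xi>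
  have f: "has_bochner_integral lborel (f n)
      ((2 * pi) ^ CARD('n) * (\<Sum>is | length is = l. LINT x|M. iter_pderiv is (\<phi> n) x * iter_pderiv is (\<phi> n) x))" for n
    using fourier_moment_test_fun[OF t[of n], of l] t
    by (simp add: f_def[abs_def] test_fourier_prod test_integral2 test_funs_iter_pderiv power2_eq_square)
  have lim: "(\<lambda>n. LBINT \<xi>. f n \<xi>) \<longlonglongrightarrow> (2 * pi) ^ CARD('n) * (\<Sum>is | length is = l. LINT x|M. V is x * V is x)"
    unfolding has_bochner_integral_integral_eq[OF f]
    by (intro tendsto_mult_left tendsto_sum l2_tendsto_integral lV) simp_all
  have nn: "0 \<le> f n \<xi>" for n \<xi> by (simp add: f_def fourier_prod_def)
  have ptw: "(\<lambda>n. f n \<xi>) \<longlonglongrightarrow> norm \<xi> ^ (2 * l) * fourier_prod M u u \<xi>" for \<xi>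
    unfolding f_def by (intro tendsto_mult_left fourier_prod_tendsto l)
  note F = fatou_integrable[OF integrable.intros[OF f] nn ptw lim]
  show "integrable lborel (\<lambda>\<xi>. norm \<xi> ^ (2 * l) * fourier_prod M u u \<xi>)" by (rule F(1))
  show "(LBINT \<xi>. norm \<xi> ^ (2 * l) * fourier_prod M u u \<xi>) \<le> (2 * pi) ^ CARD('n) * (\<mu> * (LINT x|M. (u x)\<^sup>2))"
    using F(2) unfolding l2_eigen_approx_energy[OF u u] by (simp add: power2_eq_square)
qed

text \<open>Fatou alone would give only an upper bound, whereas the bathtub argument needs the mass
  from below. Applied to \<open>\<phi> n - \<phi> m\<close> with \<open>m\<close> tending to
  infinity, Fatou bounds the transform of \<open>\<phi> n - u\<close> by the distance from
  \<open>\<phi> n\<close> to \<open>u\<close>. Hence the transforms converge in mean square, and so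
  do their squared norms.\<close>

lemma plancherel_l2_limit:
  assumes t: "\<And>n. \<phi> n \<in> test_funs \<Omega>" and l: "l2_tendsto M \<phi> u"
  shows "has_bochner_integral lborel (fourier_prod M u u) ((2 * pi) ^ CARD('n) * (LINT x|M. (u x)\<^sup>2))"
proof -
  define c where "c = (2 * pi) ^ CARD('n)"
  have us: "u \<in> sq_int M" using l by (auto simp: l2_tendsto_def)
  have \<phi>s: "\<phi> n \<in> sq_int M" for n by (rule test_sq_int[OF t])
  have pl: "has_bochner_integral lborel (fourier_prod M \<psi> \<psi>) (c * (LINT x|M. (\<psi> x)\<^sup>2))" if "\<psi> \<in> test_funs \<Omega>" for \<psi>
    using plancherel_square[OF test_funs_cont_csupp[OF that]] that
    by (simp add: c_def test_fourier_prod power2_eq_square test_integral2)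
  have diff: "integrable lborel (fourier_prod M (\<lambda>x. \<phi> n x - u x) (\<lambda>x. \<phi> n x - u x))"
     "(LBINT \<xi>. fourier_prod M (\<lambda>x. \<phi> n x - u x) (\<lambda>x. \<phi> n x - u x) \<xi>) \<le> c * (LINT x|M. (\<phi> n x - u x)\<^sup>2)" for n
  proof -
    have tm: "(\<lambda>x. \<phi> n x - \<phi> m x) \<in> test_funs \<Omega>" for m
      using test_funs_linear[OF t t, of 1 n "-1" m] by simp
    have lm: "l2_tendsto M (\<lambda>m x. \<phi> n x - \<phi> m x) (\<lambda>x. \<phi> n x - u x)"
      using l2_tendsto_linear[OF l2_tendsto_const[OF \<phi>s[of n]] l, of 1 "-1"] by simp
    have "(\<lambda>m. LBINT \<xi>. fourier_prod M (\<lambda>x. \<phi> n x - \<phi> m x) (\<lambda>x. \<phi> n x - \<phi> m x) \<xi>) \<longlonglongrightarrow> c * (LINT x|M. (\<phi> n x - u x)\<^sup>2)"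
      unfolding has_bochner_integral_integral_eq[OF pl[OF tm]] power2_eq_square
      by (intro tendsto_mult_left l2_tendsto_integral lm)
    note F = fatou_integrable[OF integrable.intros[OF pl[OF tm]] _ fourier_prod_tendsto[OF lm] this]
    show "integrable lborel (fourier_prod M (\<lambda>x. \<phi> n x - u x) (\<lambda>x. \<phi> n x - u x))"
     "(LBINT \<xi>. fourier_prod M (\<lambda>x. \<phi> n x - u x) (\<lambda>x. \<phi> n x - u x) \<xi>) \<le> c * (LINT x|M. (\<phi> n x - u x)\<^sup>2)"
      by (rule F, simp add: fourier_prod_def)+
  qed
  have meas: "cos_tr M (\<phi> n) \<in> borel_measurable lborel" "sin_tr M (\<phi> n) \<in> borel_measurable lborel" for n
    unfolding test_tr[OF t] using cos_sin_tr_measurable[OF cont_csupp_measurable[OF test_funs_cont_csupp[OF t]]] by simp_all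
  have measu: "cos_tr M u \<in> borel_measurable lborel" "sin_tr M u \<in> borel_measurable lborel"
    by (rule borel_measurable_LIMSEQ_real[OF tr_tendsto(1)[OF l] meas(1)], rule borel_measurable_LIMSEQ_real[OF tr_tendsto(2)[OF l] meas(2)])
  have P_diff: "fourier_prod M (\<lambda>x. \<phi> n x - u x) (\<lambda>x. \<phi> n x - u x) \<xi>
     = (cos_tr M (\<phi> n) \<xi> - cos_tr M u \<xi>)\<^sup>2 + (sin_tr M (\<phi> n) \<xi> - sin_tr M u \<xi>)\<^sup>2" for n \<xi>
    using tr_linear[OF \<phi>s[of n] us, of 1 "-1" \<xi>] by (simp add: fourier_prod_def power2_eq_square)
  have sq_le: "f \<in> sq_int lborel" "(LBINT \<xi>. (f \<xi>)\<^sup>2) \<le> (LBINT \<xi>. g \<xi>)"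
    if "f \<in> borel_measurable lborel" "integrable lborel g" "\<And>\<xi>. (f \<xi>)\<^sup>2 \<le> g \<xi>" for f g :: "real^'n \<Rightarrow> real"
  proof -
    have "norm ((f \<xi>)\<^sup>2) \<le> norm (g \<xi>)" for \<xi> using that(3)[of \<xi>] zero_le_power2[of "f \<xi>"] by (simp del: zero_le_power2)
    then have i: "integrable lborel (\<lambda>\<xi>. (f \<xi>)\<^sup>2)"
      using that(1) by (intro Bochner_Integration.integrable_bound[OF that(2)] AE_I2) auto
    then show "f \<in> sq_int lborel" using that(1) by (simp add: sq_int_def)
    show "(LBINT \<xi>. (f \<xi>)\<^sup>2) \<le> (LBINT \<xi>. g \<xi>)" by (intro integral_mono i that)
  qed
  \<comment> \<open>This is instantiated with the cosine and with the sine transforms, whose squares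
    are each at most \<open>fourier_prod\<close>.\<close>
  have conv: "l2_tendsto lborel T Tu"
    if T: "\<And>n. T n \<in> borel_measurable lborel" and Tu: "Tu \<in> borel_measurable lborel"
      and le: "\<And>n \<xi>. (T n \<xi>)\<^sup>2 \<le> fourier_prod M (\<phi> n) (\<phi> n) \<xi>"
      and led: "\<And>n \<xi>. (T n \<xi> - Tu \<xi>)\<^sup>2 \<le> fourier_prod M (\<lambda>x. \<phi> n x - u x) (\<lambda>x. \<phi> n x - u x) \<xi>"
    for T :: "nat \<Rightarrow> real^'n \<Rightarrow> real" and Tu
  proof -
    have sT: "T n \<in> sq_int lborel" for n
      by (rule sq_le(1)[OF T integrable.intros[OF pl[OF t[of n]]] le])
    have sd: "(\<lambda>\<xi>. T n \<xi> - Tu \<xi>) \<in> sq_int lborel" for n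
      by (rule sq_le(1)[OF _ diff(1)[of n] led]) (intro borel_measurable_diff T Tu)
    have sTu: "Tu \<in> sq_int lborel" using sq_int_diff[OF sT[of 0] sd[of 0]] by simp
    have bd: "(LBINT \<xi>. (T n \<xi> - Tu \<xi>)\<^sup>2) \<le> c * (LINT x|M. (\<phi> n x - u x)\<^sup>2)" for n
      by (rule order_trans[OF sq_le(2)[OF _ diff(1)[of n] led] diff(2)]) (intro borel_measurable_diff T Tu)
    have "(\<lambda>n. LINT x|M. (\<phi> n x - u x)\<^sup>2) \<longlonglongrightarrow> 0" using l by (simp add: l2_tendsto_def)
    from tendsto_mult_left[OF this, of c]
    have lim0: "(\<lambda>n. c * (LINT x|M. (\<phi> n x - u x)\<^sup>2)) \<longlonglongrightarrow> 0" by simp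
    have "(\<lambda>n. LBINT \<xi>. (T n \<xi> - Tu \<xi>)\<^sup>2) \<longlonglongrightarrow> 0"
      by (rule Lim_null_comparison[OF always_eventually lim0]) (simp add: bd)
    then show ?thesis using sT sTu by (simp add: l2_tendsto_def)
  qed
  have C: "l2_tendsto lborel (\<lambda>n. cos_tr M (\<phi> n)) (cos_tr M u)"
    by (rule conv[OF meas(1) measu(1)]) (simp_all add: P_diff, simp add: fourier_prod_def power2_eq_square)
  have S: "l2_tendsto lborel (\<lambda>n. sin_tr M (\<phi> n)) (sin_tr M u)"
    by (rule conv[OF meas(2) measu(2)]) (simp_all add: P_diff, simp add: fourier_prod_def power2_eq_square)
  have sq: "cos_tr M u \<in> sq_int lborel" "sin_tr M u \<in> sq_int lborel"
    "cos_tr M (\<phi> n) \<in> sq_int lborel" "sin_tr M (\<phi> n) \<in> sq_int lborel" for n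
    using C S by (auto simp: l2_tendsto_def)
  have lim1: "(\<lambda>n. (LBINT \<xi>. cos_tr M (\<phi> n) \<xi> * cos_tr M (\<phi> n) \<xi>) + (LBINT \<xi>. sin_tr M (\<phi> n) \<xi> * sin_tr M (\<phi> n) \<xi>))
    \<longlonglongrightarrow> (LBINT \<xi>. cos_tr M u \<xi> * cos_tr M u \<xi>) + (LBINT \<xi>. sin_tr M u \<xi> * sin_tr M u \<xi>)"
    by (intro tendsto_add l2_tendsto_integral C S)
  have eqn: "(LBINT \<xi>. cos_tr M (\<phi> n) \<xi> * cos_tr M (\<phi> n) \<xi>) + (LBINT \<xi>. sin_tr M (\<phi> n) \<xi> * sin_tr M (\<phi> n) \<xi>)
     = c * (LINT x|M. \<phi> n x * \<phi> n x)" for n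
    using has_bochner_integral_integral_eq[OF pl[OF t[of n]]] sq_int_mult[OF sq(3) sq(3), of n n] sq_int_mult[OF sq(4) sq(4), of n n]
    by (simp add: fourier_prod_def[abs_def] power2_eq_square)
  have lim2: "(\<lambda>n. c * (LINT x|M. \<phi> n x * \<phi> n x)) \<longlonglongrightarrow> c * (LINT x|M. u x * u x)"
    by (intro tendsto_mult_left l2_tendsto_integral l)
  have "(LBINT \<xi>. cos_tr M u \<xi> * cos_tr M u \<xi>) + (LBINT \<xi>. sin_tr M u \<xi> * sin_tr M u \<xi>) = c * (LINT x|M. u x * u x)"
    by (rule LIMSEQ_unique[OF lim1[unfolded eqn] lim2])
  then show ?thesis
    using sq_int_mult[OF sq(1) sq(1)] sq_int_mult[OF sq(2) sq(2)]
    by (simp add: has_bochner_integral_iff fourier_prod_def[abs_def] c_def power2_eq_square)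
qed

end

subsection \<open>Sums of eigenvalues\<close>

lemma bessel_inequality:
  assumes f: "f \<in> sq_int M" and w: "\<And>i. i \<in> I \<Longrightarrow> w i \<in> sq_int M" and fin: "finite I"
    and on: "\<And>i j. i \<in> I \<Longrightarrow> j \<in> I \<Longrightarrow> (LINT x|M. w i x * w j x) = (if i = j then 1 else 0)"
  shows "(\<Sum>i\<in>I. (LINT x|M. w i x * f x)\<^sup>2) \<le> (LINT x|M. (f x)\<^sup>2)"
proof -
  define b where "b i = (LINT x|M. w i x * f x)" for i
  define g where "g x = (\<Sum>i\<in>I. b i * w i x)" for x
  have "(\<lambda>x. \<Sum>i\<in>J. b i * w i x) \<in> sq_int M" if "finite J" "J \<subseteq> I" for J
    using that
  proof (induction J rule: finite_induct)
    case empty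
    then show ?case by (simp add: sq_int_def)
  next
    case (insert i J)
    have "(\<lambda>x. b i * w i x + 1 * (\<Sum>i\<in>J. b i * w i x)) \<in> sq_int M"
      using insert w by (intro sq_int_linear) auto
    then show ?case using insert by simp
  qed
  then have g: "g \<in> sq_int M" unfolding g_def using fin by blast
  have wf: "integrable M (\<lambda>x. w i x * f x)" if "i \<in> I" for i by (intro sq_int_mult w f that)
  have ww: "integrable M (\<lambda>x. w i x * w j x)" if "i \<in> I" "j \<in> I" for i j by (intro sq_int_mult w that)
  have fg: "(LINT x|M. f x * g x) = (\<Sum>i\<in>I. (b i)\<^sup>2)"
  proof -
    have "(LINT x|M. f x * g x) = (LINT x|M. (\<Sum>i\<in>I. b i * (w i x * f x)))"
      by (simp add: g_def sum_distrib_left mult_ac)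
    also have "\<dots> = (\<Sum>i\<in>I. b i * b i)" using wf by (simp add: b_def)
    finally show ?thesis by (simp add: power2_eq_square)
  qed
  have wg: "(LINT x|M. w j x * g x) = b j" if j: "j \<in> I" for j
  proof -
    have "(LINT x|M. w j x * g x) = (LINT x|M. (\<Sum>i\<in>I. b i * (w j x * w i x)))"
      by (simp add: g_def sum_distrib_left mult_ac)
    also have "\<dots> = (\<Sum>i\<in>I. b i * (LINT x|M. w j x * w i x))" using ww j by simp
    also have "\<dots> = (\<Sum>i\<in>I. if i = j then b i else 0)" using j by (intro sum.cong) (auto simp: on)
    also have "\<dots> = b j" using j fin by simp
    finally show ?thesis .
  qed
  have gg: "(LINT x|M. (g x)\<^sup>2) = (\<Sum>i\<in>I. (b i)\<^sup>2)"
  proof -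
    have "(LINT x|M. (g x)\<^sup>2) = (LINT x|M. (\<Sum>i\<in>I. b i * (w i x * g x)))"
    proof (rule Bochner_Integration.integral_cong[OF refl])
      fix x
      have "(g x)\<^sup>2 = (\<Sum>i\<in>I. b i * w i x) * g x" by (simp only: power2_eq_square g_def)
      then show "(g x)\<^sup>2 = (\<Sum>i\<in>I. b i * (w i x * g x))" by (simp only: sum_distrib_right mult.assoc)
    qed
    also have "\<dots> = (\<Sum>i\<in>I. b i * (LINT x|M. w i x * g x))" using sq_int_mult[OF w g] by simp
    finally show ?thesis by (simp add: wg power2_eq_square)
  qed
  have "0 \<le> (LINT x|M. (1 * f x + (-1) * g x)\<^sup>2)" by simp
  then show ?thesis
    unfolding integral_square_linear[OF f g] fg gg by (simp add: b_def)
qed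

lemma one_minus_cos_le: "2 - 2 * cos t \<le> t\<^sup>2" for t :: real
proof -
  have "2 - 2 * cos t = 4 * (sin (t / 2))\<^sup>2" using cos_double_sin[of "t / 2"] by simp
  also have "(sin (t / 2))\<^sup>2 \<le> (t / 2)\<^sup>2" using abs_sin_x_le_abs_x[of "t / 2"] by (simp only: abs_le_square_iff)
  finally show ?thesis by (simp add: power_divide)
qed

text \<open>It merges the Cauchy-Schwarz estimates of the cosine part and of the sine part into one;
  the mixed term is handled by the inequality of arithmetic and geometric means.\<close>

lemma square_add_le_mult:
  fixes a b x y x' y' :: real
  assumes a: "a\<^sup>2 \<le> x * y" and b: "b\<^sup>2 \<le> x' * y'" and nn: "0 \<le> x" "0 \<le> y" "0 \<le> x'" "0 \<le> y'"
  shows "(a + b)\<^sup>2 \<le> (x + x') * (y + y')"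
proof -
  have "(2 * (a * b))\<^sup>2 \<le> 4 * ((x * y) * (x' * y'))"
    using mult_mono[OF a b] nn by (simp add: power_mult_distrib)
  also have "\<dots> \<le> (x * y' + x' * y)\<^sup>2"
    using zero_le_power2[of "x * y' - x' * y"] by (simp add: power2_eq_square algebra_simps)
  finally have "2 * (a * b) \<le> x * y' + x' * y"
    using nn by (meson abs_le_D1 abs_le_square_iff abs_of_nonneg add_nonneg_nonneg mult_nonneg_nonneg order_trans power2_le_imp_le)
  then show ?thesis using a b by (simp add: power2_eq_square algebra_simps)
qed

context bounded_domain
begin

text \<open>The eigenspace of \<mu> has as many dimensions as there are indices with
  \<open>ev i = \<mu>\<close>. An orthonormal basis of each eigenspace is therefore distributed over
  these indices by a bijection, so that \<open>w i\<close> belongs to \<open>ev i\<close>; across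
  different eigenvalues orthogonality is \<open>l2_eigen_approx_orthogonal\<close>.\<close>

lemma eigenfunction_family:
  assumes "dirichlet_eigenvalues l \<Omega> ev"
  shows "\<exists>w. (\<forall>i\<ge>1. \<exists>\<phi> V. l2_eigen_approx l \<Omega> (ev i) (w i) \<phi> V) \<and>
    (\<forall>i\<ge>1. \<forall>j\<ge>1. (LINT x|M. w i x * w j x) = (if i = j then 1 else 0))"
proof -
  define S where "S \<mu> = {i. 1 \<le> i \<and> ev i = \<mu>}" for \<mu>
  define E where "E \<mu> = {u. \<exists>\<phi> V. l2_eigen_approx l \<Omega> \<mu> u \<phi> V}" for \<mu>
  have fin: "finite (S \<mu>)" and dim: "has_ae_dim \<Omega> (dirichlet_eigenspace l \<Omega> \<mu>) (card (S \<mu>))" for \<mu>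
    using assms unfolding dirichlet_eigenvalues_def S_def by auto
  have "\<exists>W. (\<forall>i<card (S \<mu>). W i \<in> E \<mu>) \<and>
    (\<forall>i<card (S \<mu>). \<forall>j<card (S \<mu>). (LINT x|M. W i x * W j x) = (if i = j then 1 else 0))" for \<mu>
  proof -
    obtain u where u: "\<forall>i<card (S \<mu>). u i \<in> dirichlet_eigenspace l \<Omega> \<mu>"
      and ind: "\<forall>c :: nat \<Rightarrow> real. (AE x in M. (\<Sum>i<card (S \<mu>). c i * u i x) = 0) \<longrightarrow> (\<forall>i<card (S \<mu>). c i = 0)"
      using dim[of \<mu>] unfolding has_ae_dim_def by blast
    show ?thesis
    proof (rule gram_schmidt_sq_int)
      show "E \<mu> \<subseteq> sq_int M" by (auto simp: E_def l2_eigen_approx_def l2_tendsto_def)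
      show "(\<lambda>x. a * f x + b * g x) \<in> E \<mu>" if "f \<in> E \<mu>" "g \<in> E \<mu>" for f g a b
        using that l2_eigen_approx_linear unfolding E_def by blast
      show "u i \<in> E \<mu>" if "i < card (S \<mu>)" for i
        using u that l2_eigen_approx_eigenspace unfolding E_def by blast
    qed (use ind in blast)
  qed
  then have "\<forall>\<mu>. \<exists>W. (\<forall>i<card (S \<mu>). W i \<in> E \<mu>) \<and>
    (\<forall>i<card (S \<mu>). \<forall>j<card (S \<mu>). (LINT x|M. W i x * W j x) = (if i = j then 1 else 0))" by blast
  from choice[OF this] obtain W where W: "\<forall>\<mu>. (\<forall>i<card (S \<mu>). W \<mu> i \<in> E \<mu>) \<and>
    (\<forall>i<card (S \<mu>). \<forall>j<card (S \<mu>). (LINT x|M. W \<mu> i x * W \<mu> j x) = (if i = j then 1 else 0))" by blast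
  have "\<forall>\<mu>. \<exists>h. bij_betw h (S \<mu>) {0..<card (S \<mu>)}" using ex_bij_betw_finite_nat[OF fin] by blast
  from choice[OF this] obtain h where h: "\<forall>\<mu>. bij_betw (h \<mu>) (S \<mu>) {0..<card (S \<mu>)}" by blast
  define w where "w i = W (ev i) (h (ev i) i)" for i
  have iS: "i \<in> S (ev i)" if "i \<ge> 1" for i using that by (simp add: S_def)
  have hi: "h (ev i) i < card (S (ev i))" if "i \<ge> 1" for i
    using bij_betwE[OF h[rule_format, of "ev i"]] iS[OF that] by fastforce
  have wE: "w i \<in> E (ev i)" if "i \<ge> 1" for i using W hi[OF that] by (simp add: w_def)
  show ?thesis
  proof (rule exI[of _ w], intro conjI allI impI)
    show "\<exists>\<phi> V. l2_eigen_approx l \<Omega> (ev i) (w i) \<phi> V" if "i \<ge> 1" for i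
      using wE[OF that] by (simp add: E_def)
    show "(LINT x|M. w i x * w j x) = (if i = j then 1 else 0)" if i: "i \<ge> 1" and j: "j \<ge> 1" for i j
    proof (cases "ev i = ev j")
      case True
      have inj: "inj_on (h (ev i)) (S (ev i))" using h by (auto simp: bij_betw_def)
      have "h (ev i) i = h (ev i) j \<longleftrightarrow> i = j"
        using inj_on_eq_iff[OF inj iS[OF i], of j] iS[OF j] True by simp
      then show ?thesis
        using W hi[OF i] hi[OF j] True by (simp add: w_def)
    next
      case False
      obtain \<phi> V \<psi> U where "l2_eigen_approx l \<Omega> (ev i) (w i) \<phi> V" "l2_eigen_approx l \<Omega> (ev j) (w j) \<psi> U"
        using wE[OF i] wE[OF j] unfolding E_def by blast
      from l2_eigen_approx_orthogonal[OF this False] show ?thesis using False by auto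
    qed
  qed
qed

text \<open>Bessel's inequality for \<open>x \<mapsto> cos (\<xi> \<bullet> x)\<close>, \<open>x \<mapsto> sin (\<xi> \<bullet> x)\<close> and for their sums and
  differences at two frequencies turns the pointwise and the Lipschitz bound into integrals over
  the domain.\<close>

lemma fourier_density_bounds:
  assumes fin: "finite I" and w: "\<And>i. i \<in> I \<Longrightarrow> w i \<in> sq_int M"
    and on: "\<And>i j. i \<in> I \<Longrightarrow> j \<in> I \<Longrightarrow> (LINT x|M. w i x * w j x) = (if i = j then 1 else 0)"
  shows "(\<Sum>i\<in>I. fourier_prod M (w i) (w i) \<xi>) \<le> measure lebesgue \<Omega>"
    and "\<bar>(\<Sum>i\<in>I. fourier_prod M (w i) (w i) \<xi>) - (\<Sum>i\<in>I. fourier_prod M (w i) (w i) \<eta>)\<bar>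
      \<le> 2 * sqrt (measure lebesgue \<Omega> * (LINT x|M. (norm x)\<^sup>2)) * norm (\<xi> - \<eta>)"
proof -
  let ?P = "\<lambda>\<xi>. \<Sum>i\<in>I. fourier_prod M (w i) (w i) \<xi>"
  define V where "V = measure lebesgue \<Omega>"
  define J where "J = (LINT x|M. (norm x)\<^sup>2)"
  have V1: "(LINT x|M. 1) = V"
    using dom_lmeasurable by (simp add: V_def measure_restrict_space)
  note bessel = bessel_inequality[OF _ w fin on]
  obtain B where B: "\<And>x. x \<in> \<Omega> \<Longrightarrow> norm x \<le> B" using bounded_dom bounded_iff by blast
  have norm_sq: "norm \<in> sq_int M" by (rule bounded_sq_int[of _ B]) (use B in auto)
  have normint: "integrable M (\<lambda>x. (norm x)\<^sup>2)" using norm_sq by (simp add: sq_int_def)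
  have add: "(LINT x|M. (f x)\<^sup>2) + (LINT x|M. (g x)\<^sup>2) = (LINT x|M. (f x)\<^sup>2 + (g x)\<^sup>2)"
    if "f \<in> sq_int M" "g \<in> sq_int M" for f g using that by (simp add: sq_int_def)
  have "?P \<xi> = (\<Sum>i\<in>I. (LINT x|M. w i x * cos (\<xi> \<bullet> x))\<^sup>2) + (\<Sum>i\<in>I. (LINT x|M. w i x * sin (\<xi> \<bullet> x))\<^sup>2)"
    by (simp add: fourier_prod_def cos_tr_def sin_tr_def sum.distrib power2_eq_square)
  also have "\<dots> \<le> (LINT x|M. (cos (\<xi> \<bullet> x))\<^sup>2) + (LINT x|M. (sin (\<xi> \<bullet> x))\<^sup>2)"
    by (intro add_mono bessel cos_sq_int sin_sq_int)
  also have "\<dots> = V" unfolding add[OF cos_sq_int sin_sq_int] using V1 by simp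
  finally show "?P \<xi> \<le> measure lebesgue \<Omega>" by (simp add: V_def)
  define d where "d = norm (\<xi> - \<eta>)"
  define c s where "c \<zeta> i = cos_tr M (w i) \<zeta>" and "s \<zeta> i = sin_tr M (w i) \<zeta>" for \<zeta> i
  have cc: "(\<lambda>x. a * cos (\<xi> \<bullet> x) + b * cos (\<eta> \<bullet> x)) \<in> sq_int M"
    and ss: "(\<lambda>x. a * sin (\<xi> \<bullet> x) + b * sin (\<eta> \<bullet> x)) \<in> sq_int M" for a b
    by (intro sq_int_linear cos_sq_int sin_sq_int)+
  have c_eq: "(LINT x|M. w i x * (a * cos (\<xi> \<bullet> x) + b * cos (\<eta> \<bullet> x))) = a * c \<xi> i + b * c \<eta> i"
    and s_eq: "(LINT x|M. w i x * (a * sin (\<xi> \<bullet> x) + b * sin (\<eta> \<bullet> x))) = a * s \<xi> i + b * s \<eta> i" if "i \<in> I" for i a b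
  proof -
    have "(\<lambda>x. w i x * (a * cos (\<xi> \<bullet> x) + b * cos (\<eta> \<bullet> x))) = (\<lambda>x. a * (w i x * cos (\<xi> \<bullet> x)) + b * (w i x * cos (\<eta> \<bullet> x)))"
      "(\<lambda>x. w i x * (a * sin (\<xi> \<bullet> x) + b * sin (\<eta> \<bullet> x))) = (\<lambda>x. a * (w i x * sin (\<xi> \<bullet> x)) + b * (w i x * sin (\<eta> \<bullet> x)))"
      by (auto simp: algebra_simps)
    then show "(LINT x|M. w i x * (a * cos (\<xi> \<bullet> x) + b * cos (\<eta> \<bullet> x))) = a * c \<xi> i + b * c \<eta> i"
      "(LINT x|M. w i x * (a * sin (\<xi> \<bullet> x) + b * sin (\<eta> \<bullet> x))) = a * s \<xi> i + b * s \<eta> i"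
      using sq_int_mult[OF w[OF that] cos_sq_int] sq_int_mult[OF w[OF that] sin_sq_int]
      by (simp_all add: c_def s_def cos_tr_def sin_tr_def)
  qed
  have lin: "(\<Sum>i\<in>I. (a * c \<xi> i + b * c \<eta> i)\<^sup>2) + (\<Sum>i\<in>I. (a * s \<xi> i + b * s \<eta> i)\<^sup>2)
      \<le> (LINT x|M. (a * cos (\<xi> \<bullet> x) + b * cos (\<eta> \<bullet> x))\<^sup>2 + (a * sin (\<xi> \<bullet> x) + b * sin (\<eta> \<bullet> x))\<^sup>2)" for a b
    using add_mono[OF bessel[OF cc, of a b] bessel[OF ss, of a b]]
    by (simp add: c_eq s_eq add[OF cc ss] cong: sum.cong)
  have tri: "(a * cos (\<xi> \<bullet> x) + b * cos (\<eta> \<bullet> x))\<^sup>2 + (a * sin (\<xi> \<bullet> x) + b * sin (\<eta> \<bullet> x))\<^sup>2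
      = a\<^sup>2 + b\<^sup>2 + 2 * a * b * cos ((\<xi> - \<eta>) \<bullet> x)" for a b x
  proof -
    have "(a * cos (\<xi> \<bullet> x) + b * cos (\<eta> \<bullet> x))\<^sup>2 + (a * sin (\<xi> \<bullet> x) + b * sin (\<eta> \<bullet> x))\<^sup>2
      = a\<^sup>2 * ((cos (\<xi> \<bullet> x))\<^sup>2 + (sin (\<xi> \<bullet> x))\<^sup>2) + b\<^sup>2 * ((cos (\<eta> \<bullet> x))\<^sup>2 + (sin (\<eta> \<bullet> x))\<^sup>2)
       + 2 * a * b * (cos (\<xi> \<bullet> x) * cos (\<eta> \<bullet> x) + sin (\<xi> \<bullet> x) * sin (\<eta> \<bullet> x))" by algebra
    then show ?thesis by (simp add: inner_diff_left cos_diff)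
  qed
  have tri_int: "integrable M (\<lambda>x. a\<^sup>2 + b\<^sup>2 + 2 * a * b * cos ((\<xi> - \<eta>) \<bullet> x))" for a b
    using add_mono cc[of a b] ss[of a b] unfolding tri[symmetric] by (simp add: sq_int_def)
  have D: "(\<Sum>i\<in>I. (c \<xi> i - c \<eta> i)\<^sup>2) + (\<Sum>i\<in>I. (s \<xi> i - s \<eta> i)\<^sup>2) \<le> d\<^sup>2 * J"
  proof -
    have "(\<Sum>i\<in>I. (c \<xi> i - c \<eta> i)\<^sup>2) + (\<Sum>i\<in>I. (s \<xi> i - s \<eta> i)\<^sup>2)
      \<le> (LINT x|M. 1\<^sup>2 + (-1)\<^sup>2 + 2 * 1 * (-1) * cos ((\<xi> - \<eta>) \<bullet> x))"
      using lin[of 1 "-1"] unfolding tri by simp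
    also have "\<dots> \<le> (LINT x|M. d\<^sup>2 * (norm x)\<^sup>2)"
    proof (rule integral_mono[OF tri_int])
      show "integrable M (\<lambda>x. d\<^sup>2 * (norm x)\<^sup>2)" using normint by simp
      fix x
      have "1\<^sup>2 + (-1)\<^sup>2 + 2 * 1 * (-1) * cos ((\<xi> - \<eta>) \<bullet> x) \<le> ((\<xi> - \<eta>) \<bullet> x)\<^sup>2"
        using one_minus_cos_le[of "(\<xi> - \<eta>) \<bullet> x"] by simp
      also have "\<dots> \<le> (d * norm x)\<^sup>2"
        using Cauchy_Schwarz_ineq2[of "\<xi> - \<eta>" x] unfolding d_def by (intro iffD1[OF abs_le_square_iff]) simp
      finally show "1\<^sup>2 + (-1)\<^sup>2 + 2 * 1 * (-1) * cos ((\<xi> - \<eta>) \<bullet> x) \<le> d\<^sup>2 * (norm x)\<^sup>2" by (simp add: power_mult_distrib)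
    qed
    finally show ?thesis by (simp add: J_def)
  qed
  have A: "(\<Sum>i\<in>I. (c \<xi> i + c \<eta> i)\<^sup>2) + (\<Sum>i\<in>I. (s \<xi> i + s \<eta> i)\<^sup>2) \<le> 4 * V"
  proof -
    have "(\<Sum>i\<in>I. (c \<xi> i + c \<eta> i)\<^sup>2) + (\<Sum>i\<in>I. (s \<xi> i + s \<eta> i)\<^sup>2)
      \<le> (LINT x|M. 1\<^sup>2 + 1\<^sup>2 + 2 * 1 * 1 * cos ((\<xi> - \<eta>) \<bullet> x))"
      using lin[of 1 1] unfolding tri by simp
    also have "\<dots> \<le> (LINT x|M. 4)"
      by (rule integral_mono[OF tri_int]) (use cos_le_one in \<open>auto simp: fin.integrable_const\<close>)
    also have "\<dots> = 4 * V" using V1 by simp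
    finally show ?thesis .
  qed
  \<comment> \<open>A difference of squares splits into a factor with differences, controlled by
    \<open>d\<^sup>2 * J\<close>, and one with sums, controlled by \<open>4 * V\<close>. The root of
    the product is the Lipschitz bound, and dividing it by \<open>(2 * pi) ^ 3\<close> gives the
    slope \<open>rho \<Omega>\<close>.\<close>
  have "?P \<xi> - ?P \<eta> = (\<Sum>i\<in>I. (c \<xi> i - c \<eta> i) * (c \<xi> i + c \<eta> i)) + (\<Sum>i\<in>I. (s \<xi> i - s \<eta> i) * (s \<xi> i + s \<eta> i))"
    by (simp add: fourier_prod_def c_def s_def sum_subtractf[symmetric] sum.distrib[symmetric] algebra_simps)
  then have "(?P \<xi> - ?P \<eta>)\<^sup>2 \<le> ((\<Sum>i\<in>I. (c \<xi> i - c \<eta> i)\<^sup>2) + (\<Sum>i\<in>I. (s \<xi> i - s \<eta> i)\<^sup>2))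
      * ((\<Sum>i\<in>I. (c \<xi> i + c \<eta> i)\<^sup>2) + (\<Sum>i\<in>I. (s \<xi> i + s \<eta> i)\<^sup>2))"
    by (simp only:) (intro square_add_le_mult Cauchy_Schwarz_ineq_sum sum_nonneg zero_le_power2)
  also have "\<dots> \<le> (d\<^sup>2 * J) * (4 * V)"
    using D A by (intro mult_mono add_nonneg_nonneg sum_nonneg zero_le_power2) (auto simp: J_def)
  also have "\<dots> = (2 * sqrt (V * J) * d)\<^sup>2"
    by (simp add: power_mult_distrib V_def J_def)
  finally have "\<bar>?P \<xi> - ?P \<eta>\<bar> \<le> \<bar>2 * sqrt (V * J) * d\<bar>" by (simp only: abs_le_square_iff)
  also have "\<dots> = 2 * sqrt (V * J) * d" by (simp add: V_def J_def d_def)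
  finally show "\<bar>?P \<xi> - ?P \<eta>\<bar> \<le> 2 * sqrt (measure lebesgue \<Omega> * (LINT x|M. (norm x)\<^sup>2)) * norm (\<xi> - \<eta>)"
    by (simp only: V_def J_def d_def)
qed

end

section \<open>From the domain to the trapezoid\<close>

text \<open>The weight \<open>(norm x)\<^sup>2 - r\<^sup>2\<close> is negative exactly on the ball
  of radius \<open>r\<close> around the origin. Its integral over any set is thus at least that over
  the ball, and equal volumes cancel the term with \<open>r\<^sup>2\<close>.\<close>

lemma moment_lower_bound:
  fixes \<Omega> :: "(real^3) set"
  assumes "open \<Omega>" "bounded \<Omega>" and r: "r \<ge> 0" "omega3 * r ^ 3 = vol \<Omega>"
  shows "moment \<Omega> \<ge> 3 / 5 * omega3 * r ^ 5"
proof -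
  interpret bounded_domain \<Omega> using assms by unfold_locales
  obtain B where B: "\<And>x. x \<in> \<Omega> \<Longrightarrow> norm x \<le> B" using bounded_dom bounded_iff by blast
  have norm_sq: "norm \<in> sq_int (lebesgue_on \<Omega>)" by (rule bounded_sq_int[of _ B]) (use B in auto)
  then have int: "integrable (lebesgue_on \<Omega>) (\<lambda>x. (norm x)\<^sup>2)" by (simp add: sq_int_def)
  have S: "\<Omega> \<in> sets lborel" "\<Omega> \<in> sets lebesgue" using open_dom by auto
  have ind: "integrable lborel (\<lambda>x. indicator \<Omega> x * (norm x)\<^sup>2)" "(LBINT x. indicator \<Omega> x * (norm x)\<^sup>2) = moment \<Omega>"
  proof -
    have m: "(\<lambda>x. indicator \<Omega> x * (norm x)\<^sup>2) \<in> borel_measurable borel" using S by measurable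
    have "integrable (lebesgue_on \<Omega>) (\<lambda>x. indicator \<Omega> x * (norm x)\<^sup>2) \<longleftrightarrow> integrable (lebesgue_on \<Omega>) (\<lambda>x. (norm x)\<^sup>2)"
      by (rule Bochner_Integration.integrable_cong) auto
    moreover have "(LINT x|lebesgue_on \<Omega>. indicator \<Omega> x * (norm x)\<^sup>2) = moment \<Omega>"
      unfolding moment_def by (rule Bochner_Integration.integral_cong) auto
    ultimately show "integrable lborel (\<lambda>x. indicator \<Omega> x * (norm x)\<^sup>2)" "(LBINT x. indicator \<Omega> x * (norm x)\<^sup>2) = moment \<Omega>"
      using integral_lebesgue_on_vanish[OF S(2) m] int by (simp_all add: indicator_def)
  qed
  have V: "integrable lborel (indicator \<Omega> :: real^3 \<Rightarrow> real)" "(LBINT x. indicator \<Omega> x) = vol \<Omega>"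
    using S dom_lmeasurable bounded_dom by (auto simp: vol_def intro!: integrable_real_indicator emeasure_bounded_finite)
  note B2 = ball_moment[OF r(1), of 2, unfolded has_bochner_integral_iff]
  note B0 = ball_moment[OF r(1), of 0, unfolded has_bochner_integral_iff, simplified]
  have "(LBINT x. indicator (ball (0::real^3) r) x * (norm x)\<^sup>2 - r\<^sup>2 * indicator (ball 0 r) x)
     \<le> (LBINT x. indicator \<Omega> x * (norm x)\<^sup>2 - r\<^sup>2 * indicator \<Omega> x)"
  proof (rule integral_mono)
    show "integrable lborel (\<lambda>x::real^3. indicator (ball 0 r) x * (norm x)\<^sup>2 - r\<^sup>2 * indicator (ball 0 r) x)"
      using B2 B0 by simp
    show "integrable lborel (\<lambda>x. indicator \<Omega> x * (norm x)\<^sup>2 - r\<^sup>2 * indicator \<Omega> x)"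
      using ind V by simp
    fix x :: "real^3"
    have "norm x < r \<Longrightarrow> (norm x)\<^sup>2 \<le> r\<^sup>2" "\<not> norm x < r \<Longrightarrow> r\<^sup>2 \<le> (norm x)\<^sup>2"
      using r by (auto intro: power_mono)
    then show "indicator (ball 0 r) x * (norm x)\<^sup>2 - r\<^sup>2 * indicator (ball 0 r) x \<le> indicator \<Omega> x * (norm x)\<^sup>2 - r\<^sup>2 * indicator \<Omega> x"
      by (auto simp: indicator_def)
  qed
  then have "3 / 5 * omega3 * r ^ 5 - r\<^sup>2 * (omega3 * r ^ 3) \<le> moment \<Omega> - r\<^sup>2 * vol \<Omega>"
    using B2 B0 ind V by simp
  then show ?thesis using r by simp
qed

text \<open>The Lagrangian bound for the sum of the first \<open>k\<close> eigenvalues, rescaled so that the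
  trapezoid with slope \<open>rho\<close> is centred at \<open>\<tau> * x\<close> and has width \<open>2 * \<tau> * h\<close>.\<close>

lemma eigenvalue_sum_mean_pow:
  fixes \<Omega> :: "(real^3) set"
  assumes dom: "open \<Omega>" "bounded \<Omega>" "\<Omega> \<noteq> {}" and ev: "dirichlet_eigenvalues l \<Omega> ev"
    and \<tau>: "\<tau> > 0" "omega3 * alpha \<Omega> * \<tau> ^ 3 = real k" and h: "h = alpha \<Omega> / (2 * rho \<Omega> * \<tau>)" "2 * h ^ 3 \<le> 1"
    and pos: "vol \<Omega> > 0" "moment \<Omega> > 0"
  shows "\<exists>x. mean_pow 3 x h = 1 \<and>
    omega3 * alpha \<Omega> * \<tau> ^ (2 * l + 3) * (3 / (2 * real l + 3) * mean_pow (2 * l + 3) x h) \<le> (\<Sum>i=1..k. ev i)"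
proof -
  interpret bounded_domain \<Omega> using dom by unfold_locales
  let ?M = "lebesgue_on \<Omega>"
  define p a where "p = rho \<Omega>" and "a = alpha \<Omega>"
  have p: "p > 0" and a: "a > 0" using pos by (auto simp: p_def a_def rho_def alpha_def)
  have h0: "h > 0" using p a \<tau> unfolding h p_def[symmetric] a_def[symmetric] by simp
  \<comment> \<open>At \<open>x = h\<close> the cubic has the value \<open>2 * h ^ 3\<close>, at
    most 1 by assumption. Having \<open>x \<ge> h\<close> makes the inner radius \<open>s\<close> of
    the trapezoid nonnegative.\<close>
  have "\<exists>x\<ge>h. x \<le> h + 1 \<and> x ^ 3 + x * h\<^sup>2 = 1"
  proof (rule IVT')
    show "h ^ 3 + h * h\<^sup>2 \<le> 1" using h(2) by (simp add: power3_eq_cube power2_eq_square)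
    have "1 ^ 3 \<le> (h + 1) ^ 3" using h0 by (intro power_mono) auto
    moreover have "0 \<le> (h + 1) * h\<^sup>2" using h0 by simp
    ultimately show "1 \<le> (h + 1) ^ 3 + (h + 1) * h\<^sup>2" by simp
    show "continuous_on {h..h + 1} (\<lambda>x. x ^ 3 + x * h\<^sup>2)" by (intro continuous_intros)
  qed simp
  then obtain x where x: "h \<le> x" "x ^ 3 + x * h\<^sup>2 = 1" by blast
  have x3: "mean_pow 3 x h = 1" using x h0 by (simp add: mean_pow_3)
  define s b where "s = \<tau> * x - \<tau> * h" and "b = \<tau> * x + \<tau> * h"
  have s: "0 \<le> s" "s < b" using x h0 \<tau> by (auto simp: s_def b_def)
  have bs: "p * (b - s) = a"
    using h p \<tau> by (simp add: s_def b_def p_def a_def field_simps)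
  \<comment> \<open>Translation between the differences of powers in
    \<open>lipschitz_bathtub\<close> and \<open>mean_pow\<close>. The case \<open>n = 3\<close> is
    the mass, the case \<open>n = 2 * l + 3\<close> the moment.\<close>
  have pow: "omega3 * p * (b ^ (n + 1) - s ^ (n + 1)) = omega3 * a * (real n + 1) * (\<tau> ^ n * mean_pow n x h)" for n
  proof -
    have "\<tau> ^ n * mean_pow n x h = mean_pow n (\<tau> * x) (\<tau> * h)" using \<tau> by (simp add: mean_pow_scale)
    also have "\<dots> = (b ^ (n + 1) - s ^ (n + 1)) / ((b - s) * (real n + 1))"
      by (simp add: mean_pow_def s_def b_def algebra_simps)
    finally have eq: "\<tau> ^ n * mean_pow n x h = (b ^ (n + 1) - s ^ (n + 1)) / ((b - s) * (real n + 1))" .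
    have "(b - s) * (real n + 1) \<noteq> 0" using s by simp
    then have "b ^ (n + 1) - s ^ (n + 1) = (b - s) * (real n + 1) * (\<tau> ^ n * mean_pow n x h)"
      unfolding eq by (metis nonzero_mult_div_cancel_left times_divide_eq_right)
    then show ?thesis unfolding bs[symmetric] by simp
  qed
  obtain w where w: "\<And>i. i \<ge> 1 \<Longrightarrow> \<exists>\<phi> V. l2_eigen_approx l \<Omega> (ev i) (w i) \<phi> V"
    and on: "\<And>i j. i \<ge> 1 \<Longrightarrow> j \<ge> 1 \<Longrightarrow> (LINT x|?M. w i x * w j x) = (if i = j then 1 else 0)"
    using eigenfunction_family[OF ev] by blast
  let ?P = "\<lambda>i. fourier_prod ?M (w i) (w i)"
  have ws: "w i \<in> sq_int ?M" if "i \<ge> 1" for i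
    using w[OF that] by (auto simp: l2_eigen_approx_def l2_tendsto_def)
  \<comment> \<open>The division by \<open>(2 * pi) ^ 3\<close> makes each eigenfunction contribute
    mass 1.\<close>
  define F where "F \<xi> = (\<Sum>i=1..k. ?P i \<xi>) / (2 * pi) ^ 3" for \<xi>
  have P_int: "has_bochner_integral lborel (?P i) ((2 * pi) ^ 3)" if i: "i \<in> {1..k}" for i
  proof -
    obtain \<phi> V where *: "l2_eigen_approx l \<Omega> (ev i) (w i) \<phi> V" using w[of i] i by (auto simp del: One_nat_def)
    then have "\<And>n. \<phi> n \<in> test_funs \<Omega>" "l2_tendsto ?M \<phi> (w i)" unfolding l2_eigen_approx_def by auto
    from plancherel_l2_limit[OF this] show ?thesis using on[of i i] that by (simp add: power2_eq_square)
  qed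
  have m_int: "integrable lborel (\<lambda>\<xi>. norm \<xi> ^ (2 * l) * ?P i \<xi>)"
    and m_le: "(LBINT \<xi>. norm \<xi> ^ (2 * l) * ?P i \<xi>) \<le> (2 * pi) ^ 3 * ev i" if i: "i \<in> {1..k}" for i
  proof -
    obtain \<phi> V where *: "l2_eigen_approx l \<Omega> (ev i) (w i) \<phi> V" using w[of i] i by (auto simp del: One_nat_def)
    show "integrable lborel (\<lambda>\<xi>. norm \<xi> ^ (2 * l) * ?P i \<xi>)"
      by (rule fourier_moment_eigen(1)[OF *])
    show "(LBINT \<xi>. norm \<xi> ^ (2 * l) * ?P i \<xi>) \<le> (2 * pi) ^ 3 * ev i"
      using fourier_moment_eigen(2)[OF *] on[of i i] that by (simp add: power2_eq_square)
  qed
  have F_int: "has_bochner_integral lborel F (real k)"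
  proof -
    have "has_bochner_integral lborel F ((\<Sum>i=1..k. (2 * pi) ^ 3) / (2 * pi) ^ 3)"
      unfolding F_def by (intro has_bochner_integral_divide has_bochner_integral_sum P_int) auto
    then show ?thesis by simp
  qed
  have Fm_eq: "norm \<xi> ^ (2 * l) * F \<xi> = (\<Sum>i=1..k. norm \<xi> ^ (2 * l) * ?P i \<xi>) / (2 * pi) ^ 3" for \<xi>
    by (simp add: F_def sum_distrib_left)
  have Fm_int: "integrable lborel (\<lambda>\<xi>. norm \<xi> ^ (2 * l) * F \<xi>)"
    unfolding Fm_eq by (intro integrable_divide Bochner_Integration.integrable_sum m_int)
  have "(LBINT \<xi>. norm \<xi> ^ (2 * l) * F \<xi>) = (\<Sum>i=1..k. LBINT \<xi>. norm \<xi> ^ (2 * l) * ?P i \<xi>) / (2 * pi) ^ 3"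
    unfolding Fm_eq using m_int by (simp only: integral_divide_zero Bochner_Integration.integral_sum)
  also have "\<dots> \<le> (\<Sum>i=1..k. (2 * pi) ^ 3 * ev i) / (2 * pi) ^ 3"
    by (intro divide_right_mono sum_mono m_le) auto
  also have "\<dots> = (\<Sum>i=1..k. ev i)" by (simp add: sum_distrib_left[symmetric])
  finally have Fm_le: "(LBINT \<xi>. norm \<xi> ^ (2 * l) * F \<xi>) \<le> (\<Sum>i=1..k. ev i)" .
  note bounds = fourier_density_bounds[of "{1..k}" w, OF finite_atLeastAtMost ws on]
  have "3 * omega3 * p / ((real (2 * l) + 3) * (real (2 * l) + 4)) * (b ^ (2 * l + 4) - s ^ (2 * l + 4)) \<le> (LBINT \<xi>. norm \<xi> ^ (2 * l) * F \<xi>)"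
  proof (rule lipschitz_bathtub[OF _ _ _ p s _ Fm_int])
    show "0 \<le> F \<xi>" for \<xi> by (auto simp: F_def fourier_prod_def intro!: divide_nonneg_nonneg sum_nonneg)
    show "F \<xi> \<le> p * (b - s)" for \<xi>
      unfolding bs F_def a_def alpha_def vol_def by (intro divide_right_mono bounds) auto
    show "\<bar>F \<xi> - F \<eta>\<bar> \<le> p * norm (\<xi> - \<eta>)" for \<xi> \<eta>
    proof -
      have "\<bar>F \<xi> - F \<eta>\<bar> = \<bar>(\<Sum>i=1..k. ?P i \<xi>) - (\<Sum>i=1..k. ?P i \<eta>)\<bar> / (2 * pi) ^ 3"
        by (simp add: F_def diff_divide_distrib[symmetric])
      also have "\<dots> \<le> (2 * sqrt (measure lebesgue \<Omega> * (LINT x|?M. (norm x)\<^sup>2)) * norm (\<xi> - \<eta>)) / (2 * pi) ^ 3"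
        by (intro divide_right_mono bounds) auto
      also have "\<dots> = p * norm (\<xi> - \<eta>)" by (simp add: p_def rho_def vol_def moment_def)
      finally show ?thesis .
    qed
    show "integrable lborel F" using F_int by (simp add: has_bochner_integral_iff)
    have "omega3 * p * (b ^ (3 + 1) - s ^ (3 + 1)) = 4 * real k"
      unfolding pow x3 using \<tau>(2) by (simp add: a_def)
    then show "omega3 * p / 4 * (b ^ 4 - s ^ 4) \<le> (LBINT x. F x)"
      using F_int by (simp add: has_bochner_integral_iff)
  qed
  moreover have "3 * omega3 * p / ((real (2 * l) + 3) * (real (2 * l) + 4)) * (b ^ (2 * l + 4) - s ^ (2 * l + 4))
     = omega3 * a * \<tau> ^ (2 * l + 3) * (3 / (2 * real l + 3) * mean_pow (2 * l + 3) x h)"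
  proof -
    have "3 * omega3 * p / ((real (2 * l) + 3) * (real (2 * l) + 4)) * (b ^ (2 * l + 4) - s ^ (2 * l + 4))
       = 3 / ((2 * real l + 3) * (2 * real l + 4)) * (omega3 * p * (b ^ ((2 * l + 3) + 1) - s ^ ((2 * l + 3) + 1)))"
    proof -
      have idx: "2 * l + 4 = (2 * l + 3) + 1" by simp
      show ?thesis unfolding idx by simp
    qed
    also have "\<dots> = 3 / ((2 * real l + 3) * (2 * real l + 4)) * (omega3 * a * (2 * real l + 4) * (\<tau> ^ (2 * l + 3) * mean_pow (2 * l + 3) x h))"
      unfolding pow by (simp add: add.assoc)
    also have "\<dots> = omega3 * a * \<tau> ^ (2 * l + 3) * (3 / (2 * real l + 3) * mean_pow (2 * l + 3) x h)"
      by (simp add: divide_simps)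
    finally show ?thesis .
  qed
  ultimately show ?thesis using x3 Fm_le unfolding a_def by (intro exI[of _ x]) auto
qed

subsection \<open>Expansion of the bound\<close>

text \<open>The volume, \<open>omega3\<close>, \<open>alpha \<Omega>\<close> and \<open>k\<close>
  will all be written as cubes, so that real exponents in thirds become integer powers and the terms
  of the claims can be compared by algebra.\<close>

lemma cube_powr: "0 < y \<Longrightarrow> (y ^ 3) powr (c / 3) = y powr c" for y :: real
  using powr_powr[of y 3 "c / 3"] powr_realpow[of y 3] by simp

lemma cube_powr_numeral: "0 < y \<Longrightarrow> (y ^ 3) powr (numeral n / 3) = y ^ numeral n" for y :: real
  using cube_powr[of y "numeral n"] by (simp add: powr_numeral)

lemma cube_root_cube: "0 < x \<Longrightarrow> (x powr (1 / 3)) ^ 3 = x" for x :: real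
  by (simp add: powr_power)

lemma powr_two_real: "0 < y \<Longrightarrow> y powr (2 * real l) = y ^ (2 * l)" for y :: real
  using powr_realpow[of y "2 * l"] by simp

lemma cube_powr_add: "0 < y \<Longrightarrow> (y ^ 3) powr ((2 * real l + real j) / 3) = y ^ (2 * l) * y ^ j" for y :: real
  by (simp only: cube_powr powr_add powr_two_real powr_realpow)

lemma cube_powr_diff: "0 < y \<Longrightarrow> (y ^ 3) powr ((2 * real l - real j) / 3) = y ^ (2 * l) / y ^ j" for y :: real
  by (simp only: cube_powr powr_diff powr_two_real powr_realpow)

lemma cube_powr_diff': "0 < y \<Longrightarrow> (y ^ 3) powr ((real j - 2 * real l) / 3) = y ^ j / y ^ (2 * l)" for y :: real
  by (simp only: cube_powr powr_diff powr_two_real powr_realpow)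

text \<open>The member of the maximum with \<open>i = 1\<close> and upper index
  \<open>2 * l + 3\<close> suffices: its binomial ratio is \<open>l + 1\<close>.\<close>

lemma k2_ge: "2 / 105 * ((real l + 1) / 2) ^ 3 \<le> k2 l" if "l \<ge> 1"
proof -
  have "(2 * l + 3) * (2 * l + 3 - 1) = (2 * l + 3) * (l + 1) * 2" by simp
  then have "(2 * l + 3) choose 2 = (2 * l + 3) * (l + 1)" by (simp only: choose_two)
  then have "real ((2 * l + 3) choose 2) = real (2 * l + 3) * (real l + 1)"
    by (simp only: of_nat_mult of_nat_add of_nat_1)
  then have "binom_ratio (2 * l + 3) 1 = real l + 1"
    unfolding binom_ratio_def one_add_one choose_one by simp
  then have "((real l + 1) / 2) ^ 3 \<le> Max (\<Union>i\<in>{1..2*l}.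
     {(binom_ratio (2*l+3) i / 2) ^ 3, (binom_ratio (2*l+2) i / 2) ^ 3, (binom_ratio (2*l+1) i / 2) ^ 3})"
    using that by (intro Max_ge) (auto intro!: bexI[of _ 1])
  then show ?thesis by (simp add: k2_def)
qed

text \<open>With \<open>e = 2 * h\<close>, the bound \<open>e * (l + 1) \<le> 2\<close> makes the terms of order three to five of
  the expansion for \<open>l \<ge> 3\<close> add up to something nonpositive.\<close>

lemma higher_terms_nonpos:
  fixes e :: real
  assumes l: "l \<ge> 1" and e: "0 \<le> e" "e * (real l + 1) \<le> 2"
  shows "- (real l + 1)\<^sup>2 / 2 * e ^ 3 + (3 * real l - 2) * (2 * real l + 1) * (real l + 1) / 24 * e ^ 4
    - (2 * real l + 1) * (2 * real l - 1) * (real l + 1) / 24 * e ^ 5 \<le> 0"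
proof -
  define x where "x = real l"
  have x: "x \<ge> 1" using l by (simp add: x_def)
  have "(3 * x - 2) * (2 * x + 1) / 24 * (e * (x + 1)) \<le> (3 * x - 2) * (2 * x + 1) / 24 * 2"
    using x e by (intro mult_left_mono) (auto simp: x_def)
  also have "\<dots> \<le> (x + 1)\<^sup>2 / 2" using x by (simp add: power2_eq_square algebra_simps)
  finally have "e ^ 3 * ((3 * x - 2) * (2 * x + 1) / 24 * (e * (x + 1)) - (x + 1)\<^sup>2 / 2) \<le> 0"
    using e by (intro mult_nonneg_nonpos) auto
  moreover have "(2 * x + 1) * (2 * x - 1) * (x + 1) / 24 * e ^ 5 \<ge> 0" using x e by simp
  moreover have "- (x + 1)\<^sup>2 / 2 * e ^ 3 + (3 * x - 2) * (2 * x + 1) * (x + 1) / 24 * e ^ 4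
     = e ^ 3 * ((3 * x - 2) * (2 * x + 1) / 24 * (e * (x + 1)) - (x + 1)\<^sup>2 / 2)"
    by algebra
  ultimately show ?thesis unfolding x_def by linarith
qed

theorem theorem3p2:
  fixes l :: nat and \<Omega> :: "(real^3) set" and ev :: "nat \<Rightarrow> real"
  assumes "l \<ge> 1"
    and "open \<Omega>" and "connected \<Omega>" and "\<Omega> \<noteq> {}" and "bounded \<Omega>"
    and "dirichlet_eigenvalues l \<Omega> ev"
  shows
    "(l = 1 \<longrightarrow> (\<forall>k::nat. k \<ge> 1 \<longrightarrow>
        (\<Sum>i=1..k. ev i) \<ge>
          3/5 * ((2*pi)^3 / (omega3 * vol \<Omega>)) powr (2/3) * real k powr (5/3)
          + 1/16 * (vol \<Omega> / moment \<Omega>) * real k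
          - 11/3840 * (omega3 powr (1/3) / (2*pi))^2 * (vol \<Omega> powr (4/3) / moment \<Omega>)^2
              * real k powr (1/3)
          + 659/6400000 * (omega3^4 / 4) powr (1/3)
              * (vol \<Omega> powr (13/3) / ((2*pi)^4 * moment \<Omega> ^ 3)) * real k powr (- (1/3))))
     \<and>
     (l = 2 \<longrightarrow> (\<forall>k::nat. k \<ge> 1 \<longrightarrow>
        (\<Sum>i=1..k. ev i) \<ge>
          3/7 * ((2*pi)^3 / (omega3 * vol \<Omega>)) powr (4/3) * real k powr (7/3)
          + pi^2 / (2 * omega3 powr (2/3)) * (vol \<Omega> powr (1/3) / moment \<Omega>) * real k powr (5/3)
          - 1/256 * (vol \<Omega> / moment \<Omega>)^2 * real k
          + 23/580608 * (vol \<Omega> powr (11/3) / ((2*pi)^2 * moment \<Omega> ^ 3)) * real k powr (1/3)))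
     \<and>
     (l \<ge> 3 \<longrightarrow> (\<forall>k::nat. k \<ge> 1 \<longrightarrow> real k \<ge> max (k1 l) (k2 l) \<longrightarrow>
        (\<Sum>i=1..k. ev i) \<ge>
          3 / ((2 * real l + 3) * omega3 powr (2 * real l / 3))
              * alpha \<Omega> powr (- (2 * real l / 3)) * real k powr ((2 * real l + 3) / 3)
          + 4 * real l * pi^6 / (vol \<Omega> * moment \<Omega> * omega3 powr ((2 * real l - 2) / 3))
              * alpha \<Omega> powr ((8 - 2 * real l) / 3) * real k powr ((2 * real l + 1) / 3)
          - (real l + 1)^2 / (2 * omega3 powr ((2 * real l - 3) / 3) * rho \<Omega> ^ 3)
              * alpha \<Omega> powr ((12 - 2 * real l) / 3) * real k powr (2 * real l / 3)
          + (3 * real l - 2) * (2 * real l + 1) * (real l + 1)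
                / (24 * omega3 powr ((2 * real l - 4) / 3) * rho \<Omega> ^ 4)
              * alpha \<Omega> powr ((16 - 2 * real l) / 3) * real k powr ((2 * real l - 1) / 3)
          - (2 * real l + 1) * (2 * real l - 1) * (real l + 1)
                / (24 * omega3 powr ((2 * real l - 5) / 3) * rho \<Omega> ^ 5)
              * alpha \<Omega> powr ((20 - 2 * real l) / 3) * real k powr ((2 * real l - 2) / 3)))"
proof -
  have pos: "vol \<Omega> > 0" "moment \<Omega> > 0"
  proof -
    obtain z d where d: "d > 0" "ball z d \<subseteq> \<Omega>" using assms(2,4) open_contains_ball by (metis ex_in_conv)
    have fin: "\<Omega> \<in> lmeasurable" using assms(2,5) by (simp add: lmeasurable_open)
    have "0 < measure lebesgue (ball z d)" using d(1) by simp
    also have "\<dots> \<le> vol \<Omega>" unfolding vol_def using d(2) fin by (intro measure_mono_fmeasurable) auto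
    finally show V: "vol \<Omega> > 0" .
    have om: "omega3 > 0" by (simp add: omega3_def)
    define r where "r = (vol \<Omega> / omega3) powr (1 / 3)"
    have r: "r > 0" "omega3 * r ^ 3 = vol \<Omega>" using V om by (simp_all add: r_def cube_root_cube)
    have "0 < 3 / 5 * omega3 * r ^ 5" using r om by simp
    also have "\<dots> \<le> moment \<Omega>" using r by (intro moment_lower_bound assms) auto
    finally show "moment \<Omega> > 0" .
  qed
  note mom = moment_lower_bound[OF assms(2,5)]
  note main = eigenvalue_sum_mean_pow[OF assms(2,5,4,6) _ _ _ _ pos]
  define P where "P = 2 * pi"
  \<comment> \<open>Cube roots: \<open>v\<close> of the volume, \<open>c\<close> of
    \<open>omega3\<close>, and \<open>u\<close> of \<open>alpha \<Omega>\<close>.\<close>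
  define v c u where "v = vol \<Omega> powr (1/3)" and "c = omega3 powr (1/3)" and "u = v / P"
  have om: "omega3 > 1" using pi_gt3 by (simp add: omega3_def)
  have P: "P > 0" by (simp add: P_def)
  have v: "v > 0" "v ^ 3 = vol \<Omega>" using pos by (simp_all add: v_def cube_root_cube)
  have c: "c > 0" "c ^ 3 = omega3" using om by (simp_all add: c_def cube_root_cube)
  have o1: "c \<ge> 1" using om by (simp add: c_def ge_one_powr_ge_zero)
  have u: "u > 0" "v = u * P" using v P by (auto simp: u_def)
  have al: "alpha \<Omega> = u ^ 3" using v P by (simp add: alpha_def u_def power_divide P_def)
  have rho: "rho \<Omega> > 0" using pos by (simp add: rho_def)
  have rho2: "rho \<Omega> ^ 2 = 4 * (v ^ 3 * moment \<Omega>) / P ^ 6"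
    using pos v by (simp add: rho_def P_def power_mult_distrib power_divide) 
  \<comment> \<open>Besides the bound on the sum, this expresses \<open>k\<close>,
    \<open>moment \<Omega>\<close> and \<open>rho \<Omega>\<close> through \<open>c\<close>,
    \<open>u\<close>, \<open>v\<close>, \<tau> and \<open>h\<close>, which is what reduces the three
    claims to inequalities in \<open>h\<close>.\<close>
  have base: "\<exists>\<tau> h x. \<tau> > 0 \<and> h > 0 \<and> h\<^sup>2 \<le> 3 / 100 \<and> (2 * h) ^ 3 * real k \<le> 2 / 105 \<and> real k = (c * u * \<tau>) ^ 3 \<and>
      moment \<Omega> = v ^ 3 / (16 * h\<^sup>2 * \<tau>\<^sup>2) \<and> rho \<Omega> = u ^ 3 / (2 * h * \<tau>) \<and> mean_pow 3 x h = 1 \<and>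
      c ^ 3 * u ^ 3 * \<tau> ^ (2 * l + 3) * (3 / (2 * real l + 3) * mean_pow (2 * l + 3) x h) \<le> (\<Sum>i=1..k. ev i)"
    if k: "k \<ge> 1" for k
  proof -
    define q \<tau> h where "q = real k powr (1/3)" and "\<tau> = q / (c * u)" and "h = alpha \<Omega> / (2 * rho \<Omega> * \<tau>)"
    have q: "q > 0" "q ^ 3 = real k" using k by (simp_all add: q_def cube_root_cube)
    have \<tau>: "\<tau> > 0" "q = c * u * \<tau>" using q c u by (auto simp: \<tau>_def)
    have h: "h > 0" using u rho \<tau> by (simp add: h_def al)
    have rho_eq: "rho \<Omega> = u ^ 3 / (2 * h * \<tau>)" using rho \<tau> h u by (simp add: h_def al field_simps)
    have mom_eq: "moment \<Omega> = v ^ 3 / (16 * h\<^sup>2 * \<tau>\<^sup>2)"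
    proof -
      have "u ^ 6 / (4 * h\<^sup>2 * \<tau>\<^sup>2) = 4 * (v ^ 3 * moment \<Omega>) / P ^ 6"
        using rho2 unfolding rho_eq by (simp add: power_divide power_mult_distrib power_mult[symmetric])
      also have "u ^ 6 = v ^ 6 / P ^ 6" by (simp add: u_def power_divide)
      finally have "v ^ 6 / (4 * h\<^sup>2 * \<tau>\<^sup>2) = 4 * (v ^ 3 * moment \<Omega>)" using P h \<tau> by (simp add: field_simps)
      moreover have "v ^ 6 = v ^ 3 * v ^ 3" by (simp add: power_add[symmetric])
      ultimately show ?thesis using v h \<tau> pos by (simp add: field_simps)
    qed
    \<comment> \<open>The radius \<open>v / c\<close> is that of a ball with the volume of the
      domain. As the moment is inversely proportional to \<open>h\<^sup>2\<close>, its lower bound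
      becomes an upper bound for \<open>h\<close>; after cubing, the volume drops out and only
      \<open>h ^ 3 * real k\<close> remains.\<close>
    have "moment \<Omega> \<ge> 3 / 5 * omega3 * (v / c) ^ 5"
      using v c om by (intro mom) (auto simp: power_divide)
    then have "3 / 5 * c ^ 3 * (v / c) ^ 5 * (16 * h\<^sup>2 * \<tau>\<^sup>2) \<le> v ^ 3"
      unfolding mom_eq c(2)[symmetric] using h \<tau> by (simp add: field_simps)
    moreover have "3 / 5 * c ^ 3 * (v / c) ^ 5 * (16 * h\<^sup>2 * \<tau>\<^sup>2) = v ^ 3 * (48 / 5 * (v * h * \<tau> / c)\<^sup>2)"
      using c(1) by (simp add: power_divide power_mult_distrib power_numeral_reduce field_simps)
    ultimately have "v ^ 3 * (48 / 5 * (v * h * \<tau> / c)\<^sup>2) \<le> v ^ 3 * 1" by linarith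
    then have "48 / 5 * (v * h * \<tau> / c)\<^sup>2 \<le> 1" using v(1) by (simp only: mult_le_cancel_left_pos zero_less_power)
    then have "(v * h * \<tau> / c)\<^sup>2 \<le> 5 / 48" by simp
    then have "((v * h * \<tau> / c)\<^sup>2) ^ 3 \<le> (5 / 48) ^ 3" by (intro power_mono) auto
    moreover have "v * h * \<tau> / c = h * q * P / c ^ 2"
      using c(1) unfolding \<tau>(2) u(2) by (simp add: field_simps power2_eq_square)
    ultimately have "((h * q * P / c ^ 2)\<^sup>2) ^ 3 \<le> (5 / 48) ^ 3" by simp
    moreover have "((h * q * P / c ^ 2)\<^sup>2) ^ 3 = (h ^ 3 * q ^ 3) ^ 2 * P ^ 6 / (c ^ 3) ^ 4"
      by (simp add: power_divide power_mult_distrib power_mult[symmetric])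
    ultimately have "(h ^ 3 * real k)\<^sup>2 * P ^ 6 \<le> (5 / 48) ^ 3 * omega3 ^ 4"
      using om unfolding q(2) c(2) by (simp add: pos_divide_le_eq)
    then have "(h ^ 3 * real k)\<^sup>2 * pi\<^sup>2 \<le> (5 / 48) ^ 3 * (4 / 3) ^ 4 / 64"
      by (simp add: P_def omega3_def power_mult_distrib power_divide power_numeral_reduce field_simps)
    \<comment> \<open>The sharp bound for \<open>(2 * h) ^ 3 * real k\<close> is about 0.01902,
      while \<open>2 / 105\<close> is about 0.01905, so \<open>pi > 3\<close> would not be precise
      enough. This is where the factor \<open>2 / 105\<close> of \<open>k2\<close> is
      matched.\<close>
    moreover have "(986 / 100) \<le> pi\<^sup>2"
    proof -
      have "(3141 / 1000)\<^sup>2 \<le> pi\<^sup>2" using pi_approx by (intro power_mono) auto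
      then show ?thesis by (simp add: power2_eq_square)
    qed
    then have "(h ^ 3 * real k)\<^sup>2 * (986 / 100) \<le> (h ^ 3 * real k)\<^sup>2 * pi\<^sup>2" by (intro mult_left_mono) auto
    ultimately have "((2 * h) ^ 3 * real k)\<^sup>2 \<le> (2 / 105)\<^sup>2"
      by (simp add: power_mult_distrib power_divide)
    then have hk: "(2 * h) ^ 3 * real k \<le> 2 / 105" by (rule power2_le_imp_le) simp
    have "(2 * h) ^ 3 \<le> (2 * h) ^ 3 * real k" using k h by (simp add: mult_le_cancel_left1)
    then have h3: "(2 * h) ^ 3 \<le> 2 / 105" using hk by linarith
    have "h \<le> 15 / 100"
    proof (rule ccontr)
      assume "\<not> h \<le> 15 / 100"
      then have "(2 * (15 / 100)) ^ 3 \<le> (2 * h) ^ 3" by (intro power_mono) auto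
      then show False using h3 by (simp add: power3_eq_cube)
    qed
    then have "h\<^sup>2 \<le> (15 / 100)\<^sup>2" using h by (intro power_mono) auto
    then have h2: "h\<^sup>2 \<le> 3 / 100" by (simp add: power2_eq_square)
    have "\<exists>x. mean_pow 3 x h = 1 \<and>
        omega3 * alpha \<Omega> * \<tau> ^ (2 * l + 3) * (3 / (2 * real l + 3) * mean_pow (2 * l + 3) x h) \<le> (\<Sum>i=1..k. ev i)"
    proof (rule main[OF \<tau>(1) _ h_def])
      show "omega3 * alpha \<Omega> * \<tau> ^ 3 = real k"
        unfolding al c(2)[symmetric] q(2)[symmetric] \<tau>(2) by (simp add: power_mult_distrib)
      show "2 * h ^ 3 \<le> 1" using h3 h by (simp add: power_mult_distrib)
    qed
    then show ?thesis
      using \<tau>(1) h h2 hk q(2) \<tau>(2) mom_eq rho_eq unfolding al c(2) by metis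
  qed
  show ?thesis
  proof (intro conjI allI impI, goal_cases)
    case (1 k)
    note l = 1(1) and k = 1(2)
    from base[OF k] obtain \<tau> h x where \<tau>: "\<tau> > 0" and h: "h > 0" "h\<^sup>2 \<le> 3 / 100" and kq: "real k = (c * u * \<tau>) ^ 3"
      and I: "moment \<Omega> = v ^ 3 / (16 * h\<^sup>2 * \<tau>\<^sup>2)" and x: "mean_pow 3 x h = 1"
      and ge: "c ^ 3 * u ^ 3 * \<tau> ^ (2 * l + 3) * (3 / (2 * real l + 3) * mean_pow (2 * l + 3) x h) \<le> (\<Sum>i=1..k. ev i)" by blast
    have q: "c * u * \<tau> > 0" using c(1) u(1) \<tau> by simp
    have t1: "((2*pi)^3 / (omega3 * vol \<Omega>)) powr (2/3) * real k powr (5/3) = c ^ 3 * u ^ 3 * \<tau> ^ 5"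
    proof -
      have "(2*pi)^3 / (omega3 * vol \<Omega>) = (1 / (c * u)) ^ 3"
        using P unfolding c(2)[symmetric] v(2)[symmetric] u(2) P_def[symmetric] by (simp add: power_divide power_mult_distrib)
      moreover have "((1 / (c * u)) ^ 3) powr (2/3) = (1 / (c * u)) ^ 2"
        by (rule cube_powr_numeral) (use c u in simp)
      moreover have "((c * u * \<tau>) ^ 3) powr (5/3) = (c * u * \<tau>) ^ 5"
        by (rule cube_powr_numeral[OF q])
      ultimately show ?thesis
        unfolding kq using c(1) u(1) by (simp only:) (simp add: power_divide power_mult_distrib power_numeral_reduce field_simps)
    qed
    have t2: "vol \<Omega> / moment \<Omega> * real k = 16 * (c ^ 3 * u ^ 3 * \<tau> ^ 5) * h\<^sup>2"
      unfolding I kq v(2)[symmetric] using v(1) h \<tau> by (simp add: power_mult_distrib power_numeral_reduce field_simps)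
    have k13: "real k powr (1/3) = c * u * \<tau>" unfolding kq using cube_powr[OF q, of 1] q by simp
    have v43: "vol \<Omega> powr (4/3) = v ^ 4" unfolding v(2)[symmetric] using v(1) by (simp add: cube_powr_numeral)
    have t3: "(omega3 powr (1/3) / (2*pi))^2 * (vol \<Omega> powr (4/3) / moment \<Omega>)^2 * real k powr (1/3)
       = 256 * (c ^ 3 * u ^ 3 * \<tau> ^ 5) * h ^ 4"
      unfolding v43 k13 I c_def[symmetric] P_def[symmetric] u(2) using P u(1) h \<tau>
      by (simp add: power_mult_distrib power_divide power_numeral_reduce field_simps)
    have v133: "vol \<Omega> powr (13/3) = v ^ 13" unfolding v(2)[symmetric] using v(1) by (simp add: cube_powr_numeral)
    have km13: "real k powr (- (1/3)) = 1 / (c * u * \<tau>)" unfolding powr_minus k13 by (simp add: divide_inverse)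
    \<comment> \<open>The cube of \<open>63 / 100\<close> is 0.250047, just above one quarter. The
      last coefficient becomes \<open>659 / 6400000 * 63 / 100 * 4096\<close>, about 0.2657 and
      below the available \<open>4/15\<close>.\<close>
    have o4: "(omega3 ^ 4 / 4) powr (1/3) \<le> 63 / 100 * c ^ 4"
    proof -
      have "omega3 ^ 4 / 4 \<le> (63 / 100 * c ^ 4) ^ 3"
        unfolding c(2)[symmetric] by (simp add: power_mult_distrib power_mult[symmetric] power_divide)
      then have "(omega3 ^ 4 / 4) powr (1/3) \<le> ((63 / 100 * c ^ 4) ^ 3) powr (1/3)"
        using om by (intro powr_mono2) auto
      then show ?thesis using cube_powr[of "63 / 100 * c ^ 4" 1] c(1) by simp
    qed
    have "(omega3 ^ 4 / 4) powr (1/3) * (vol \<Omega> powr (13/3) / ((2*pi)^4 * moment \<Omega> ^ 3)) * real k powr (- (1/3))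
       \<le> (63 / 100 * c ^ 4) * (vol \<Omega> powr (13/3) / ((2*pi)^4 * moment \<Omega> ^ 3)) * real k powr (- (1/3))"
      using pos by (intro mult_right_mono o4) auto
    also have "\<dots> = 63 / 100 * 4096 * (c ^ 3 * u ^ 3 * \<tau> ^ 5) * h ^ 6"
      unfolding v133 km13 I P_def[symmetric] u(2) using P u(1) c(1) h \<tau>
      by (simp add: power_mult_distrib power_divide power_numeral_reduce field_simps)
    finally have t4: "(omega3 ^ 4 / 4) powr (1/3) * (vol \<Omega> powr (13/3) / ((2*pi)^4 * moment \<Omega> ^ 3)) * real k powr (- (1/3))
       \<le> 63 / 100 * 4096 * (c ^ 3 * u ^ 3 * \<tau> ^ 5) * h ^ 6" .
    define A where "A = c ^ 3 * u ^ 3 * \<tau> ^ 5"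
    have A: "A > 0" using c(1) u(1) \<tau> by (simp add: A_def)
    have "A * (3/5 + h\<^sup>2 - 11/15 * h ^ 4 + 4/15 * h ^ 6) \<le> A * (3/5 * mean_pow 5 x h)"
      using A by (intro mult_left_mono mean_pow_5_lower h x) auto
    also have "\<dots> \<le> (\<Sum>i=1..k. ev i)" using ge unfolding l A_def by simp
    finally have fin: "A * (3/5) + A * h\<^sup>2 - 11/15 * (A * h ^ 4) + 4/15 * (A * h ^ 6) \<le> (\<Sum>i=1..k. ev i)"
      by (simp add: algebra_simps)
    have "A * h ^ 6 \<ge> 0" using A h by simp
    then show ?case
      using fin t1 t2 t3 t4 unfolding A_def[symmetric] by (simp add: mult.assoc)
  next
    case (2 k)
    note l = 2(1) and k = 2(2)
    from base[OF k] obtain \<tau> h x where \<tau>: "\<tau> > 0" and h: "h > 0" "h\<^sup>2 \<le> 3 / 100" and kq: "real k = (c * u * \<tau>) ^ 3"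
      and I: "moment \<Omega> = v ^ 3 / (16 * h\<^sup>2 * \<tau>\<^sup>2)" and x: "mean_pow 3 x h = 1"
      and ge: "c ^ 3 * u ^ 3 * \<tau> ^ (2 * l + 3) * (3 / (2 * real l + 3) * mean_pow (2 * l + 3) x h) \<le> (\<Sum>i=1..k. ev i)" by blast
    have q: "c * u * \<tau> > 0" using c(1) u(1) \<tau> by simp
    have t1: "((2*pi)^3 / (omega3 * vol \<Omega>)) powr (4/3) * real k powr (7/3) = c ^ 3 * u ^ 3 * \<tau> ^ 7"
    proof -
      have "(2*pi)^3 / (omega3 * vol \<Omega>) = (1 / (c * u)) ^ 3"
        using P unfolding c(2)[symmetric] v(2)[symmetric] u(2) P_def[symmetric] by (simp add: power_divide power_mult_distrib)
      moreover have "((1 / (c * u)) ^ 3) powr (4/3) = (1 / (c * u)) ^ 4"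
        by (rule cube_powr_numeral) (use c u in simp)
      moreover have "((c * u * \<tau>) ^ 3) powr (7/3) = (c * u * \<tau>) ^ 7"
        by (rule cube_powr_numeral[OF q])
      ultimately show ?thesis
        unfolding kq using c(1) u(1) by (simp only:) (simp add: power_divide power_mult_distrib power_numeral_reduce field_simps)
    qed
    have o23: "omega3 powr (2/3) = c\<^sup>2" unfolding c(2)[symmetric] using c(1) by (simp add: cube_powr_numeral)
    have k53: "real k powr (5/3) = (c * u * \<tau>) ^ 5" unfolding kq using q by (simp add: cube_powr_numeral)
    have k13: "real k powr (1/3) = c * u * \<tau>" unfolding kq using cube_powr[OF q, of 1] q by simp
    have v113: "vol \<Omega> powr (11/3) = v ^ 11" unfolding v(2)[symmetric] using v(1) by (simp add: cube_powr_numeral)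
    have pP: "pi = P / 2" by (simp add: P_def)
    have t2: "pi^2 / (2 * omega3 powr (2/3)) * (vol \<Omega> powr (1/3) / moment \<Omega>) * real k powr (5/3) = 2 * (c ^ 3 * u ^ 3 * \<tau> ^ 7) * h\<^sup>2"
      unfolding o23 k53 I v_def[symmetric] u(2) pP using P u(1) c(1) h \<tau>
      by (simp add: power_mult_distrib power_divide power_numeral_reduce field_simps)
    have t3: "(vol \<Omega> / moment \<Omega>)^2 * real k = 256 * (c ^ 3 * u ^ 3 * \<tau> ^ 7) * h ^ 4"
      unfolding I kq v(2)[symmetric] using v(1) h \<tau> by (simp add: power_mult_distrib power_divide power_numeral_reduce field_simps)
    have "(vol \<Omega> powr (11/3) / ((2*pi)^2 * moment \<Omega> ^ 3)) * real k powr (1/3) = 4096 * (c * u ^ 3 * \<tau> ^ 7) * h ^ 6"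
      unfolding v113 k13 I P_def[symmetric] u(2) using P u(1) c(1) h \<tau>
      by (simp add: power_mult_distrib power_divide power_numeral_reduce field_simps)
    \<comment> \<open>This term has one factor \<open>c\<close> where the others have three;
      \<open>c \<ge> 1\<close> makes up for it. Its coefficient \<open>23 / 580608 * 4096\<close>,
      about 0.162, stays below the available \<open>12/63\<close>.\<close>
    also have "\<dots> \<le> 4096 * (c ^ 3 * u ^ 3 * \<tau> ^ 7) * h ^ 6"
      using power_increasing[of 1 3 c] o1 u(1) \<tau> h by (intro mult_right_mono mult_left_mono) auto
    finally have t4: "(vol \<Omega> powr (11/3) / ((2*pi)^2 * moment \<Omega> ^ 3)) * real k powr (1/3) \<le> 4096 * (c ^ 3 * u ^ 3 * \<tau> ^ 7) * h ^ 6" .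
    define A where "A = c ^ 3 * u ^ 3 * \<tau> ^ 7"
    have A: "A > 0" using c(1) u(1) \<tau> by (simp add: A_def)
    have "A * (3/7 + 2 * h\<^sup>2 - h ^ 4 + 12/63 * h ^ 6) \<le> A * (3/7 * mean_pow 7 x h)"
      using A by (intro mult_left_mono mean_pow_7_lower h x) auto
    also have "\<dots> \<le> (\<Sum>i=1..k. ev i)" using ge unfolding l A_def by simp
    finally have fin: "A * (3/7) + 2 * (A * h\<^sup>2) - A * h ^ 4 + 12/63 * (A * h ^ 6) \<le> (\<Sum>i=1..k. ev i)"
      by (simp add: algebra_simps)
    have "A * h ^ 6 \<ge> 0" using A h by simp
    then show ?case
      using fin t1 t2 t3 t4 unfolding A_def[symmetric] by (simp add: mult.assoc)
  next
    case (3 k)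
    note l = 3(1) and k = 3(2) and kk = 3(3)
    from base[OF k] obtain \<tau> h x where \<tau>: "\<tau> > 0" and h: "h > 0" "h\<^sup>2 \<le> 3 / 100" and hk: "(2 * h) ^ 3 * real k \<le> 2 / 105"
      and kq: "real k = (c * u * \<tau>) ^ 3" and I: "moment \<Omega> = v ^ 3 / (16 * h\<^sup>2 * \<tau>\<^sup>2)" and r: "rho \<Omega> = u ^ 3 / (2 * h * \<tau>)"
      and x: "mean_pow 3 x h = 1"
      and ge: "c ^ 3 * u ^ 3 * \<tau> ^ (2 * l + 3) * (3 / (2 * real l + 3) * mean_pow (2 * l + 3) x h) \<le> (\<Sum>i=1..k. ev i)" by blast
    have q: "c * u * \<tau> > 0" using c u \<tau> by simp
    define C U T where "C = c ^ (2 * l)" and "U = u ^ (2 * l)" and "T = \<tau> ^ (2 * l)"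
    have CUT: "C > 0" "U > 0" "T > 0" using c u \<tau> by (simp_all add: C_def U_def T_def)
    define e where "e = 2 * h"
    define A where "A = c ^ 3 * u ^ 3 * (T * \<tau> ^ 3)"
    have A: "A > 0" using c(1) u(1) \<tau> CUT by (simp add: A_def)
    have qU: "(c * u * \<tau>) ^ (2 * l) = C * U * T" by (simp add: C_def U_def T_def power_mult_distrib)
    \<comment> \<open>Each exponent is split into \<open>2 * l\<close> and a fixed number
      \<open>j\<close>. The powers with exponent \<open>2 * l\<close> are collected in
      \<open>C\<close>, \<open>U\<close> and \<open>T\<close>; the first two cancel in every term,
      and \<open>T\<close> goes into the common factor \<open>A\<close>.\<close>
    have kp: "real k powr ((2 * real l + real j) / 3) = C * U * T * (c * u * \<tau>) ^ j" for j
      unfolding kq by (simp only: cube_powr_add[OF q] qU)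
    have km: "real k powr ((2 * real l - real j) / 3) = C * U * T / (c * u * \<tau>) ^ j" for j
      unfolding kq by (simp only: cube_powr_diff[OF q] qU)
    have cm: "omega3 powr ((2 * real l - real j) / 3) = C / c ^ j" for j
      unfolding c(2)[symmetric] by (simp only: cube_powr_diff[OF c(1)] C_def)
    have am: "alpha \<Omega> powr ((real j - 2 * real l) / 3) = u ^ j / U" for j
      unfolding al by (simp only: cube_powr_diff'[OF u(1)] U_def)
    have pP: "pi = P / 2" by (simp add: P_def)
    have t1: "3 / ((2 * real l + 3) * omega3 powr (2 * real l / 3)) * alpha \<Omega> powr (- (2 * real l / 3)) * real k powr ((2 * real l + 3) / 3)
      = A * (3 / (2 * real l + 3))"
      using cm[of 0] am[of 0] kp[of 3] c(1) u(1) CUT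
      by (simp add: A_def power_mult_distrib)
    have t2: "4 * real l * pi^6 / (vol \<Omega> * moment \<Omega> * omega3 powr ((2 * real l - 2) / 3))
              * alpha \<Omega> powr ((8 - 2 * real l) / 3) * real k powr ((2 * real l + 1) / 3) = A * (real l * h\<^sup>2)"
      using c(1) u(1) P h \<tau> CUT
      unfolding cm[of 2, simplified] am[of 8, simplified] kp[of 1, simplified] I v(2)[symmetric] u(2) pP
      by (simp add: A_def power_mult_distrib power_divide power_numeral_reduce field_simps)
    have t3: "(real l + 1)^2 / (2 * omega3 powr ((2 * real l - 3) / 3) * rho \<Omega> ^ 3)
              * alpha \<Omega> powr ((12 - 2 * real l) / 3) * real k powr (2 * real l / 3) = A * ((real l + 1)\<^sup>2 / 2 * e ^ 3)"
      using c(1) u(1) h \<tau> CUT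
      unfolding cm[of 3, simplified] am[of 12, simplified] kp[of 0, simplified] r e_def
      by (simp add: A_def power_mult_distrib power_divide power_numeral_reduce)
    have t4: "(3 * real l - 2) * (2 * real l + 1) * (real l + 1) / (24 * omega3 powr ((2 * real l - 4) / 3) * rho \<Omega> ^ 4)
              * alpha \<Omega> powr ((16 - 2 * real l) / 3) * real k powr ((2 * real l - 1) / 3)
       = A * ((3 * real l - 2) * (2 * real l + 1) * (real l + 1) / 24 * e ^ 4)"
      using c(1) u(1) h \<tau> CUT
      unfolding cm[of 4, simplified] am[of 16, simplified] km[of 1, simplified] r e_def
      by (simp add: A_def power_mult_distrib power_divide power_numeral_reduce)
    have t5: "(2 * real l + 1) * (2 * real l - 1) * (real l + 1) / (24 * omega3 powr ((2 * real l - 5) / 3) * rho \<Omega> ^ 5)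
              * alpha \<Omega> powr ((20 - 2 * real l) / 3) * real k powr ((2 * real l - 2) / 3)
       = A * ((2 * real l + 1) * (2 * real l - 1) * (real l + 1) / 24 * e ^ 5)"
      using c(1) u(1) h \<tau> CUT
      unfolding cm[of 5, simplified] am[of 20, simplified] km[of 2, simplified] r e_def
      by (simp add: A_def power_mult_distrib power_divide power_numeral_reduce)
    \<comment> \<open>By \<open>hk\<close> the product \<open>e ^ 3 * real k\<close> is at most
      \<open>2 / 105\<close>, the same factor as in \<open>k2\<close>. It cancels, and a cube root
      turns the assumption on \<open>k\<close> into a bound on \<open>e * (l + 1)\<close>.\<close>
    have "2 / 105 * ((real l + 1) / 2) ^ 3 \<le> real k" using k2_ge[of l] l kk by simp
    then have "e ^ 3 * (2 / 105 * ((real l + 1) / 2) ^ 3) \<le> e ^ 3 * real k"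
      using h by (intro mult_left_mono) (auto simp: e_def)
    also have "\<dots> \<le> 2 / 105" using hk by (simp add: e_def)
    finally have "(e * ((real l + 1) / 2)) ^ 3 \<le> 1" by (subst power_mult_distrib) simp
    then have "e * ((real l + 1) / 2) \<le> 1"
      using h by (subst (asm) power_le_one_iff) (auto simp: e_def)
    then have el: "e * (real l + 1) \<le> 2" by (simp add: field_simps)
    \<comment> \<open>The exponent \<open>2 * l + 3\<close> is at least 9 because
      \<open>l \<ge> 3\<close>. After multiplication by \<open>3 / (2 * l + 3)\<close> the
      coefficient of \<open>h\<^sup>2\<close> is exactly \<open>l\<close>, that of the second term
      of the claim; the remaining three terms together are nonpositive.\<close>
    have "1 + real (2 * l + 3) * (real (2 * l + 3) - 3) / 6 * h\<^sup>2 \<le> mean_pow (2 * l + 3) x h"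
      using l by (intro mean_pow_lower h x) auto
    then have "3 / (2 * real l + 3) * (1 + (2 * real l + 3) * (2 * real l) / 6 * h\<^sup>2) \<le> 3 / (2 * real l + 3) * mean_pow (2 * l + 3) x h"
      by (intro mult_left_mono) auto
    moreover have "3 / (2 * real l + 3) * (1 + (2 * real l + 3) * (2 * real l) / 6 * h\<^sup>2) = 3 / (2 * real l + 3) + real l * h\<^sup>2"
      by (simp add: divide_simps) (simp add: algebra_simps)
    ultimately have m: "3 / (2 * real l + 3) + real l * h\<^sup>2 \<le> 3 / (2 * real l + 3) * mean_pow (2 * l + 3) x h" by simp
    have n: "- (real l + 1)\<^sup>2 / 2 * e ^ 3 + (3 * real l - 2) * (2 * real l + 1) * (real l + 1) / 24 * e ^ 4
      - (2 * real l + 1) * (2 * real l - 1) * (real l + 1) / 24 * e ^ 5 \<le> 0"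
      using l h by (intro higher_terms_nonpos el) (auto simp: e_def)
    have "A * (3 / (2 * real l + 3)) + A * (real l * h\<^sup>2) - A * ((real l + 1)\<^sup>2 / 2 * e ^ 3)
       + A * ((3 * real l - 2) * (2 * real l + 1) * (real l + 1) / 24 * e ^ 4)
       - A * ((2 * real l + 1) * (2 * real l - 1) * (real l + 1) / 24 * e ^ 5)
       = A * (3 / (2 * real l + 3) + real l * h\<^sup>2 + (- (real l + 1)\<^sup>2 / 2 * e ^ 3 + (3 * real l - 2) * (2 * real l + 1) * (real l + 1) / 24 * e ^ 4
      - (2 * real l + 1) * (2 * real l - 1) * (real l + 1) / 24 * e ^ 5))"
      by (simp only: distrib_left right_diff_distrib minus_divide_left[symmetric] mult_minus_left mult_minus_right) 
    also have "\<dots> \<le> A * (3 / (2 * real l + 3) * mean_pow (2 * l + 3) x h)"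
      using mult_left_mono[OF add_mono[OF m n] less_imp_le[OF A]] by (simp only: add_0_right)
    also have "\<dots> \<le> (\<Sum>i=1..k. ev i)" using ge by (simp add: A_def T_def power_add)
    finally show ?case unfolding t1 t2 t3 t4 t5 .
  qed
qed

end
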